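(* Let $1<p<\infty$ and, for $n\in\mathbb N$, let $n^{1/p}\mathbb B_p^n=\{x\in\mathbb R^n:|x_1|^p+\cdots+|x_n|^p\le n\}$. Then, as $n\to\infty$, $$ \sup_{j\in\{0,\dots,n\}}\left|\frac1n\log V_j(n^{1/p}\mathbb B_p^n)-g_p\!\left(\frac jn\right)\right|\to 0, $$ where $$ g_p(\alpha):=\kappa_p(\alpha)+\sup_{\theta>0}\Psi_{p,\alpha}(\theta),\qquad\alpha\in[0,1], $$ $$ \Psi_{p,\alpha}(\theta)=\frac{1-\alpha}{2}\log\theta+\alpha\log\mathcal I_p(\theta)+(1-\alpha)\log\mathcal J_p(\theta),\qquad\theta>0, $$ and $$ \kappa_p(\alpha):=\frac\alpha p\Bigl(1-\log\frac\alpha p\Bigr)+(1-\alpha)\log(p-1)-\alpha\log\alpha-(1-\alpha)\log(1-\alpha)-\frac{1-\alpha}{2}\log\pi, $$ with the convention $0\log 0=0$.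
   Context: For a convex body $K\subset\mathbb R^n$, the intrinsic volumes $V_0(K),\dots,V_n(K)$ are defined by the Steiner formula $\mathrm{Vol}_n(K+t\mathbb B_2^n)=\sum_{j=0}^n\kappa_{n-j}V_j(K)t^{n-j}$, $t\ge 0$, where $\mathbb B_2^n$ is the Euclidean unit ball and $\kappa_m=\mathrm{Vol}_m(\mathbb B_2^m)$ (the numbers $\kappa_m$ are unrelated to the function $\kappa_p(\alpha)$). For $\theta\ge 0$: $\mathcal I_p(\theta)=\int_{\mathbb R}e^{-|x|^p-\theta|x|^{2p-2}}dx$ and $\mathcal J_p(\theta)=\int_{\mathbb R}|x|^{p-2}e^{-|x|^p-\theta|x|^{2p-2}}dx$. *)

theory Defs
  imports "HOL-Analysis.Analysis"
begin

text \<open>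
  The dimension \<open>n\<close> tends to infinity, so it cannot be a type. A point of \<open>\<real>\<^sup>n\<close> is an extensional
  function on \<open>{..<n}\<close>, i.e. an element of the space of the \<open>n\<close>-fold product of \<open>lborel\<close>.
\<close>

definition lborel_n :: "nat \<Rightarrow> (nat \<Rightarrow> real) measure" where
  "lborel_n n = Pi\<^sub>M {..<n} (\<lambda>_. lborel)"

definition vol :: "nat \<Rightarrow> (nat \<Rightarrow> real) set \<Rightarrow> real" where
  "vol n K = measure (lborel_n n) K"

definition euclidean_ball :: "nat \<Rightarrow> (nat \<Rightarrow> real) set" where
  "euclidean_ball n = {x \<in> {..<n} \<rightarrow>\<^sub>E UNIV. (\<Sum>i<n. (x i)\<^sup>2) \<le> 1}"

definition kappa :: "nat \<Rightarrow> real" where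
  "kappa m = vol m (euclidean_ball m)"

text \<open>The Minkowski sum of \<open>K\<close> and \<open>t\<close> times the Euclidean unit ball.\<close>

definition parallel_body :: "nat \<Rightarrow> (nat \<Rightarrow> real) set \<Rightarrow> real \<Rightarrow> (nat \<Rightarrow> real) set" where
  "parallel_body n K t = {\<lambda>i\<in>{..<n}. x i + t * y i | x y. x \<in> K \<and> y \<in> euclidean_ball n}"

definition steiner_formula :: "nat \<Rightarrow> (nat \<Rightarrow> real) set \<Rightarrow> (nat \<Rightarrow> real) \<Rightarrow> bool" where
  "steiner_formula n K V \<longleftrightarrow>
     (\<forall>t\<ge>0. vol n (parallel_body n K t) = (\<Sum>j=0..n. kappa (n - j) * V j * t ^ (n - j)))"

text \<open>
  Every convex body \<open>K\<close> in \<open>\<real>\<^sup>n\<close> admits coefficients satisfying the Steiner formula, and by the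
  lemma \<open>intrinsic_volume_eqI\<close> below they are unique for \<open>j \<le> n\<close>. Other sets, and other
  indices, may get an unspecified value.
\<close>

definition intrinsic_volume :: "nat \<Rightarrow> (nat \<Rightarrow> real) set \<Rightarrow> nat \<Rightarrow> real" where
  "intrinsic_volume n K j = (THE v. \<exists>V. steiner_formula n K V \<and> v = V j)"

lemma kappa_eq_unit_ball_vol: "kappa m = unit_ball_vol (real m)"
proof -
  have "euclidean_ball m =
      {f. sqrt (\<Sum>i\<in>{..<m}. (f i)\<^sup>2) \<le> 1} \<inter> space (Pi\<^sub>M {..<m} (\<lambda>_. lborel :: real measure))"
    by (auto simp: euclidean_ball_def space_PiM)
  then show ?thesis
    using emeasure_cball_aux[of "{..<m}" 1]
    by (simp add: kappa_def vol_def lborel_n_def measure_def)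
qed

lemma steiner_formula_unique:
  assumes "steiner_formula n K V" "steiner_formula n K W" "j \<le> n"
  shows "V j = W j"
proof -
  define c where "c i = kappa i * (V (n - i) - W (n - i))" for i
  have zero: "(\<Sum>i\<le>n. c i * t ^ i) = 0" if "t \<ge> 0" for t
  proof -
    have "(\<Sum>j=0..n. kappa (n - j) * V j * t ^ (n - j)) =
          (\<Sum>j=0..n. kappa (n - j) * W j * t ^ (n - j))"
      using assms that by (simp add: steiner_formula_def)
    then have "(\<Sum>j=0..n. c (n - j) * t ^ (n - j)) = 0"
      by (simp add: c_def algebra_simps sum_subtractf)
    moreover have "(\<Sum>j=0..n. c (n - j) * t ^ (n - j)) = (\<Sum>i\<le>n. c i * t ^ i)"
      by (rule sum.reindex_bij_witness[of _ "\<lambda>i. n - i" "\<lambda>i. n - i"]) auto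
    ultimately show ?thesis by simp
  qed
  have "{0..} \<subseteq> {t::real. (\<Sum>i\<le>n. c i * t ^ i) = 0}"
    using zero by auto
  then have "infinite {t::real. (\<Sum>i\<le>n. c i * t ^ i) = 0}"
    using infinite_Ici finite_subset by blast
  then have "c (n - j) = 0"
    using Transcendental.polyfun_finite_roots[of c n] by auto
  moreover have "kappa (n - j) > 0"
    by (simp add: kappa_eq_unit_ball_vol)
  ultimately show ?thesis
    using assms(3) by (simp add: c_def)
qed

lemma intrinsic_volume_eqI:
  assumes "steiner_formula n K V" "j \<le> n"
  shows "intrinsic_volume n K j = V j"
  unfolding intrinsic_volume_def
  using assms steiner_formula_unique by (intro the_equality) blast+

text \<open>The set \<open>n\<^bsup>1/p\<^esup> B\<^sub>p\<^sup>n\<close>.\<close>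

definition scaled_lp_ball :: "real \<Rightarrow> nat \<Rightarrow> (nat \<Rightarrow> real) set" where
  "scaled_lp_ball p n = {x \<in> {..<n} \<rightarrow>\<^sub>E UNIV. (\<Sum>i<n. \<bar>x i\<bar> powr p) \<le> real n}"

definition I_fun :: "real \<Rightarrow> real \<Rightarrow> real" where
  "I_fun p \<theta> = (LINT x|lborel. exp (- (\<bar>x\<bar> powr p) - \<theta> * \<bar>x\<bar> powr (2 * p - 2)))"

definition J_fun :: "real \<Rightarrow> real \<Rightarrow> real" where
  "J_fun p \<theta> =
     (LINT x|lborel. \<bar>x\<bar> powr (p - 2) * exp (- (\<bar>x\<bar> powr p) - \<theta> * \<bar>x\<bar> powr (2 * p - 2)))"

definition Psi :: "real \<Rightarrow> real \<Rightarrow> real \<Rightarrow> real" where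
  "Psi p \<alpha> \<theta> = (1 - \<alpha>) / 2 * ln \<theta> + \<alpha> * ln (I_fun p \<theta>) + (1 - \<alpha>) * ln (J_fun p \<theta>)"

text \<open>The convention \<open>0 log 0 = 0\<close> is automatic, since \<open>ln\<close> is total.\<close>

definition kappa_fun :: "real \<Rightarrow> real \<Rightarrow> real" where
  "kappa_fun p \<alpha> = \<alpha> / p * (1 - ln (\<alpha> / p)) + (1 - \<alpha>) * ln (p - 1)
     - \<alpha> * ln \<alpha> - (1 - \<alpha>) * ln (1 - \<alpha>) - (1 - \<alpha>) / 2 * ln pi"

text \<open>
  For \<open>p > 1\<close> and \<open>0 \<le> \<alpha> \<le> 1\<close> the real supremum below is over a set bounded above:
  \<open>I_fun p \<theta> \<le> I_fun p 0\<close>, and dropping \<open>\<bar>x\<bar>\<^sup>p\<close> from the exponent and rescaling \<open>x\<close> shows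
  that \<open>sqrt \<theta> * J_fun p \<theta>\<close> is at most a constant depending on \<open>p\<close> only.
\<close>

definition g_fun :: "real \<Rightarrow> real \<Rightarrow> real" where
  "g_fun p \<alpha> = kappa_fun p \<alpha> + (SUP \<theta>\<in>{0<..}. Psi p \<alpha> \<theta>)"

end

theory Submission
  imports Defs
begin

text \<open>
  Write \<open>N x\<close> for the sum of the \<open>\<bar>x i\<bar> powr p\<close> and \<open>v x\<close> for its gradient divided by \<open>p\<close>. A point \<open>y\<close> outside the
  sublevel set \<open>N \<le> R\<close> is \<open>x + c v(x)\<close> for a unique \<open>c > 0\<close> and \<open>x\<close> with \<open>N x = R\<close>, and \<open>x\<close> is its nearest
  point, at distance \<open>c\<bar>v(x)\<bar>\<close>. For fixed \<open>c\<close> the map \<open>x \<mapsto> x + c v(x)\<close> acts coordinatewise, so its Jacobian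
  is a product. Averaging the volume of the outer parallel shells over all levels \<open>R\<close> with weight \<open>exp (- R)\<close>
  and substituting first \<open>R\<close> by \<open>c\<close> and then \<open>y\<close> by \<open>x\<close> yields integrals over the whole space in place of surface
  integrals. A shell width proportional to \<open>R powr (1/p)\<close> gives the Steiner polynomial; a Gaussian average over
  constant widths makes the integrand a product and gives its coefficients: up to explicit factors,
  \<open>V\<^sub>j\<close> is the integral over \<open>\<theta> > 0\<close> of \<open>exp (n \<Psi>(\<theta>)) \<cdot> (- I'(\<theta>)) / (\<theta> J(\<theta>))\<close> with \<open>\<Psi> = Psi p (j/n)\<close>.
  Laplace's method then applies uniformly in \<open>j\<close>: scaling the integration variable shows that \<open>I\<close> and \<open>J\<close> lose
  at most a power of \<open>d\<close> between \<open>\<theta>\<close> and \<open>d \<theta>\<close>, and the supremum of \<open>Psi p \<alpha>\<close> is convex, hence continuous, in \<open>\<alpha>\<close>.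
\<close>

section \<open>Substitution in one and several variables\<close>

text \<open>Both kinds of width are needed. Widths proportional to \<open>R powr (1/p)\<close> make
  all shells homothetic, so that polynomial dependence on the width can be read off; but the
  coefficients come out as integrals of powers of \<open>R powr (1/p)\<close> divided by the length
  of v(x), which do not factorize. Constant widths with Gaussian averaging factorize, but they
  identify the coefficients, by comparing powers of z, only once the shell volume is known to be a
  polynomial. This has to be proved, since \<open>intrinsic_volume\<close> is defined through the
  Steiner formula. Surface and curvature measures are avoided because for p < 2 the curvature of the
  boundary is infinite where a coordinate vanishes. In an integral over the whole space this is
  merely a factor with exponent p - 2, integrable because p > 1; its integral is J. The Gaussian
  average contributes Gamma ((n - j) / 2 + 1), which turns \<open>kappa (n - j)\<close> into a power
  of pi; the powers of R contribute Gamma (j / p + 1), and the binomial theorem a binomial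
  coefficient. The leading Stirling terms of these factors, with the remaining powers, make up
  \<open>kappa_fun\<close>.\<close>

lemma nn_integral_subst_halfline:
  fixes f :: "real \<Rightarrow> ennreal"
  assumes f [measurable]: "f \<in> borel_measurable borel"
    and deriv: "\<And>x. x > 0 \<Longrightarrow> (g has_real_derivative g' x) (at x)"
    and cont: "continuous_on {0<..} g'"
    and pos: "\<And>x. x > 0 \<Longrightarrow> g' x > 0"
    and image: "g ` {0<..} = S"
  shows "(\<integral>\<^sup>+x. f x * indicator S x \<partial>lborel) =
         (\<integral>\<^sup>+x\<in>{0<..}. f (g x) * ennreal (g' x) \<partial>lborel)"
proof -
  \<comment> \<open>The substitution rule for compact intervals is applied on [a k, b k] and passed
    to the limit by continuity from below, because \<open>g'\<close> may blow up at 0. The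
    derivative of \<open>expand\<close> does so for p < 2.\<close>
  define a b :: "nat \<Rightarrow> real" where "a k = 1 / (real k + 2)" and "b k = real k + 2" for k
  have ab: "0 < a k" "a k < b k" for k
  proof -
    have "a k \<le> 1" "b k > 1" by (auto simp: a_def b_def)
    then show "a k < b k" by simp
  qed (simp add: a_def)
  have mono: "g x < g y" if "0 < x" "x < y" for x y
    using that deriv pos by (intro DERIV_pos_imp_increasing[of x y g]) (meson less_le_trans)+
  then have mono': "g x \<le> g y" if "0 < x" "x \<le> y" for x y
    using that by (cases "x = y") (auto intro: less_imp_le)
  have contg: "continuous_on {0<..} g"
    by (rule DERIV_continuous_on) (use deriv in \<open>auto intro: DERIV_subset\<close>)
  have sub: "{a k..b k} \<subseteq> {0<..}" for k
    using ab(1)[of k] by auto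
  have img: "g ` {a k..b k} = {g (a k)..g (b k)}" for k
  proof
    show "{g (a k)..g (b k)} \<subseteq> g ` {a k..b k}"
    proof
      fix y assume "y \<in> {g (a k)..g (b k)}"
      then have "\<exists>x\<ge>a k. x \<le> b k \<and> g x = y"
        using ab[of k] continuous_on_subset[OF contg sub] by (intro IVT') auto
      then show "y \<in> g ` {a k..b k}" by auto
    qed
    show "g ` {a k..b k} \<subseteq> {g (a k)..g (b k)}"
      using ab[of k] by (auto intro!: mono')
  qed
  have Un: "(\<Union>k. {a k..b k}) = {0<..}"
  proof (intro equalityI subsetI)
    fix x :: real assume "x \<in> {0<..}"
    then have x: "x > 0" by simp
    obtain k where "max x (1/x) \<le> real k" using real_arch_simple by blast
    then have "x \<le> b k" "1 / x \<le> real k + 2" by (auto simp: b_def)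
    then have "x \<in> {a k..b k}" using x by (auto simp: a_def field_simps)
    then show "x \<in> (\<Union>k. {a k..b k})" by blast
  qed (use sub in blast)
  have inc: "incseq (\<lambda>k. {a k..b k})"
    by (auto simp: incseq_def a_def b_def intro: order_trans[rotated] frac_le elim!: order_trans[rotated])
  have S: "(\<Union>k. {g (a k)..g (b k)}) = S"
    unfolding img[symmetric] image[symmetric] Un[symmetric] by blast
  have incS: "incseq (\<lambda>k. {g (a k)..g (b k)})"
    using inc unfolding img[symmetric] incseq_def by (meson image_mono)
  define h where "h = (\<lambda>x. f (g x) * ennreal (g' x) * indicator {0<..} x)"
  have g_meas: "(\<lambda>x. g x * indicator {0<..} x) \<in> borel_measurable borel"
    using borel_measurable_continuous_on_indicator[OF _ contg] by (simp add: mult.commute)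
  have g'_meas: "(\<lambda>x. g' x * indicator {0<..} x) \<in> borel_measurable borel"
    using borel_measurable_continuous_on_indicator[OF _ cont] by (simp add: mult.commute)
  have h_meas [measurable]: "h \<in> borel_measurable borel"
  proof -
    have "h = (\<lambda>x. f (g x * indicator {0<..} x) * ennreal (g' x * indicator {0<..} x) * indicator {0<..} x)"
      by (auto simp: indicator_def h_def)
    then show ?thesis using g_meas g'_meas by simp
  qed
  have 1: "(\<lambda>k. emeasure (density lborel f) {g (a k)..g (b k)}) \<longlonglongrightarrow> emeasure (density lborel f) S"
    unfolding S[symmetric] by (intro Lim_emeasure_incseq incS) auto
  have 2: "(\<lambda>k. emeasure (density lborel h) {a k..b k}) \<longlonglongrightarrow> emeasure (density lborel h) {0<..}"
    unfolding Un[symmetric] by (intro Lim_emeasure_incseq inc) auto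
  have "emeasure (density lborel f) {g (a k)..g (b k)} = emeasure (density lborel h) {a k..b k}" for k
  proof -
    have pos_k: "x > 0" if "x \<in> {a k..b k}" for x using that ab(1)[of k] by auto
    have "(\<integral>\<^sup>+x. f x * indicator {g (a k)..g (b k)} x \<partial>lborel) =
             (\<integral>\<^sup>+x. f (g x) * g' x * indicator {a k..b k} x \<partial>lborel)"
      using pos_k by (intro nn_integral_substitution_aux f deriv continuous_on_subset[OF cont sub]
          less_imp_le[OF pos] ab) auto
    also have "\<dots> = (\<integral>\<^sup>+x. h x * indicator {a k..b k} x \<partial>lborel)"
      using pos_k by (intro nn_integral_cong) (auto simp: h_def indicator_def)
    finally show ?thesis by (simp add: emeasure_density)
  qed
  then have eq: "emeasure (density lborel f) S = emeasure (density lborel h) {0<..}"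
    using 1 2 LIMSEQ_unique by simp
  have [measurable]: "S \<in> sets borel"
    unfolding S[symmetric] by measurable
  have "(\<integral>\<^sup>+x\<in>{0<..}. h x \<partial>lborel) = (\<integral>\<^sup>+x. h x \<partial>lborel)"
    by (intro nn_integral_cong) (auto simp: h_def indicator_def)
  then have "emeasure (density lborel h) {0<..} = (\<integral>\<^sup>+x. h x \<partial>lborel)"
    by (simp add: emeasure_density)
  then show ?thesis
    using eq by (simp add: emeasure_density) (simp add: h_def)
qed

lemma nn_integral_split_sign:
  fixes f :: "real \<Rightarrow> ennreal"
  assumes [measurable]: "f \<in> borel_measurable borel"
  shows "(\<integral>\<^sup>+x. f x \<partial>lborel) = (\<integral>\<^sup>+x\<in>{0<..}. (f x + f (- x)) \<partial>lborel)"
proof -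
  have "(\<integral>\<^sup>+x. f x \<partial>lborel) =
      (\<integral>\<^sup>+x. f x * indicator {0<..} x + f x * indicator {..<0} x \<partial>lborel)"
    using AE_lborel_singleton[of 0]
    by (intro nn_integral_cong_AE) (auto elim!: eventually_mono simp: indicator_def)
  also have "\<dots> = (\<integral>\<^sup>+x\<in>{0<..}. f x \<partial>lborel) + (\<integral>\<^sup>+x. f x * indicator {..<0} x \<partial>lborel)"
    by (intro nn_integral_add) auto
  also have "(\<integral>\<^sup>+x. f x * indicator {..<0} x \<partial>lborel) = (\<integral>\<^sup>+x\<in>{0<..}. f (- x) \<partial>lborel)"
    by (subst nn_integral_real_affine[of _ "-1" 0]) (auto simp: indicator_def intro!: nn_integral_cong)
  also have "(\<integral>\<^sup>+x\<in>{0<..}. f x \<partial>lborel) + \<dots> =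
      (\<integral>\<^sup>+x. f x * indicator {0<..} x + f (- x) * indicator {0<..} x \<partial>lborel)"
    by (intro nn_integral_add[symmetric]) auto
  finally show ?thesis by (simp add: distrib_right)
qed

text \<open>Reflecting the negative half-line reduces the claim to the half-line rule, applied to f
  x + f (- x). The point 0, at which no derivative is required, is a null set.\<close>

lemma nn_integral_subst_odd:
  fixes f :: "real \<Rightarrow> ennreal"
  assumes f [measurable]: "f \<in> borel_measurable borel"
    and [measurable]: "g \<in> borel_measurable borel" "g' \<in> borel_measurable borel"
    and deriv: "\<And>x. x > 0 \<Longrightarrow> (g has_real_derivative g' x) (at x)"
    and cont: "continuous_on {0<..} g'"
    and pos: "\<And>x. x > 0 \<Longrightarrow> g' x > 0"
    and image: "g ` {0<..} = {0<..}"
    and odd: "\<And>x. g (- x) = - g x"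
    and even: "\<And>x. g' (- x) = g' x"
  shows "(\<integral>\<^sup>+x. f x \<partial>lborel) = (\<integral>\<^sup>+x. f (g x) * ennreal (g' x) \<partial>lborel)"
proof -
  have "(\<integral>\<^sup>+x. f x \<partial>lborel) = (\<integral>\<^sup>+x\<in>{0<..}. (f x + f (- x)) \<partial>lborel)"
    by (rule nn_integral_split_sign) simp
  also have "\<dots> = (\<integral>\<^sup>+x\<in>{0<..}. (f (g x) + f (- g x)) * ennreal (g' x) \<partial>lborel)"
    by (rule nn_integral_subst_halfline) (use deriv cont pos image in auto)
  also have "\<dots> = (\<integral>\<^sup>+x. f (g x) * ennreal (g' x) \<partial>lborel)"
    by (subst nn_integral_split_sign) (auto simp: odd even distrib_right)
  finally show ?thesis .
qed

lemma product_sigma_finite_lborel: "product_sigma_finite (\<lambda>_::nat. lborel :: real measure)"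
  by standard

lemma sigma_finite_lborel_n: "sigma_finite_measure (lborel_n n)"
  unfolding lborel_n_def by (intro product_sigma_finite.sigma_finite product_sigma_finite_lborel) simp

lemma measurable_lborel_n_component:
  "i < n \<Longrightarrow> f \<in> M \<rightarrow>\<^sub>M lborel_n n \<Longrightarrow> (\<lambda>w. f w i) \<in> borel_measurable M"
  unfolding lborel_n_def
  by (rule measurable_compose[of f M "Pi\<^sub>M {..<n} (\<lambda>_. lborel)" "\<lambda>x. x i"])
     (auto intro: measurable_component_singleton)

lemma measurable_lborel_n_coordinate [measurable (raw)]:
  "i < n \<Longrightarrow> (\<lambda>x. x i) \<in> borel_measurable (lborel_n n)"
  using measurable_lborel_n_component[of i n "\<lambda>x. x"] by simp

lemma measurable_lborel_n_restrict:
  assumes "\<And>i. i < n \<Longrightarrow> (\<lambda>w. f w i) \<in> borel_measurable M"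
  shows "(\<lambda>w. \<lambda>i\<in>{..<n}. f w i) \<in> M \<rightarrow>\<^sub>M lborel_n n"
  unfolding lborel_n_def using assms by (intro measurable_restrict) auto

lemma space_lborel_n: "space (lborel_n n) = {..<n} \<rightarrow>\<^sub>E UNIV"
  by (simp add: lborel_n_def space_PiM)

lemma nn_integral_lborel_n_prod:
  assumes "\<And>i. i < n \<Longrightarrow> f i \<in> borel_measurable borel"
  shows "(\<integral>\<^sup>+x. (\<Prod>i<n. f i (x i)) \<partial>lborel_n n) = (\<Prod>i<n. \<integral>\<^sup>+x. f i x \<partial>lborel)"
  unfolding lborel_n_def
  by (rule product_sigma_finite.product_nn_integral_prod[OF product_sigma_finite_lborel]) (use assms in auto)

text \<open>The image of the measure with the product density under the coordinatewise map agrees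
  with the product Lebesgue measure on boxes, hence everywhere. So the one-dimensional rule is the
  only input, and no determinant has to be computed.\<close>

lemma nn_integral_lborel_n_subst:
  fixes \<phi> :: "(nat \<Rightarrow> real) \<Rightarrow> ennreal"
  assumes \<phi>: "\<phi> \<in> borel_measurable (lborel_n n)"
    and g [measurable]: "g \<in> borel_measurable borel" "g' \<in> borel_measurable borel"
    and subst: "\<And>f. f \<in> borel_measurable borel \<Longrightarrow>
      (\<integral>\<^sup>+x. f x \<partial>lborel) = (\<integral>\<^sup>+x. f (g x) * ennreal (g' x) \<partial>lborel)"
  shows "(\<integral>\<^sup>+y. \<phi> y \<partial>lborel_n n) =
    (\<integral>\<^sup>+x. \<phi> (\<lambda>i\<in>{..<n}. g (x i)) * (\<Prod>i<n. ennreal (g' (x i))) \<partial>lborel_n n)"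
proof -
  define T where "T = (\<lambda>x. \<lambda>i\<in>{..<n}. g (x i))"
  define w where "w = (\<lambda>x. \<Prod>i<n. ennreal (g' (x i)))"
  have T [measurable]: "T \<in> lborel_n n \<rightarrow>\<^sub>M lborel_n n"
    unfolding T_def by (rule measurable_lborel_n_restrict) measurable
  have w [measurable]: "w \<in> borel_measurable (lborel_n n)"
    unfolding w_def by measurable
  have "distr (density (lborel_n n) w) (lborel_n n) T = Pi\<^sub>M {..<n} (\<lambda>_. lborel)"
  proof (rule product_sigma_finite.PiM_eqI[OF product_sigma_finite_lborel])
    fix A :: "nat \<Rightarrow> real set" assume A: "\<And>i. i \<in> {..<n} \<Longrightarrow> A i \<in> sets lborel"
    have [measurable]: "Pi\<^sub>E {..<n} A \<in> sets (lborel_n n)"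
      unfolding lborel_n_def using A by (intro sets_PiM_I_finite) auto
    have ind: "indicator (A i) \<in> borel_measurable borel" if "i < n" for i
      using A[of i] that by simp
    have "emeasure (distr (density (lborel_n n) w) (lborel_n n) T) (Pi\<^sub>E {..<n} A) =
        (\<integral>\<^sup>+x. (\<Prod>i<n. indicator (A i) (g (x i)) * ennreal (g' (x i))) \<partial>lborel_n n)"
    proof -
      have "(\<Prod>i<n. indicator (A i) (g (x i)) :: ennreal) = indicator (T -` Pi\<^sub>E {..<n} A \<inter> space (lborel_n n)) x"
        if "x \<in> space (lborel_n n)" for x
      proof (cases "\<forall>i<n. g (x i) \<in> A i")
        case False
        then obtain i where "i < n" "g (x i) \<notin> A i" by blast
        then have "T x \<notin> Pi\<^sub>E {..<n} A" and "(\<Prod>i<n. indicator (A i) (g (x i)) :: ennreal) = 0"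
          by (auto simp: T_def dest!: PiE_mem[of _ _ _ i] intro!: prod_zero bexI[of _ i])
        then show ?thesis by simp
      qed (use that in \<open>auto simp: T_def\<close>)
      then show ?thesis
        by (simp add: emeasure_distr emeasure_density prod.distrib w_def mult.commute cong: nn_integral_cong)
    qed
    also have "\<dots> = (\<Prod>i<n. \<integral>\<^sup>+x. indicator (A i) (g x) * ennreal (g' x) \<partial>lborel)"
      using ind by (intro nn_integral_lborel_n_prod borel_measurable_times_ennreal
          measurable_compose[OF g(1)]) auto
    also have "\<dots> = (\<Prod>i<n. \<integral>\<^sup>+x. indicator (A i) x \<partial>lborel)"
      using subst[OF ind] by (intro prod.cong) auto
    also have "\<dots> = (\<Prod>i\<in>{..<n}. emeasure lborel (A i))"
      using A by (intro prod.cong) auto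
    finally show "emeasure (distr (density (lborel_n n) w) (lborel_n n) T) (Pi\<^sub>E {..<n} A) =
        (\<Prod>i\<in>{..<n}. emeasure lborel (A i))" .
  qed (simp_all add: lborel_n_def)
  then have "(\<integral>\<^sup>+y. \<phi> y \<partial>lborel_n n) = (\<integral>\<^sup>+y. \<phi> y \<partial>distr (density (lborel_n n) w) (lborel_n n) T)"
    by (simp add: lborel_n_def)
  also have "\<dots> = (\<integral>\<^sup>+x. \<phi> (T x) * w x \<partial>lborel_n n)"
    using \<phi> by (simp add: nn_integral_distr nn_integral_density mult.commute)
  finally show ?thesis by (simp add: T_def w_def)
qed

section \<open>Parallel bodies of sublevel sets\<close>

text \<open>
  In one coordinate, \<open>expand p c\<close> below is the map \<open>x \<mapsto> x + c sgn x \<bar>x\<bar> powr (p - 1)\<close>, and \<open>prox p c y\<close> is the absolute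
  value of its inverse at \<open>y\<close>; therefore \<open>prox\<close> depends on \<open>\<bar>y\<bar>\<close> only.
\<close>

definition prox :: "real \<Rightarrow> real \<Rightarrow> real \<Rightarrow> real" where
  "prox p c y = (THE x. 0 \<le> x \<and> x + \<bar>c\<bar> * x powr (p - 1) = \<bar>y\<bar>)"

definition lp_sum :: "real \<Rightarrow> nat \<Rightarrow> (nat \<Rightarrow> real) \<Rightarrow> real" where
  "lp_sum q n x = (\<Sum>i<n. \<bar>x i\<bar> powr q)"

text \<open>The bound \<open>R\<close> is the value of the sum, not a radius: for positive q and R
  the radius in the q-norm is \<open>R powr (1 / q)\<close>.\<close>

definition lp_ball :: "real \<Rightarrow> nat \<Rightarrow> real \<Rightarrow> (nat \<Rightarrow> real) set" where
  "lp_ball q n R = {x \<in> {..<n} \<rightarrow>\<^sub>E UNIV. lp_sum q n x \<le> R}"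

text \<open>The level of the point x in the decomposition y = x + c v(x).\<close>

definition prox_sum :: "real \<Rightarrow> nat \<Rightarrow> real \<Rightarrow> (nat \<Rightarrow> real) \<Rightarrow> real" where
  "prox_sum p n c y = lp_sum p n (\<lambda>i. prox p c (y i))"

text \<open>For nonnegative c this is the squared distance between y and x in y = x + c v(x), by
  \<open>prox_dist2_eq\<close>. The form with exponent 2 p - 2 is the one that survives the
  substitution of y by x.\<close>

definition prox_dist2 :: "real \<Rightarrow> nat \<Rightarrow> real \<Rightarrow> (nat \<Rightarrow> real) \<Rightarrow> real" where
  "prox_dist2 p n c y = c\<^sup>2 * lp_sum (2 * p - 2) n (\<lambda>i. prox p c (y i))"

lemma lp_sum_nonneg [simp]: "0 \<le> lp_sum q n x"
  unfolding lp_sum_def by (intro sum_nonneg) simp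

lemma lp_sum_cong: "(\<And>i. i < n \<Longrightarrow> \<bar>x i\<bar> = \<bar>y i\<bar>) \<Longrightarrow> lp_sum q n x = lp_sum q n y"
  unfolding lp_sum_def by (intro sum.cong) auto

lemma lp_sum_restrict [simp]: "lp_sum q n (\<lambda>i\<in>{..<n}. x i) = lp_sum q n x"
  by (intro lp_sum_cong) auto

lemma lp_sum_pos_iff: "0 < lp_sum q n x \<longleftrightarrow> (\<exists>i<n. x i \<noteq> 0)"
proof -
  have "lp_sum q n x = 0 \<longleftrightarrow> (\<forall>i<n. x i = 0)"
    unfolding lp_sum_def by (subst sum_nonneg_eq_0_iff) auto
  then show ?thesis using lp_sum_nonneg[of q n x] by (auto simp: order_le_less)
qed

lemma measurable_lp_sum_pointwise:
  assumes "\<And>i. i < n \<Longrightarrow> (\<lambda>w. f w i) \<in> borel_measurable M"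
  shows "(\<lambda>w. lp_sum q n (f w)) \<in> borel_measurable M"
  unfolding lp_sum_def using assms by (intro borel_measurable_sum) auto

lemma measurable_lp_sum [measurable (raw)]:
  "Y \<in> M \<rightarrow>\<^sub>M lborel_n n \<Longrightarrow> (\<lambda>w. lp_sum q n (Y w)) \<in> borel_measurable M"
  by (intro measurable_lp_sum_pointwise measurable_lborel_n_component)

lemma lp_ball_subset: "lp_ball q n R \<subseteq> {..<n} \<rightarrow>\<^sub>E UNIV"
  by (auto simp: lp_ball_def)

lemma lp_ball_sets [measurable]: "lp_ball q n R \<in> sets (lborel_n n)"
proof -
  have "lp_ball q n R = {x \<in> space (lborel_n n). lp_sum q n x \<le> R}"
    by (simp add: lp_ball_def space_lborel_n)
  also have "\<dots> \<in> sets (lborel_n n)" by measurable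
  finally show ?thesis .
qed

lemma mem_parallel_body_iff:
  assumes y: "y \<in> {..<n} \<rightarrow>\<^sub>E UNIV" and K: "K \<subseteq> {..<n} \<rightarrow>\<^sub>E UNIV" and "0 \<le> \<rho>"
  shows "y \<in> parallel_body n K \<rho> \<longleftrightarrow> (\<exists>z\<in>K. (\<Sum>i<n. (y i - z i)\<^sup>2) \<le> \<rho>\<^sup>2)"
proof
  assume "y \<in> parallel_body n K \<rho>"
  then obtain z u where z: "z \<in> K" and u: "u \<in> euclidean_ball n"
    and yzu: "y = (\<lambda>i\<in>{..<n}. z i + \<rho> * u i)"
    unfolding parallel_body_def by auto
  have "(\<Sum>i<n. (y i - z i)\<^sup>2) = \<rho>\<^sup>2 * (\<Sum>i<n. (u i)\<^sup>2)"
    by (simp add: yzu power_mult_distrib sum_distrib_left)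
  also have "\<dots> \<le> \<rho>\<^sup>2 * 1"
    using u by (intro mult_left_mono) (auto simp: euclidean_ball_def)
  finally show "\<exists>z\<in>K. (\<Sum>i<n. (y i - z i)\<^sup>2) \<le> \<rho>\<^sup>2" using z by auto
next
  assume "\<exists>z\<in>K. (\<Sum>i<n. (y i - z i)\<^sup>2) \<le> \<rho>\<^sup>2"
  then obtain z where z: "z \<in> K" "(\<Sum>i<n. (y i - z i)\<^sup>2) \<le> \<rho>\<^sup>2" by blast
  \<comment> \<open>For \<rho> = 0 this is the zero vector, since division by 0 gives 0; in that
    case y and z have the same coordinates.\<close>
  define u where "u = (\<lambda>i\<in>{..<n}. (y i - z i) / \<rho>)"
  have yz: "y i = z i + \<rho> * u i" if "i < n" for i
  proof (cases "\<rho> = 0")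
    case True
    then have "(\<Sum>i<n. (y i - z i)\<^sup>2) = 0"
      using z(2) by (simp add: antisym sum_nonneg)
    then show ?thesis using that True by (simp add: sum_nonneg_eq_0_iff)
  qed (use that in \<open>simp add: u_def\<close>)
  have "(\<Sum>i<n. (u i)\<^sup>2) = (\<Sum>i<n. (y i - z i)\<^sup>2) / \<rho>\<^sup>2"
    by (simp add: u_def power_divide sum_divide_distrib)
  also have "\<dots> \<le> 1"
    using z(2) by (cases "\<rho> = 0") (auto simp: field_simps)
  finally have "u \<in> euclidean_ball n"
    by (simp add: euclidean_ball_def u_def)
  moreover have "y = (\<lambda>i\<in>{..<n}. z i + \<rho> * u i)"
    using y yz by (auto simp: fun_eq_iff PiE_def extensional_def)
  ultimately show "y \<in> parallel_body n K \<rho>"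
    unfolding parallel_body_def using z(1) by blast
qed

lemma parallel_body_subset: "parallel_body n K t \<subseteq> {..<n} \<rightarrow>\<^sub>E UNIV"
  unfolding parallel_body_def PiE_def by auto

lemma emeasure_lborel_n_scale:
  assumes c: "0 < c" and A [measurable]: "A \<in> sets (lborel_n n)"
  shows "emeasure (lborel_n n) A =
    ennreal (c ^ n) * emeasure (lborel_n n) {x \<in> space (lborel_n n). (\<lambda>i\<in>{..<n}. c * x i) \<in> A}"
proof -
  have [measurable]: "(\<lambda>x. \<lambda>i\<in>{..<n}. c * x i) \<in> lborel_n n \<rightarrow>\<^sub>M lborel_n n"
    by (rule measurable_lborel_n_restrict) measurable
  have "emeasure (lborel_n n) A = (\<integral>\<^sup>+x. indicator A x \<partial>lborel_n n)" by simp
  also have "\<dots> = (\<integral>\<^sup>+x. indicator A (\<lambda>i\<in>{..<n}. c * x i) * (\<Prod>i<n. ennreal c) \<partial>lborel_n n)"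
  proof (rule nn_integral_lborel_n_subst[where g = "\<lambda>x. c * x" and g' = "\<lambda>_. c"])
    fix f :: "real \<Rightarrow> ennreal" assume [measurable]: "f \<in> borel_measurable borel"
    show "(\<integral>\<^sup>+x. f x \<partial>lborel) = (\<integral>\<^sup>+x. f (c * x) * ennreal c \<partial>lborel)"
      using c by (subst nn_integral_real_affine[of f c 0]) (auto simp: nn_integral_cmult mult.commute)
  qed auto
  also have "\<dots> = (\<integral>\<^sup>+x. ennreal (c ^ n) * indicator {x \<in> space (lborel_n n). (\<lambda>i\<in>{..<n}. c * x i) \<in> A} x \<partial>lborel_n n)"
    using c by (intro nn_integral_cong) (auto simp: indicator_def ennreal_power)
  also have "\<dots> = ennreal (c ^ n) * emeasure (lborel_n n) {x \<in> space (lborel_n n). (\<lambda>i\<in>{..<n}. c * x i) \<in> A}"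
    by (rule nn_integral_cmult_indicator) measurable
  finally show ?thesis .
qed

lemma emeasure_lborel_n_box_finite: "emeasure (lborel_n n) ({..<n} \<rightarrow>\<^sub>E {a..b}) < \<infinity>"
  unfolding lborel_n_def
  by (subst product_sigma_finite.emeasure_PiM[OF product_sigma_finite_lborel])
     (auto simp: ennreal_power emeasure_lborel_Icc_eq)

text \<open>The \<open>b m\<close> are extended reals because the integrals put in their place by
  \<open>intrinsic_volume_lower\<close> are not yet known to be finite. The value z = 1 shows
  finiteness; after that, a real polynomial with infinitely many roots must vanish.\<close>

lemma poly_coeff_ennreal:
  fixes a :: "nat \<Rightarrow> real" and b :: "nat \<Rightarrow> ennreal"
  assumes a: "\<And>m. m < n \<Longrightarrow> 0 \<le> a m"
    and eq: "\<And>z::real. 0 < z \<Longrightarrow> (\<Sum>m<n. ennreal (a m * z ^ (m + 1))) = (\<Sum>m<n. b m * ennreal (z ^ (m + 1)))"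
    and m: "m < n"
  shows "b m = ennreal (a m)"
proof -
  have "(\<Sum>m<n. b m) = (\<Sum>m<n. ennreal (a m))" using eq[of 1] by simp
  then have fin: "b k < \<infinity>" if "k < n" for k
    proof -
    have "b k \<le> (\<Sum>m<n. b m)" using that by (intro member_le_sum) auto
    also have "\<dots> < \<infinity>" unfolding \<open>(\<Sum>m<n. b m) = _\<close> by simp
    finally show ?thesis .
  qed
  define r where "r k = enn2real (b k)" for k
  have b: "b k = ennreal (r k)" "0 \<le> r k" if "k < n" for k
    using fin[OF that] by (auto simp: r_def)
  \<comment> \<open>The constant coefficient is 0 because only the exponents m + 1 occur.\<close>
  define d where "d i = (if i = 0 then 0 else a (i - 1) - r (i - 1))" for i
  have zero: "(\<Sum>i\<le>n. d i * z ^ i) = 0" if z: "0 < z" for z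
  proof -
    have "ennreal (\<Sum>m<n. a m * z ^ (m + 1)) = ennreal (\<Sum>m<n. r m * z ^ (m + 1))"
    proof -
      have "(\<Sum>m<n. b m * ennreal (z ^ (m + 1))) = (\<Sum>m<n. ennreal (r m * z ^ (m + 1)))"
        using z b by (intro sum.cong) (auto simp: ennreal_mult)
      then show ?thesis
        using eq[OF z] a b(2) z by (subst (asm) (1 2) sum_ennreal) (auto intro!: mult_nonneg_nonneg)
    qed
    then have "(\<Sum>m<n. a m * z ^ (m + 1)) = (\<Sum>m<n. r m * z ^ (m + 1))"
      using z a b(2) by (subst (asm) ennreal_inj) (auto intro!: sum_nonneg mult_nonneg_nonneg)
    then have "(\<Sum>m<n. d (Suc m) * z ^ Suc m) = 0"
      by (simp add: d_def algebra_simps sum_subtractf)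
    then show ?thesis
      by (simp add: lessThan_Suc_atMost[symmetric] sum.lessThan_Suc_shift d_def del: sum.lessThan_Suc)
  qed
  have "{0<..} \<subseteq> {z::real. (\<Sum>i\<le>n. d i * z ^ i) = 0}" using zero by auto
  then have "infinite {z::real. (\<Sum>i\<le>n. d i * z ^ i) = 0}"
    using infinite_Ioi finite_subset by blast
  then have "d (Suc m) = 0"
    using polyfun_finite_roots[of d n] m by auto
  then show ?thesis using b[OF m] by (simp add: d_def)
qed

text \<open>Expanding over subsets and grouping them by size: the coefficients are the elementary
  symmetric functions of the \<open>d k\<close>. In the application the set is \<open>{..<n}\<close>
  without one index, whence the bound n.\<close>

lemma prod_one_plus_expand:
  fixes d :: "'a \<Rightarrow> real"
  assumes "finite A" "card A < n"
  shows "(\<Prod>k\<in>A. 1 + c * d k) = (\<Sum>m<n. c ^ m * (\<Sum>S\<in>{S \<in> Pow A. card S = m}. \<Prod>k\<in>S. d k))"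
proof -
  have "(\<Prod>k\<in>A. 1 + c * d k) = (\<Prod>k\<in>A. c * d k + 1)" by (simp add: add.commute)
  also have "\<dots> = (\<Sum>S\<in>Pow A. c ^ card S * (\<Prod>k\<in>S. d k))"
    using assms(1) by (subst prod_add) (auto simp: prod.distrib)
  also have "\<dots> = (\<Sum>m<n. \<Sum>S\<in>{S \<in> Pow A. card S = m}. c ^ card S * (\<Prod>k\<in>S. d k))"
  proof (rule sum.group[symmetric])
    show "card ` Pow A \<subseteq> {..<n}"
      using assms by (auto intro: le_less_trans[OF card_mono])
  qed (use assms in auto)
  finally show ?thesis
    by (simp add: sum_distrib_left)
qed

section \<open>Gamma integrals and Stirling bounds\<close>

lemma nn_integral_power_Ioc:
  assumes "0 \<le> a"
  shows "(\<integral>\<^sup>+c. ennreal (c ^ m) * indicator {0<..a} c \<partial>lborel) = ennreal (a ^ (m + 1) / (m + 1))"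
proof -
  have "(\<integral>\<^sup>+c. ennreal (c ^ m) * indicator {0<..a} c \<partial>lborel) = (\<integral>\<^sup>+c. ennreal (c ^ m) * indicator {0..a} c \<partial>lborel)"
    using AE_lborel_singleton[of 0]
    by (intro nn_integral_cong_AE) (auto elim!: eventually_mono simp: indicator_def)
  also have "\<dots> = ennreal (a ^ (m + 1) / (m + 1) - 0 ^ (m + 1) / (m + 1))"
  proof (rule nn_integral_FTC_Icc)
    fix c :: real
    have "((\<lambda>c. c ^ (m + 1) / (m + 1)) has_real_derivative (real (m + 1) * c ^ m) / (m + 1)) (at c)"
      using DERIV_cdivide[OF DERIV_pow[of "m + 1" c UNIV], of "m + 1"] by simp
    then show "((\<lambda>c. c ^ (m + 1) / (m + 1)) has_real_derivative c ^ m) (at c)"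
      by (simp del: of_nat_add of_nat_Suc)
  qed (use assms in auto)
  finally show ?thesis by simp
qed

text \<open>Euler's integral after the substitution t = x powr b.\<close>

lemma nn_integral_powr_exp:
  assumes "-1 < a" "0 < b"
  shows "(\<integral>\<^sup>+x\<in>{0<..}. ennreal (x powr a * exp (- (x powr b))) \<partial>lborel) = ennreal (Gamma ((a + 1) / b) / b)"
    (is "?I = _")
proof -
  define s where "s = (a + 1) / b"
  have s: "s > 0" using assms by (simp add: s_def)
  have "ennreal (Gamma s) = (\<integral>\<^sup>+t. ennreal (indicator {0..} t * t powr (s - 1) / exp t) \<partial>lborel)"
    by (rule Gamma_conv_nn_integral_real[OF s])
  also have "\<dots> = (\<integral>\<^sup>+t\<in>{0<..}. ennreal (t powr (s - 1) / exp t) \<partial>lborel)"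
    using AE_lborel_singleton[of 0]
    by (intro nn_integral_cong_AE) (auto elim!: eventually_mono simp: indicator_def)
  also have "\<dots> = (\<integral>\<^sup>+x\<in>{0<..}. ennreal ((x powr b) powr (s - 1) / exp (x powr b)) * ennreal (b * x powr (b - 1)) \<partial>lborel)"
  proof (rule nn_integral_subst_halfline)
    show "continuous_on {0<..} (\<lambda>x. b * x powr (b - 1))" by (intro continuous_intros) auto
    show "(\<lambda>x. x powr b) ` {0<..} = {0<..}"
    proof (intro equalityI subsetI)
      fix y :: real assume "y \<in> {0<..}"
      then show "y \<in> (\<lambda>x. x powr b) ` {0<..}"
        using assms by (intro image_eqI[of _ _ "y powr (1 / b)"]) (auto simp: powr_powr)
    qed auto
  qed (use assms in \<open>auto intro!: derivative_eq_intros\<close>)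
  also have "\<dots> = (\<integral>\<^sup>+x. ennreal b * (ennreal (x powr a * exp (- (x powr b))) * indicator {0<..} x) \<partial>lborel)"
    (is "nn_integral _ ?f = nn_integral _ ?g")
  proof (rule nn_integral_cong)
    fix x :: real
    have "(x powr b) powr (s - 1) / exp (x powr b) * (b * x powr (b - 1)) = b * (x powr a * exp (- (x powr b)))"
    proof -
      have "(x powr b) powr (s - 1) * x powr (b - 1) = x powr (b * (s - 1) + (b - 1))"
        by (simp add: powr_powr powr_add)
      also have "b * (s - 1) + (b - 1) = a" using assms by (simp add: s_def field_simps)
      finally show ?thesis by (simp add: exp_minus divide_inverse mult_ac)
    qed
    then show "?f x = ?g x"
      using assms by (auto simp: indicator_def simp flip: ennreal_mult)
  qed
  also have "\<dots> = ennreal b * ?I"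
    by (rule nn_integral_cmult) measurable
  finally have "ennreal (Gamma s) = ennreal b * ?I" .
  then have "ennreal (1 / b) * ennreal (Gamma s) = (ennreal (1 / b) * ennreal b) * ?I"
    by (simp add: mult.assoc)
  also have "ennreal (1 / b) * ennreal b = 1" using assms by (simp flip: ennreal_mult)
  finally show ?thesis
    using assms s by (simp add: s_def Gamma_real_pos less_imp_le flip: ennreal_mult)
qed

lemma nn_integral_powr_exp_minus:
  assumes "-1 < a"
  shows "(\<integral>\<^sup>+x\<in>{0<..}. ennreal (x powr a * exp (- x)) \<partial>lborel) = ennreal (Gamma (a + 1))"
proof -
  have "(\<integral>\<^sup>+x\<in>{0<..}. ennreal (x powr a * exp (- x)) \<partial>lborel) =
      (\<integral>\<^sup>+x\<in>{0<..}. ennreal (x powr a * exp (- (x powr 1))) \<partial>lborel)"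
    by (intro nn_integral_cong) (auto simp: indicator_def)
  then show ?thesis using nn_integral_powr_exp[of a 1] assms by simp
qed

lemma nn_integral_exp_atLeast:
  assumes "0 < \<mu>"
  shows "(\<integral>\<^sup>+t\<in>{a..}. ennreal (exp (- (\<mu> * t))) \<partial>lborel) = ennreal (exp (- (\<mu> * a)) / \<mu>)"
proof -
  have "(\<integral>\<^sup>+t\<in>{a..}. ennreal (exp (- (\<mu> * t))) \<partial>lborel) = ennreal (0 - (- (exp (- (\<mu> * a)) / \<mu>)))"
  proof (rule nn_integral_FTC_atLeast)
    show "((\<lambda>t. - (exp (- (\<mu> * t)) / \<mu>)) has_real_derivative exp (- (\<mu> * t))) (at t)" for t
      using assms by (auto intro!: derivative_eq_intros)
    have "filterlim (\<lambda>t. - (\<mu> * t)) at_bot at_top"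
      unfolding filterlim_uminus_at_bot using assms
      by (auto intro!: filterlim_tendsto_pos_mult_at_top[OF tendsto_const] filterlim_ident)
    then have "((\<lambda>t. exp (- (\<mu> * t))) \<longlongrightarrow> 0) at_top" by (rule filterlim_compose[OF exp_at_bot])
    then have "((\<lambda>t. - (exp (- (\<mu> * t)) / \<mu>)) \<longlongrightarrow> - (0 / \<mu>)) at_top" using assms by (intro tendsto_intros) auto
    then show "((\<lambda>t. - (exp (- (\<mu> * t)) / \<mu>)) \<longlongrightarrow> 0) at_top" by simp
  qed auto
  then show ?thesis by simp
qed

lemma nn_integral_Gaussian_tail:
  assumes z: "0 < z" and a: "0 \<le> a"
  shows "(\<integral>\<^sup>+s\<in>{a..}. ennreal (2 * s / z\<^sup>2 * exp (- (s\<^sup>2 / z\<^sup>2))) \<partial>lborel) = ennreal (exp (- (a\<^sup>2 / z\<^sup>2)))"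
proof -
  have "(\<integral>\<^sup>+s\<in>{a..}. ennreal (2 * s / z\<^sup>2 * exp (- (s\<^sup>2 / z\<^sup>2))) \<partial>lborel) = ennreal (0 - (- exp (- (a\<^sup>2 / z\<^sup>2))))"
  proof (rule nn_integral_FTC_atLeast)
    fix s :: real
    show "((\<lambda>s. - exp (- (s\<^sup>2 / z\<^sup>2))) has_real_derivative 2 * s / z\<^sup>2 * exp (- (s\<^sup>2 / z\<^sup>2))) (at s)"
      using z by (auto intro!: derivative_eq_intros simp: field_simps power2_eq_square power4_eq_xxxx)
    have "((\<lambda>s::real. exp (- (s\<^sup>2 / z\<^sup>2))) \<longlongrightarrow> 0) at_top"
    proof (rule filterlim_compose[OF exp_at_bot])
      have "filterlim (\<lambda>s::real. (1 / z\<^sup>2) * s\<^sup>2) at_top at_top"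
        using z by (intro filterlim_tendsto_pos_mult_at_top[OF tendsto_const] filterlim_pow_at_top filterlim_ident) auto
      then show "filterlim (\<lambda>s::real. - (s\<^sup>2 / z\<^sup>2)) at_bot at_top"
        by (simp add: filterlim_uminus_at_bot)
    qed
    then show "((\<lambda>s. - exp (- (s\<^sup>2 / z\<^sup>2))) \<longlongrightarrow> 0) at_top"
      using tendsto_minus by fastforce
  qed (use a in auto)
  then show ?thesis by simp
qed

lemma nn_integral_Gaussian_moment:
  assumes z: "0 < z"
  shows "(\<integral>\<^sup>+s\<in>{0<..}. ennreal (s ^ (m + 1)) * ennreal (2 * s / z\<^sup>2 * exp (- (s\<^sup>2 / z\<^sup>2))) \<partial>lborel) =
    ennreal (Gamma ((real m + 1) / 2 + 1) * z ^ (m + 1))"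
    (is "?I = _")
proof -
  have "?I =
    ennreal z * (\<integral>\<^sup>+s. ennreal ((z * s) ^ (m + 1)) * ennreal (2 * (z * s) / z\<^sup>2 * exp (- ((z * s)\<^sup>2 / z\<^sup>2))) * indicator {0<..} (z * s) \<partial>lborel)"
    using z by (subst nn_integral_real_affine[of _ z 0]) auto
  also have "\<dots> = (\<integral>\<^sup>+s. ennreal z * (ennreal ((z * s) ^ (m + 1)) * ennreal (2 * (z * s) / z\<^sup>2 * exp (- ((z * s)\<^sup>2 / z\<^sup>2))) * indicator {0<..} (z * s)) \<partial>lborel)"
    by (rule nn_integral_cmult[symmetric]) measurable
  also have "\<dots> = (\<integral>\<^sup>+s. ennreal (2 * z ^ (m + 1)) * (ennreal (s powr (m + 2) * exp (- (s powr 2))) * indicator {0<..} s) \<partial>lborel)"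
    (is "nn_integral _ ?f = nn_integral _ ?g")
  proof (rule nn_integral_cong)
    fix s :: real
    show "?f s = ?g s"
    proof (cases "0 < s")
      case True
      have "z * ((z * s) ^ (m + 1) * (2 * (z * s) / z\<^sup>2 * exp (- ((z * s)\<^sup>2 / z\<^sup>2)))) =
        2 * z ^ (m + 1) * (s powr (m + 2) * exp (- (s powr 2)))"
      proof -
        have "s powr (m + 2) = s ^ (m + 2)" using True by (metis of_nat_add of_nat_numeral powr_realpow)
        then show ?thesis
          using True z by (simp add: power_mult_distrib power2_eq_square field_simps)
      qed
      then show ?thesis using True z by (simp add: indicator_def flip: ennreal_mult del: power_Suc)
    qed (use z in \<open>simp add: indicator_def zero_less_mult_iff\<close>)
  qed
  also have "\<dots> = ennreal (2 * z ^ (m + 1)) * (\<integral>\<^sup>+s\<in>{0<..}. ennreal (s powr (m + 2) * exp (- (s powr 2))) \<partial>lborel)"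
    by (rule nn_integral_cmult) measurable
  also have "(\<integral>\<^sup>+s\<in>{0<..}. ennreal (s powr (m + 2) * exp (- (s powr 2))) \<partial>lborel) = ennreal (Gamma ((real (m + 2) + 1) / 2) / 2)"
    by (rule nn_integral_powr_exp) auto
  also have "(real (m + 2) + 1) / 2 = (real m + 1) / 2 + 1" by (simp add: field_simps)
  finally have eq: "?I =
    ennreal (2 * z ^ (m + 1)) * ennreal (Gamma ((real m + 1) / 2 + 1) / 2)" .
  have "0 \<le> Gamma ((real m + 1) / 2 + 1)" by (intro less_imp_le Gamma_real_pos) (simp add: add_pos_pos)
  then show ?thesis
    unfolding eq using z by (simp add: mult_ac flip: ennreal_mult)
qed

text \<open>A logarithmic error is affordable, since everything is divided by n at the end. Lower
  bound: restrict Euler's integral to t \<ge> x, where t powr x \<ge> x powr x. Upper bound: the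
  tangent of ln at x + 1 bounds the integrand by a multiple of exp (- t / (x + 1)), whose integral
  is explicit.\<close>

lemma ln_Gamma_bounds:
  fixes x :: real
  assumes "0 \<le> x"
  shows "x * ln x - x \<le> ln (Gamma (x + 1))" "ln (Gamma (x + 1)) \<le> x * ln x - x + ln (x + 1) + 1"
proof -
  have "x * ln x - x \<le> ln (Gamma (x + 1)) \<and> ln (Gamma (x + 1)) \<le> x * ln x - x + ln (x + 1) + 1"
  proof (cases "x = 0")
    case False
    then have x: "0 < x" using assms by simp
    have G: "0 < Gamma (x + 1)" using x by (intro Gamma_real_pos) auto
    have int: "ennreal (Gamma (x + 1)) = (\<integral>\<^sup>+t\<in>{0<..}. ennreal (t powr x * exp (- t)) \<partial>lborel)"
      using x by (subst nn_integral_powr_exp_minus) auto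
    have "ennreal (x powr x * exp (- x)) = ennreal (x powr x) * (\<integral>\<^sup>+t\<in>{x..}. ennreal (exp (- (1 * t))) \<partial>lborel)"
      by (subst nn_integral_exp_atLeast) (auto simp: ennreal_mult)
    also have "\<dots> = (\<integral>\<^sup>+t. ennreal (x powr x) * (ennreal (exp (- (1 * t))) * indicator {x..} t) \<partial>lborel)"
      by (rule nn_integral_cmult[symmetric]) measurable
    also have "\<dots> \<le> ennreal (Gamma (x + 1))"
      unfolding int using x
      by (intro nn_integral_mono)
         (auto simp: indicator_def simp flip: ennreal_mult intro!: ennreal_leI mult_right_mono powr_mono2)
    finally have "x powr x * exp (- x) \<le> Gamma (x + 1)" using G by simp
    then have "ln (x powr x * exp (- x)) \<le> ln (Gamma (x + 1))" using x G by (subst ln_le_cancel_iff) auto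
    then have lower: "x * ln x - x \<le> ln (Gamma (x + 1))" using x by (simp add: ln_mult ln_powr)
    define C where "C = (x + 1) powr x * exp (- x)"
    have le: "t powr x * exp (- t) \<le> C * exp (- (1 / (x + 1) * t))" if t: "0 < t" for t
    proof -
      have "ln (t / (x + 1)) \<le> t / (x + 1) - 1" using t x by (intro ln_le_minus_one) auto
      then have "x * ln t - x * ln (x + 1) \<le> x * (t / (x + 1) - 1)"
        using mult_left_mono[of "ln (t / (x + 1))" "t / (x + 1) - 1" x] x t by (simp add: ln_div algebra_simps)
      also have "x * (t / (x + 1) - 1) = t - t / (x + 1) - x" using x by (simp add: field_simps)
      finally have "x * ln t - t \<le> x * ln (x + 1) - x - 1 / (x + 1) * t" by simp
      then have "exp (x * ln t - t) \<le> exp (x * ln (x + 1) - x - 1 / (x + 1) * t)" by simp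
      then show ?thesis using x t by (simp add: C_def powr_def exp_diff exp_minus divide_inverse)
    qed
    have "ennreal (Gamma (x + 1)) \<le> (\<integral>\<^sup>+t. ennreal C * (ennreal (exp (- (1 / (x + 1) * t))) * indicator {0..} t) \<partial>lborel)"
      unfolding int using le x
      by (intro nn_integral_mono) (auto simp: indicator_def C_def simp flip: ennreal_mult intro!: ennreal_leI)
    also have "\<dots> = ennreal C * (\<integral>\<^sup>+t. ennreal (exp (- (1 / (x + 1) * t))) * indicator {0..} t \<partial>lborel)"
      by (rule nn_integral_cmult) measurable
    also have "\<dots> = ennreal (C * (x + 1))"
      using x by (subst nn_integral_exp_atLeast) (auto simp: C_def ennreal_mult)
    finally have "Gamma (x + 1) \<le> C * (x + 1)" using x by (simp add: C_def)
    then have "ln (Gamma (x + 1)) \<le> ln (C * (x + 1))" using x G by (subst ln_le_cancel_iff) (auto simp: C_def)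
    also have "\<dots> = x * ln (x + 1) - x + ln (x + 1)" using x by (simp add: C_def ln_mult ln_powr)
    also have "x * ln (x + 1) \<le> x * ln x + 1"
    proof -
      have "ln ((x + 1) / x) \<le> (x + 1) / x - 1" using x by (intro ln_le_minus_one) auto
      then have "x * ln ((x + 1) / x) \<le> x * ((x + 1) / x - 1)" using x by (intro mult_left_mono) auto
      also have "(x + 1) / x - 1 = 1 / x" using x by (simp add: field_simps)
      finally show ?thesis using x by (simp add: ln_div algebra_simps)
    qed
    finally show ?thesis using lower by simp
  qed simp
  then show "x * ln x - x \<le> ln (Gamma (x + 1))" "ln (Gamma (x + 1)) \<le> x * ln x - x + ln (x + 1) + 1" by auto
qed

section \<open>Uniformity and error terms\<close>

lemma ex_delta_mult_less:
  fixes B \<epsilon> :: real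
  assumes "0 \<le> B" "0 < \<epsilon>"
  obtains d where "0 < d" "\<And>x. 0 \<le> x \<Longrightarrow> x < d \<Longrightarrow> x * B < \<epsilon>"
\<comment> \<open>B + 1 instead of B covers the case B = 0.\<close>
proof (rule that[of "\<epsilon> / (B + 1)"])
  show "0 < \<epsilon> / (B + 1)" using assms by simp
  fix x assume "0 \<le> x" "x < \<epsilon> / (B + 1)"
  then have "x * (B + 1) < \<epsilon>" using assms by (simp add: pos_less_divide_eq)
  moreover have "x * B \<le> x * (B + 1)" using \<open>0 \<le> x\<close> by (intro mult_left_mono) auto
  ultimately show "x * B < \<epsilon>" by simp
qed

text \<open>Finitely many of the neighbourhoods cover the compact interval [0, 1]; the sum of their
  thresholds serves as a common threshold.\<close>

lemma uniform_of_local: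
  fixes P :: "nat \<Rightarrow> nat \<Rightarrow> bool"
  assumes "\<And>\<alpha>. 0 \<le> \<alpha> \<Longrightarrow> \<alpha> \<le> 1 \<Longrightarrow> \<exists>\<delta>>0. \<exists>N. \<forall>n\<ge>N. \<forall>j<n. \<bar>j / n - \<alpha>\<bar> < \<delta> \<longrightarrow> P n j"
  shows "\<exists>N. \<forall>n\<ge>N. \<forall>j<n. P n j"
proof -
  have "\<forall>\<alpha>\<in>{0..1}. \<exists>\<delta> N. 0 < \<delta> \<and> (\<forall>n\<ge>N. \<forall>j<n. \<bar>j / n - \<alpha>\<bar> < \<delta> \<longrightarrow> P n j)"
    using assms by force
  then obtain \<delta> N where \<delta>N: "\<And>\<alpha>. \<alpha> \<in> {0..1} \<Longrightarrow> 0 < \<delta> \<alpha>"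
    "\<And>\<alpha> n j. \<alpha> \<in> {0..1} \<Longrightarrow> N \<alpha> \<le> n \<Longrightarrow> j < n \<Longrightarrow> \<bar>j / n - \<alpha>\<bar> < \<delta> \<alpha> \<Longrightarrow> P n j"
    by metis
  obtain A where A: "A \<subseteq> {0..1::real}" "finite A" "{0..1} \<subseteq> (\<Union>\<alpha>\<in>A. ball \<alpha> (\<delta> \<alpha>))"
    by (rule compactE_image[of "{0..1::real}" "{0..1}" "\<lambda>\<alpha>. ball \<alpha> (\<delta> \<alpha>)"]) (use \<delta>N(1) in auto)
  have "P n j" if n: "(\<Sum>\<alpha>\<in>A. N \<alpha>) \<le> n" and j: "j < n" for n j
  proof -
    have "real j / n \<in> {0..1}" using j by auto
    then obtain \<alpha> where \<alpha>: "\<alpha> \<in> A" "real j / n \<in> ball \<alpha> (\<delta> \<alpha>)" using A(3) by blast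
    have "N \<alpha> \<le> (\<Sum>\<alpha>\<in>A. N \<alpha>)" using \<alpha>(1) A(2) by (intro member_le_sum) auto
    then show ?thesis using \<alpha> A(1) n j by (intro \<delta>N(2)[of \<alpha>]) (auto simp: dist_real_def abs_minus_commute)
  qed
  then show ?thesis by blast
qed

definition stirling_err :: "real \<Rightarrow> real" where
  "stirling_err x = ln (Gamma (x + 1)) - (x * ln x - x)"

lemma stirling_err_bounds:
  assumes "0 \<le> x" "x \<le> y"
  shows "0 \<le> stirling_err x" "stirling_err x \<le> ln (y + 1) + 1"
proof -
  have "ln (x + 1) \<le> ln (y + 1)" using assms by (subst ln_le_cancel_iff) auto
  then show "0 \<le> stirling_err x" "stirling_err x \<le> ln (y + 1) + 1"
    using ln_Gamma_bounds[OF assms(1)] by (auto simp: stirling_err_def)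
qed

lemma ln_over_n_const_tendsto: "(\<lambda>n. (c + 4 * ln (real n)) / real n) \<longlonglongrightarrow> 0"
proof -
  have "(\<lambda>n. c / real n + 4 * (ln (real n) / real n)) \<longlonglongrightarrow> 0 + 4 * 0"
    by (intro tendsto_add tendsto_mult tendsto_const lim_const_over_n lim_ln_over_n)
  then show ?thesis by (simp add: add_divide_distrib)
qed

section \<open>Weights, moments and coefficient integrals\<close>

definition expand :: "real \<Rightarrow> real \<Rightarrow> real \<Rightarrow> real" where
  "expand p c x = x + c * (sgn x * \<bar>x\<bar> powr (p - 1))"

text \<open>Derivative of \<open>expand p c\<close> away from 0, hence one factor of the Jacobian.
  At 0 the value is 1 because \<open>0 powr a = 0\<close>, although for p < 2 and c > 0 the slope
  there is infinite.\<close>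

definition expand' :: "real \<Rightarrow> real \<Rightarrow> real \<Rightarrow> real" where
  "expand' p c x = 1 + c * (p - 1) * \<bar>x\<bar> powr (p - 2)"

text \<open>Minus the derivative of \<open>prox_sum\<close> in c, that is, the speed at which the
  level falls as c grows.\<close>

definition prox_speed :: "real \<Rightarrow> nat \<Rightarrow> real \<Rightarrow> (nat \<Rightarrow> real) \<Rightarrow> real" where
  "prox_speed p n c y = p * (\<Sum>i<n. prox p c (y i) powr (2 * p - 2) / (1 + c * (p - 1) * prox p c (y i) powr (p - 2)))"

definition shell :: "real \<Rightarrow> nat \<Rightarrow> real \<Rightarrow> ennreal" where
  "shell p n t = emeasure (lborel_n n) (parallel_body n (lp_ball p n 1) t - lp_ball p n 1)"

text \<open>The integrand after both substitutions: exp (- R) times \<open>prox_speed\<close> times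
  the Jacobian. Each denominator of \<open>prox_speed\<close> cancels one factor of the Jacobian,
  which is why the products omit the index i.\<close>

definition weight :: "real \<Rightarrow> nat \<Rightarrow> real \<Rightarrow> (nat \<Rightarrow> real) \<Rightarrow> real" where
  "weight p n c x = exp (- lp_sum p n x) * p *
    (\<Sum>i<n. \<bar>x i\<bar> powr (2 * p - 2) * (\<Prod>k\<in>{..<n} - {i}. expand' p c (x k)))"

text \<open>The coefficient of c ^ m in \<open>weight\<close>, by
  \<open>weight_expand\<close>.\<close>

definition weight_coeff :: "real \<Rightarrow> nat \<Rightarrow> nat \<Rightarrow> (nat \<Rightarrow> real) \<Rightarrow> real" where
  "weight_coeff p n m x = exp (- lp_sum p n x) * p *
    (\<Sum>i<n. \<bar>x i\<bar> powr (2 * p - 2) *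
      (\<Sum>S\<in>{S \<in> Pow ({..<n} - {i}). card S = m}. \<Prod>k\<in>S. (p - 1) * \<bar>x k\<bar> powr (p - 2)))"

text \<open>
  For \<open>q = 0\<close> and \<open>q = p - 2\<close> the moments are \<open>I_fun p\<close> and \<open>J_fun p\<close>, and \<open>q = 2 p - 2\<close> gives minus the
  derivative of \<open>I_fun p\<close>. Since \<open>0 powr 0 = 0\<close>, the identification for \<open>q = 0\<close> holds only almost everywhere
  under the integral.
\<close>

definition kern :: "real \<Rightarrow> real \<Rightarrow> real \<Rightarrow> real" where
  "kern p \<theta> u = exp (- (\<bar>u\<bar> powr p) - \<theta> * \<bar>u\<bar> powr (2 * p - 2))"

definition moment :: "real \<Rightarrow> real \<Rightarrow> real \<Rightarrow> ennreal" where
  "moment p q \<theta> = (\<integral>\<^sup>+u. ennreal (\<bar>u\<bar> powr q * kern p \<theta> u) \<partial>lborel)"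

text \<open>By \<open>intrinsic_volume_lower\<close> this is the intrinsic volume of index j = n - 1
  - m up to elementary factors. Of the n coordinates, one carries the moment of order 2 p - 2, m
  carry J, and the remaining n - 1 - m carry I.\<close>

definition H_int :: "real \<Rightarrow> nat \<Rightarrow> nat \<Rightarrow> ennreal" where
  "H_int p n m = (\<integral>\<^sup>+\<theta>\<in>{0<..}. ennreal (\<theta> powr ((real m - 1) / 2)) * moment p (2 * p - 2) \<theta> *
     moment p (p - 2) \<theta> ^ m * moment p 0 \<theta> ^ (n - 1 - m) \<partial>lborel)"

definition rmom :: "real \<Rightarrow> real \<Rightarrow> real \<Rightarrow> real" where
  "rmom p q \<theta> = enn2real (moment p q \<theta>)"

text \<open>The integrand of \<open>H_int p n (n - 1 - j)\<close> as a real number, now indexed by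
  j.\<close>

definition H_fun :: "real \<Rightarrow> nat \<Rightarrow> nat \<Rightarrow> real \<Rightarrow> real" where
  "H_fun p n j \<theta> = \<theta> powr ((real (n - 1 - j) - 1) / 2) * rmom p (2 * p - 2) \<theta> *
     rmom p (p - 2) \<theta> ^ (n - 1 - j) * rmom p 0 \<theta> ^ j"

definition S_fun :: "real \<Rightarrow> real \<Rightarrow> real" where
  "S_fun p \<alpha> = (SUP \<theta>\<in>{0<..}. Psi p \<alpha> \<theta>)"

context
  fixes p :: real
  assumes p: "1 < p"
begin

section \<open>The inverse of the coordinatewise map\<close>

lemma prox_strict_mono:
  assumes "0 \<le> x" "x < z"
  shows "x + \<bar>c\<bar> * x powr (p - 1) < z + \<bar>c\<bar> * z powr (p - 1)"
  using assms p by (intro add_less_le_mono mult_left_mono powr_mono2) auto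

lemma prox_le_mono_iff:
  assumes "0 \<le> x" "0 \<le> z"
  shows "x + \<bar>c\<bar> * x powr (p - 1) \<le> z + \<bar>c\<bar> * z powr (p - 1) \<longleftrightarrow> x \<le> z"
  using prox_strict_mono[of x z c] prox_strict_mono[of z x c] assms
  by (cases x z rule: linorder_cases) auto

lemma prox_ex: "\<exists>!x. 0 \<le> x \<and> x + \<bar>c\<bar> * x powr (p - 1) = \<bar>y\<bar>"
proof -
  have "\<exists>x\<ge>0. x \<le> \<bar>y\<bar> \<and> x + \<bar>c\<bar> * x powr (p - 1) = \<bar>y\<bar>"
    using p by (intro IVT') (auto intro!: continuous_intros continuous_on_powr')
  then obtain x where x: "0 \<le> x \<and> x + \<bar>c\<bar> * x powr (p - 1) = \<bar>y\<bar>" by blast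
  show ?thesis
  proof (intro ex1I[of _ x] x)
    fix z assume z: "0 \<le> z \<and> z + \<bar>c\<bar> * z powr (p - 1) = \<bar>y\<bar>"
    show "z = x"
      using prox_le_mono_iff[of x z c] prox_le_mono_iff[of z x c] x z by auto
  qed
qed

lemma prox_nonneg [simp]: "0 \<le> prox p c y"
  and prox_eq: "prox p c y + \<bar>c\<bar> * prox p c y powr (p - 1) = \<bar>y\<bar>"
  using theI'[OF prox_ex[of c y]] by (auto simp: prox_def)

lemma prox_eqI: "0 \<le> x \<Longrightarrow> x + \<bar>c\<bar> * x powr (p - 1) = \<bar>y\<bar> \<Longrightarrow> prox p c y = x"
  using prox_ex[of c y] prox_nonneg[of c y] prox_eq[of c y] by blast

lemma prox_le_iff: "prox p c y \<le> a \<longleftrightarrow> 0 \<le> a \<and> \<bar>y\<bar> \<le> a + \<bar>c\<bar> * a powr (p - 1)"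
proof (cases "0 \<le> a")
  case True
  then show ?thesis
    using prox_le_mono_iff[of "prox p c y" a c] by (simp add: prox_eq)
qed (use order_trans[OF prox_nonneg[of c y]] in blast)

lemma prox_le: "prox p c y \<le> \<bar>y\<bar>"
  by (simp add: prox_le_iff)

lemma prox_0 [simp]: "prox p 0 y = \<bar>y\<bar>" "prox p c 0 = 0"
  using p by (auto intro!: prox_eqI)

lemma prox_pos: "y \<noteq> 0 \<Longrightarrow> 0 < prox p c y"
  using prox_eq[of c y] prox_nonneg[of c y] by (cases "prox p c y = 0") (auto simp: order_le_less)

lemma prox_antimono:
  assumes "0 \<le> c" "c \<le> d"
  shows "prox p d y \<le> prox p c y"
proof -
  have "\<bar>y\<bar> = prox p c y + \<bar>c\<bar> * prox p c y powr (p - 1)" by (simp add: prox_eq)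
  also have "\<dots> \<le> prox p c y + \<bar>d\<bar> * prox p c y powr (p - 1)"
    using assms by (intro add_left_mono mult_right_mono) auto
  finally show ?thesis by (simp add: prox_le_iff)
qed

lemma prox_strict_antimono:
  assumes "0 \<le> c" "c < d" "y \<noteq> 0"
  shows "prox p d y < prox p c y"
proof -
  have "prox p d y \<noteq> prox p c y"
  proof
    assume e: "prox p d y = prox p c y"
    have "\<bar>c\<bar> * prox p c y powr (p - 1) = \<bar>d\<bar> * prox p c y powr (p - 1)"
      using prox_eq[of c y] prox_eq[of d y] unfolding e by linarith
    then show False using prox_pos[of y c] assms by auto
  qed
  then show ?thesis
    using prox_antimono[of c d y] assms by simp
qed

text \<open>Subtract the two defining equations and enlarge the power of \<open>prox p d y\<close>
  to that of \<open>prox p c y\<close>. The resulting Lipschitz bound gives continuity in c up to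
  and including c = 0.\<close>

lemma prox_diff_le:
  assumes "0 \<le> c" "c \<le> d"
  shows "prox p c y - prox p d y \<le> (d - c) * \<bar>y\<bar> powr (p - 1)"
proof -
  have "prox p c y - prox p d y = d * prox p d y powr (p - 1) - c * prox p c y powr (p - 1)"
    using prox_eq[of c y] prox_eq[of d y] assms by simp
  also have "\<dots> \<le> d * prox p c y powr (p - 1) - c * prox p c y powr (p - 1)"
    using assms p prox_antimono[OF assms, of y]
    by (intro diff_right_mono mult_left_mono powr_mono2) auto
  also have "\<dots> = (d - c) * prox p c y powr (p - 1)" by (simp add: algebra_simps)
  also have "\<dots> \<le> (d - c) * \<bar>y\<bar> powr (p - 1)"
    using assms p by (intro mult_left_mono powr_mono2 prox_le) auto
  finally show ?thesis .
qed

lemma continuous_on_prox: "continuous_on {0..} (\<lambda>c. prox p c y)"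
proof -
  define L where "L = \<bar>y\<bar> powr (p - 1)"
  have *: "\<bar>prox p c y - prox p d y\<bar> \<le> L * \<bar>c - d\<bar>" if "0 \<le> c" "0 \<le> d" for c d
    using prox_diff_le[of c d y] prox_diff_le[of d c y] prox_antimono[of c d y]
      prox_antimono[of d c y] that by (cases "c \<le> d") (auto simp: L_def mult.commute)
  have "L-lipschitz_on {0..} (\<lambda>c. prox p c y)"
    by (rule lipschitz_onI) (use * in \<open>auto simp: dist_real_def L_def\<close>)
  then show ?thesis by (rule lipschitz_on_continuous_on)
qed

lemma prox_tendsto_0: "((\<lambda>c. prox p c y) \<longlongrightarrow> 0) at_top"
proof (rule tendsto_sandwich[OF _ _ tendsto_const])
  show "\<forall>\<^sub>F c in at_top. prox p c y \<le> (\<bar>y\<bar> / c) powr (1 / (p - 1))"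
    using eventually_gt_at_top[of 0]
  proof eventually_elim
    case (elim c)
    have "\<bar>c\<bar> * prox p c y powr (p - 1) \<le> \<bar>y\<bar>"
      using prox_eq[of c y] prox_nonneg[of c y] by linarith
    then have "prox p c y powr (p - 1) \<le> \<bar>y\<bar> / c"
      using elim by (simp add: field_simps)
    then have "(prox p c y powr (p - 1)) powr (1 / (p - 1)) \<le> (\<bar>y\<bar> / c) powr (1 / (p - 1))"
      using p by (intro powr_mono2) auto
    then show ?case
      using p by (simp add: powr_powr)
  qed
  have "((\<lambda>c. \<bar>y\<bar> / c) \<longlongrightarrow> 0) at_top"
    by (intro tendsto_divide_0[OF tendsto_const] filterlim_at_top_imp_at_infinity filterlim_ident)
  then show "((\<lambda>c. (\<bar>y\<bar> / c) powr (1 / (p - 1))) \<longlongrightarrow> 0) at_top"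
    using p by (intro tendsto_zero_powrI[OF _ tendsto_const])
      (auto intro: eventually_mono[OF eventually_gt_at_top[of 0]])
qed auto

text \<open>Solved for c instead of x, the defining equation reads c = (\<bar>y\<bar> - x) x powr (1
  - p). This is an explicit function of x with nonzero derivative, and \<open>prox\<close> is its
  inverse.\<close>

lemma has_derivative_prox:
  assumes "0 < c" "y \<noteq> 0"
  shows "((\<lambda>c. prox p c y) has_real_derivative
    - (prox p c y powr (p - 1) / (1 + c * (p - 1) * prox p c y powr (p - 2)))) (at c)"
proof -
  define x where "x = prox p c y"
  have x: "x > 0" using prox_pos assms by (simp add: x_def)
  have xy: "\<bar>y\<bar> - x = c * x powr (p - 1)" using prox_eq[of c y] assms by (simp add: x_def)
  define E where "E = 1 + c * (p - 1) * x powr (p - 2)"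
  have E: "E > 0" using assms p x by (auto simp: E_def intro!: add_pos_nonneg)
  have pw: "x powr (1 - p) = inverse (x powr (p - 1))"
    using x by (simp flip: powr_minus)
  have "((\<lambda>x. (\<bar>y\<bar> - x) * x powr (1 - p)) has_real_derivative
      (- 1 * x powr (1 - p) + (1 - p) * x powr (1 - p - 1) * (\<bar>y\<bar> - x))) (at x)"
    using x by (auto intro!: derivative_eq_intros)
  also have "- 1 * x powr (1 - p) + (1 - p) * x powr (1 - p - 1) * (\<bar>y\<bar> - x) = - (E / x powr (p - 1))"
  proof -
    have "x powr (1 - p - 1) * x powr (p - 1) = x powr (p - 2) * x powr (1 - p)"
      using x by (simp flip: powr_add)
    then have *: "c * x powr (p - 1) * x powr (1 - p - 1) = c * x powr (p - 2) * x powr (1 - p)"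
      by (simp add: mult_ac)
    have "(1 - p) * x powr (1 - p - 1) * (c * x powr (p - 1)) =
        (1 - p) * (c * x powr (p - 1) * x powr (1 - p - 1))"
      by (simp only: mult_ac)
    also have "\<dots> = (1 - p) * (c * x powr (p - 2)) * x powr (1 - p)"
      unfolding * by (simp only: mult.assoc)
    finally show ?thesis
      unfolding xy E_def by (simp only: pw) (simp add: divide_inverse algebra_simps)
  qed
  finally have "((\<lambda>x. (\<bar>y\<bar> - x) * x powr (1 - p)) has_real_derivative - (E / x powr (p - 1))) (at (prox p c y))"
    by (simp add: x_def)
  then have "((\<lambda>c. prox p c y) has_real_derivative inverse (- (E / x powr (p - 1)))) (at c)"
  proof (rule DERIV_inverse_function)
    show "- (E / x powr (p - 1)) \<noteq> 0" using E x by simp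
    show "0 < c" "c < c + 1" using assms by auto
    show "(\<bar>y\<bar> - prox p t y) * prox p t y powr (1 - p) = t" if "0 < t" "t < c + 1" for t
    proof -
      have "\<bar>y\<bar> - prox p t y = t * prox p t y powr (p - 1)"
        using prox_eq[of t y] that by simp
      then show ?thesis
        using prox_pos[of y t] assms powr_add[of "prox p t y" "p - 1" "1 - p"] by simp
    qed
    have "continuous_on {0<..} (\<lambda>c. prox p c y)"
      by (rule continuous_on_subset[OF continuous_on_prox]) auto
    then show "isCont (\<lambda>c. prox p c y) c"
      using assms by (simp add: continuous_on_eq_continuous_at)
  qed
  then show ?thesis by (simp add: E_def x_def)
qed

lemma has_derivative_prox_powr:
  assumes "0 < c"
  shows "((\<lambda>c. prox p c y powr p) has_real_derivative
    - (p * (prox p c y powr (2 * p - 2) / (1 + c * (p - 1) * prox p c y powr (p - 2))))) (at c)"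
proof (cases "y = 0")
  case False
  define x where "x = prox p c y"
  have x: "x > 0" using prox_pos False by (simp add: x_def)
  have "((\<lambda>c. prox p c y powr p) has_real_derivative
      p * x powr (p - 1) * (- (x powr (p - 1) / (1 + c * (p - 1) * x powr (p - 2))))) (at c)"
    using x assms False unfolding x_def
    by (intro DERIV_chain2[OF has_real_derivative_powr has_derivative_prox]) auto
  moreover have "x powr (p - 1) * x powr (p - 1) = x powr (2 * p - 2)"
    using powr_add[of x "p - 1" "p - 1"] by (simp add: algebra_simps)
  then have "p * x powr (p - 1) * (- (x powr (p - 1) / (1 + c * (p - 1) * x powr (p - 2)))) =
    - (p * (x powr (2 * p - 2) / (1 + c * (p - 1) * x powr (p - 2))))"
    by simp
  ultimately show ?thesis by (simp only: x_def)
qed simp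

text \<open>Measurability is joint in c and y, as the interchange of integrals requires. There is no
  closed form for \<open>prox\<close>, but its sublevel sets are explicit by
  \<open>prox_le_iff\<close>.\<close>

lemma measurable_prox [measurable (raw)]:
  assumes [measurable]: "C \<in> borel_measurable M" "Y \<in> borel_measurable M"
  shows "(\<lambda>w. prox p (C w) (Y w)) \<in> borel_measurable M"
proof (subst borel_measurable_iff_le, intro allI)
  fix a
  have "{w \<in> space M. 0 \<le> a \<and> \<bar>Y w\<bar> \<le> a + \<bar>C w\<bar> * b} \<in> sets M" for b
    by measurable
  then show "{w \<in> space M. prox p (C w) (Y w) \<le> a} \<in> sets M"
    by (simp only: prox_le_iff)
qed

lemma measurable_expand [measurable]: "expand p c \<in> borel_measurable borel" "expand' p c \<in> borel_measurable borel"
  unfolding expand_def expand'_def by measurable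

lemma expand'_pos: "0 \<le> c \<Longrightarrow> 0 < expand' p c x"
  using p by (auto simp: expand'_def intro!: add_pos_nonneg)

lemma abs_expand: "0 \<le> c \<Longrightarrow> \<bar>expand p c x\<bar> = \<bar>x\<bar> + c * \<bar>x\<bar> powr (p - 1)"
proof (cases "x \<ge> 0")
  case False
  assume "0 \<le> c"
  then have "c * (- x) powr (p - 1) \<ge> 0" by simp
  then show ?thesis using False by (simp add: expand_def)
qed (cases "x = 0"; simp add: expand_def)

lemma prox_expand [simp]: "0 \<le> c \<Longrightarrow> prox p c (expand p c x) = \<bar>x\<bar>"
  by (rule prox_eqI) (auto simp: abs_expand)

lemma nn_integral_expand:
  assumes "0 < c" "f \<in> borel_measurable borel"
  shows "(\<integral>\<^sup>+x. f x \<partial>lborel) = (\<integral>\<^sup>+x. f (expand p c x) * ennreal (expand' p c x) \<partial>lborel)"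
proof (rule nn_integral_subst_odd)
  show "expand' p c (- x) = expand' p c x" for x by (simp add: expand'_def)
  show "(expand p c has_real_derivative expand' p c x) (at x)" if "x > 0" for x
  proof -
    have "((\<lambda>x. x + c * x powr (p - 1)) has_real_derivative expand' p c x) (at x)"
      using that by (auto intro!: derivative_eq_intros simp: expand'_def)
    then show ?thesis
    proof (rule has_field_derivative_transform_within_open)
      show "open {0::real<..}" "x \<in> {0<..}" using that by auto
    qed (auto simp: expand_def)
  qed
  show "continuous_on {0<..} (expand' p c)"
    unfolding expand'_def by (intro continuous_intros) auto
  show "expand p c ` {0<..} = {0<..}"
  proof (intro equalityI subsetI)
    fix y :: real assume y: "y \<in> {0<..}"
    then have "prox p c y > 0" by (intro prox_pos) auto
    moreover from this have "expand p c (prox p c y) = y"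
      using prox_eq[of c y] y assms by (simp add: expand_def)
    ultimately show "y \<in> expand p c ` {0<..}" by (metis greaterThan_iff image_eqI)
  qed (use assms in \<open>auto simp: expand_def intro!: add_pos_nonneg\<close>)
  show "expand p c (- x) = - expand p c x" for x by (simp add: expand_def sgn_minus)
  show "0 < expand' p c x" for x using assms by (intro expand'_pos) simp
qed (use assms measurable_expand in auto)

section \<open>Nearest points in sublevel sets\<close>

text \<open>The tangent inequality at x for the convex function \<bar>z\<bar> powr p. It is Young's
  inequality with the conjugate exponent q = p / (p - 1), for which (p - 1) q = p.\<close>

lemma powr_tangent_le:
  assumes "0 \<le> x"
  shows "x powr (p - 1) * (\<bar>z\<bar> - x) \<le> (\<bar>z\<bar> powr p - x powr p) / p"
proof -
  define q where "q = p / (p - 1)"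
  have q: "1 < q" "1 / p + 1 / q = 1" "(p - 1) * q = p" "1 / q = (p - 1) / p"
    using p by (auto simp: q_def field_simps)
  have "\<bar>z\<bar> * x powr (p - 1) \<le> \<bar>z\<bar> powr p / p + (x powr (p - 1)) powr q / q"
    using p q by (intro Youngs_inequality) auto
  also have "(x powr (p - 1)) powr q / q = x powr p * ((p - 1) / p)"
    using q by (simp add: powr_powr divide_inverse)
  finally show ?thesis
    using p assms powr_mult_base[of x "p - 1"] by (simp add: field_simps)
qed

lemma prox_power2: "prox p c y powr (2 * p - 2) = (prox p c y powr (p - 1))\<^sup>2"
  using powr_add[of "prox p c y" "p - 1" "p - 1"] by (simp add: power2_eq_square algebra_simps)

lemma prox_dist2_eq: "0 \<le> c \<Longrightarrow> prox_dist2 p n c y = (\<Sum>i<n. (\<bar>y i\<bar> - prox p c (y i))\<^sup>2)"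
proof -
  assume c: "0 \<le> c"
  have "\<bar>y i\<bar> - prox p c (y i) = c * prox p c (y i) powr (p - 1)" for i
    using prox_eq[of c "y i"] c by simp
  then show ?thesis
    by (simp add: prox_dist2_def lp_sum_def power_mult_distrib sum_distrib_left prox_power2 prox_nonneg)
qed

lemma prox_sum_antimono: "0 \<le> c \<Longrightarrow> c \<le> d \<Longrightarrow> prox_sum p n d y \<le> prox_sum p n c y"
  using p unfolding prox_sum_def lp_sum_def
  by (intro sum_mono powr_mono2) (auto simp: prox_nonneg prox_antimono)

lemma prox_sum_strict_antimono:
  assumes "0 \<le> c" "c < d" "0 < lp_sum p n y"
  shows "prox_sum p n d y < prox_sum p n c y"
proof -
  obtain i where i: "i < n" "y i \<noteq> 0" using assms(3) by (auto simp: lp_sum_pos_iff)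
  then have "prox p d (y i) powr p < prox p c (y i) powr p"
    using p assms prox_strict_antimono[of c d "y i"] by (intro powr_less_mono2) (auto simp: prox_nonneg)
  moreover have "prox p d (y j) powr p \<le> prox p c (y j) powr p" for j
    using p assms by (intro powr_mono2) (auto simp: prox_nonneg prox_antimono)
  ultimately show ?thesis
    using i p unfolding prox_sum_def lp_sum_def by (intro sum_strict_mono_ex1) (auto simp: prox_nonneg)
qed

lemma prox_sum_0 [simp]: "prox_sum p n 0 y = lp_sum p n y"
  using p by (simp add: prox_sum_def lp_sum_def)

lemma prox_dist2_mono:
  assumes "0 \<le> c" "c \<le> d"
  shows "prox_dist2 p n c y \<le> prox_dist2 p n d y"
  using assms unfolding prox_dist2_eq[OF assms(1)] prox_dist2_eq[OF order_trans[OF assms]]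
  by (intro sum_mono power_mono diff_left_mono prox_antimono) (auto simp: prox_le)

lemma continuous_on_prox_sum: "continuous_on {0..} (\<lambda>c. prox_sum p n c y)"
  using p unfolding prox_sum_def lp_sum_def
  by (intro continuous_intros continuous_on_powr' continuous_on_prox) auto

lemma continuous_on_prox_dist2: "continuous_on {0..} (\<lambda>c. prox_dist2 p n c y)"
  using p unfolding prox_dist2_def lp_sum_def
  by (intro continuous_intros continuous_on_powr' continuous_on_prox) auto

lemma prox_sum_tendsto_0: "((\<lambda>c. prox_sum p n c y) \<longlongrightarrow> 0) at_top"
  using p unfolding prox_sum_def lp_sum_def
  by (intro tendsto_null_sum tendsto_zero_powrI[OF _ tendsto_const] tendsto_rabs_zero prox_tendsto_0) auto

text \<open>The level decreases strictly and continuously from that of y at c = 0 to the limit 0, so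
  c parametrizes all levels below that of y.\<close>

lemma prox_sum_image:
  assumes "0 < lp_sum p n y"
  shows "(\<lambda>c. prox_sum p n c y) ` {0<..} = {0<..<lp_sum p n y}"
proof (intro equalityI subsetI)
  fix R assume "R \<in> (\<lambda>c. prox_sum p n c y) ` {0<..}"
  then obtain c where c: "c > 0" "R = prox_sum p n c y" by auto
  obtain i where "i < n" "y i \<noteq> 0" using assms by (auto simp: lp_sum_pos_iff)
  then have "0 < prox_sum p n c y"
    using prox_pos[of "y i" c] by (auto simp: prox_sum_def lp_sum_pos_iff)
  then show "R \<in> {0<..<lp_sum p n y}"
    using prox_sum_strict_antimono[of 0 c n y] c assms by simp
next
  fix R assume R: "R \<in> {0<..<lp_sum p n y}"
  have "\<forall>\<^sub>F c in at_top. prox_sum p n c y < R \<and> c > 0"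
    using R order_tendstoD(2)[OF prox_sum_tendsto_0] by (intro eventually_conj eventually_gt_at_top) auto
  then obtain d where d: "prox_sum p n d y < R" "d > 0"
    by (metis (mono_tags, lifting) eventually_at_top_linorder order_refl)
  have "\<exists>c\<ge>0. c \<le> d \<and> prox_sum p n c y = R"
    using d R continuous_on_subset[OF continuous_on_prox_sum, of "{0..d}"] by (intro IVT2') auto
  then obtain c where "0 \<le> c" "prox_sum p n c y = R" by blast
  moreover from this have "c \<noteq> 0" using R by auto
  ultimately show "R \<in> (\<lambda>c. prox_sum p n c y) ` {0<..}" by force
qed

text \<open>
  The point with coordinates \<open>sgn (y i) * prox p c (y i)\<close> is the metric projection of \<open>y\<close> onto
  the sublevel set through it, because its offset from \<open>y\<close> is \<open>c / p\<close> times the gradient of \<open>lp_sum p n\<close>.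
\<close>

lemma prox_projection:
  assumes y: "y \<in> {..<n} \<rightarrow>\<^sub>E UNIV" and "0 \<le> c" "0 \<le> \<rho>"
  shows "y \<in> parallel_body n (lp_ball p n (prox_sum p n c y)) \<rho> \<longleftrightarrow> prox_dist2 p n c y \<le> \<rho>\<^sup>2"
proof -
  define x where "x = (\<lambda>i\<in>{..<n}. sgn (y i) * prox p c (y i))"
  have x_abs: "\<bar>x i\<bar> = prox p c (y i)" if "i < n" for i
    using that p by (auto simp: x_def abs_mult sgn_if prox_nonneg)
  have xK: "x \<in> lp_ball p n (prox_sum p n c y)"
    using lp_sum_cong[of n x "\<lambda>i. prox p c (y i)" p] x_abs p
    by (auto simp: lp_ball_def prox_sum_def x_def prox_nonneg)
  have yx: "y i - x i = sgn (y i) * (c * prox p c (y i) powr (p - 1))" if "i < n" for i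
  proof -
    have "y i = sgn (y i) * \<bar>y i\<bar>" by (simp add: sgn_mult_abs)
    also have "\<bar>y i\<bar> = prox p c (y i) + c * prox p c (y i) powr (p - 1)"
      using prox_eq[of c "y i"] assms by simp
    finally show ?thesis using that by (simp add: x_def algebra_simps)
  qed
  have yx2: "(\<Sum>i<n. (y i - x i)\<^sup>2) = prox_dist2 p n c y"
    unfolding prox_dist2_eq[OF assms(2)]
  proof (intro sum.cong refl)
    fix i assume "i \<in> {..<n}"
    then show "(y i - x i)\<^sup>2 = (\<bar>y i\<bar> - prox p c (y i))\<^sup>2"
      using p by (cases "y i" "0::real" rule: linorder_cases) (auto simp: x_def power2_eq_square algebra_simps)
  qed
  have le: "prox_dist2 p n c y \<le> (\<Sum>i<n. (y i - z i)\<^sup>2)"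
    if z: "z \<in> lp_ball p n (prox_sum p n c y)" for z
  proof -
    \<comment> \<open>Expand the square around x i and bound the cross term by
      \<open>powr_tangent_le\<close>. After summation the correction is 2 c / p times the difference
      between the level of z and that of x, which is at most 0 for z in the ball.\<close>
    have "(y i - x i)\<^sup>2 - 2 * c / p * (\<bar>z i\<bar> powr p - prox p c (y i) powr p) \<le> (y i - z i)\<^sup>2"
      if i: "i < n" for i
    proof -
      define t where "t = prox p c (y i)"
      have t: "0 \<le> t" using p by (simp add: t_def prox_nonneg)
      have "(y i - x i) * (z i - x i) \<le> c * (t powr (p - 1) * (\<bar>z i\<bar> - t))"
      proof (cases "y i = 0")
        case True
        then show ?thesis using i p by (simp add: x_def t_def)
      next
        case False
        have "(y i - x i) * (z i - x i) = c * t powr (p - 1) * (sgn (y i) * z i - t)"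
          using False i unfolding yx[OF i] by (simp add: x_def t_def algebra_simps sgn_if)
        also have "\<dots> \<le> c * t powr (p - 1) * (\<bar>z i\<bar> - t)"
          using assms(2) by (intro mult_left_mono diff_right_mono) (auto simp: sgn_if)
        finally show ?thesis by (simp add: mult.assoc)
      qed
      also have "\<dots> \<le> c * ((\<bar>z i\<bar> powr p - t powr p) / p)"
        using assms t by (intro mult_left_mono powr_tangent_le) auto
      finally have "2 * ((y i - x i) * (z i - x i)) \<le> 2 * c / p * (\<bar>z i\<bar> powr p - t powr p)"
        by simp
      moreover have "(y i - z i)\<^sup>2 = (y i - x i)\<^sup>2 - 2 * ((y i - x i) * (z i - x i)) + (z i - x i)\<^sup>2"
        by (simp add: power2_eq_square algebra_simps)
      ultimately show ?thesis
        using zero_le_power2[of "z i - x i"] unfolding t_def by linarith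
    qed
    then have "(\<Sum>i<n. (y i - x i)\<^sup>2 - 2 * c / p * (\<bar>z i\<bar> powr p - prox p c (y i) powr p)) \<le> (\<Sum>i<n. (y i - z i)\<^sup>2)"
      by (intro sum_mono) auto
    also have "(\<Sum>i<n. (y i - x i)\<^sup>2 - 2 * c / p * (\<bar>z i\<bar> powr p - prox p c (y i) powr p)) =
        prox_dist2 p n c y - 2 * c / p * (lp_sum p n z - prox_sum p n c y)"
      using p by (simp only: sum_subtractf yx2 flip: sum_distrib_left)
        (simp add: lp_sum_def prox_sum_def sum_subtractf prox_nonneg)
    finally show ?thesis
      using mult_nonneg_nonpos[of "2 * c / p" "lp_sum p n z - prox_sum p n c y"] z assms(2) p
      by (simp add: lp_ball_def)
  qed
  show ?thesis
    unfolding mem_parallel_body_iff[OF y lp_ball_subset assms(3)]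
  proof
    assume "\<exists>z\<in>lp_ball p n (prox_sum p n c y). (\<Sum>i<n. (y i - z i)\<^sup>2) \<le> \<rho>\<^sup>2"
    then show "prox_dist2 p n c y \<le> \<rho>\<^sup>2" using le by fastforce
  qed (auto intro!: bexI[OF _ xK] simp: yx2)
qed

text \<open>Membership is an existence statement over uncountably many points z; countably many
  conditions make it measurable. Let c be the parameter with level R. A rational q \<ge> c satisfies
  the first alternative, and a smaller one the second if the distance at c is at most \<rho>.
  Conversely, if the distance at c exceeds \<rho>, then by continuity it still does at a rational
  slightly below c, where the level exceeds R.\<close>

lemma mem_parallel_body_rat_iff:
  assumes y: "y \<in> {..<n} \<rightarrow>\<^sub>E UNIV" and R: "0 < R" and "0 \<le> \<rho>"
  shows "y \<in> parallel_body n (lp_ball p n R) \<rho> \<longleftrightarrow>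
    (\<forall>q::rat. 0 < q \<longrightarrow> prox_sum p n (of_rat q) y \<le> R \<or> prox_dist2 p n (of_rat q) y \<le> \<rho>\<^sup>2)"
    (is "_ \<longleftrightarrow> ?rhs")
proof (cases "lp_sum p n y \<le> R")
  case True
  then have "y \<in> lp_ball p n R" using y by (simp add: lp_ball_def)
  then have "y \<in> parallel_body n (lp_ball p n R) \<rho>"
    unfolding mem_parallel_body_iff[OF y lp_ball_subset assms(3)] by (intro bexI[of _ y]) auto
  moreover have ?rhs
  proof (intro allI impI disjI1)
    fix q :: rat assume "0 < q"
    then show "prox_sum p n (of_rat q) y \<le> R"
      using prox_sum_antimono[of 0 "of_rat q" n y] True by simp
  qed
  ultimately show ?thesis by simp
next
  case False
  then have "R \<in> (\<lambda>c. prox_sum p n c y) ` {0<..}"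
    using prox_sum_image[of n y] R by auto
  then obtain c where c: "c > 0" and Rc: "R = prox_sum p n c y" by auto
  have pos: "0 < lp_sum p n y" using False R by simp
  have "y \<in> parallel_body n (lp_ball p n R) \<rho> \<longleftrightarrow> prox_dist2 p n c y \<le> \<rho>\<^sup>2"
    unfolding Rc using c assms by (intro prox_projection) auto
  also have "\<dots> \<longleftrightarrow> ?rhs"
  proof
    assume le: "prox_dist2 p n c y \<le> \<rho>\<^sup>2"
    show ?rhs
    proof (intro allI impI)
      fix q :: rat assume "0 < q"
      then show "prox_sum p n (of_rat q) y \<le> R \<or> prox_dist2 p n (of_rat q) y \<le> \<rho>\<^sup>2"
        using prox_sum_antimono[of c "of_rat q" n y] prox_dist2_mono[of "of_rat q" c n y] c le Rc
        by (cases "c \<le> of_rat q") auto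
    qed
  next
    assume rhs: ?rhs
    show "prox_dist2 p n c y \<le> \<rho>\<^sup>2"
    proof (rule ccontr)
      assume "\<not> ?thesis"
      then have gt: "\<rho>\<^sup>2 < prox_dist2 p n c y" by simp
      have "continuous_on {0<..} (\<lambda>c. prox_dist2 p n c y)"
        by (rule continuous_on_subset[OF continuous_on_prox_dist2]) auto
      then have "isCont (\<lambda>c. prox_dist2 p n c y) c"
        using c by (simp add: continuous_on_eq_continuous_at)
      then have "\<forall>\<^sub>F t in at c. \<rho>\<^sup>2 < prox_dist2 p n t y"
        using gt unfolding isCont_def by (rule order_tendstoD(1))
      then have "\<forall>\<^sub>F t in at_left c. \<rho>\<^sup>2 < prox_dist2 p n t y"
        by (simp add: eventually_at_split)
      then obtain b where b: "b < c" "\<And>t. b < t \<Longrightarrow> t < c \<Longrightarrow> \<rho>\<^sup>2 < prox_dist2 p n t y"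
        unfolding eventually_at_left_field by blast
      obtain q where q: "max 0 b < of_rat q" "of_rat q < c"
        using of_rat_dense[of "max 0 b" c] b c by auto
      then have "prox_dist2 p n (of_rat q) y \<le> \<rho>\<^sup>2 \<or> prox_sum p n (of_rat q) y \<le> R" "0 < q"
        using rhs by auto
      then show False
        using b(2)[of "of_rat q"] q prox_sum_strict_antimono[of "of_rat q" c n y] pos Rc by auto
    qed
  qed
  finally show ?thesis .
qed

lemma measurable_prox_sum [measurable (raw)]:
  assumes [measurable]: "C \<in> borel_measurable M" "Y \<in> M \<rightarrow>\<^sub>M lborel_n n"
  shows "(\<lambda>w. prox_sum p n (C w) (Y w)) \<in> borel_measurable M"
    and "(\<lambda>w. prox_dist2 p n (C w) (Y w)) \<in> borel_measurable M"
proof -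
  have [measurable]: "(\<lambda>w. prox p (C w) (Y w i)) \<in> borel_measurable M" if "i < n" for i
    using that by (rule measurable_prox[OF assms(1) measurable_lborel_n_component[OF _ assms(2)]])
  show "(\<lambda>w. prox_sum p n (C w) (Y w)) \<in> borel_measurable M"
    "(\<lambda>w. prox_dist2 p n (C w) (Y w)) \<in> borel_measurable M"
    unfolding prox_sum_def prox_dist2_def
    by (intro measurable_lp_sum_pointwise borel_measurable_times borel_measurable_power assms; measurable)+
qed

text \<open>Level, width and point vary together, because in \<open>nn_integral_shells\<close> the
  width depends on the level, and after the first substitution the level depends on the
  point.\<close>

lemma measurable_parallel_body:
  assumes [measurable]: "R \<in> borel_measurable M" "\<rho> \<in> borel_measurable M" "Y \<in> M \<rightarrow>\<^sub>M lborel_n n"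
    and nn: "\<And>w. w \<in> space M \<Longrightarrow> 0 < R w \<Longrightarrow> 0 \<le> \<rho> w"
  shows "Measurable.pred M (\<lambda>w. 0 < R w \<and> Y w \<in> parallel_body n (lp_ball p n (R w)) (\<rho> w))"
proof -
  have "Measurable.pred M (\<lambda>w. 0 < R w \<and> (\<forall>q::rat. 0 < q \<longrightarrow>
      prox_sum p n (of_rat q) (Y w) \<le> R w \<or> prox_dist2 p n (of_rat q) (Y w) \<le> (\<rho> w)\<^sup>2))"
    by measurable
  moreover have "(0 < R w \<and> Y w \<in> parallel_body n (lp_ball p n (R w)) (\<rho> w)) \<longleftrightarrow>
      (0 < R w \<and> (\<forall>q::rat. 0 < q \<longrightarrow>
      prox_sum p n (of_rat q) (Y w) \<le> R w \<or> prox_dist2 p n (of_rat q) (Y w) \<le> (\<rho> w)\<^sup>2))"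
    if "w \<in> space M" for w
  proof (cases "0 < R w")
    case True
    have "Y w \<in> {..<n} \<rightarrow>\<^sub>E UNIV"
      using measurable_space[OF assms(3) that] by (simp add: space_lborel_n)
    from mem_parallel_body_rat_iff[OF this True nn[OF that True]] show ?thesis by simp
  qed simp
  ultimately show ?thesis by (simp cong: measurable_cong)
qed

section \<open>The average volume of the shells\<close>

lemma has_derivative_prox_sum:
  assumes "0 < c"
  shows "((\<lambda>c. prox_sum p n c y) has_real_derivative - prox_speed p n c y) (at c)"
proof -
  have "((\<lambda>c. \<Sum>i<n. prox p c (y i) powr p) has_real_derivative
    (\<Sum>i<n. - (p * (prox p c (y i) powr (2 * p - 2) / (1 + c * (p - 1) * prox p c (y i) powr (p - 2)))))) (at c)"
    using assms by (intro DERIV_sum has_derivative_prox_powr)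
  then show ?thesis
    by (simp add: prox_sum_def lp_sum_def prox_speed_def sum_negf sum_distrib_left prox_nonneg)
qed

lemma prox_speed_nonneg: "0 \<le> c \<Longrightarrow> 0 \<le> prox_speed p n c y"
  using p unfolding prox_speed_def
  by (intro mult_nonneg_nonneg sum_nonneg divide_nonneg_nonneg add_nonneg_nonneg) auto

lemma prox_speed_pos:
  assumes "0 \<le> c" "0 < lp_sum p n y"
  shows "0 < prox_speed p n c y"
proof -
  obtain i where i: "i < n" "y i \<noteq> 0" using assms(2) by (auto simp: lp_sum_pos_iff)
  have den: "0 < 1 + c * (p - 1) * prox p c (y j) powr (p - 2)" for j
    using assms p by (intro add_pos_nonneg) auto
  have "0 < prox p c (y i) powr (2 * p - 2) / (1 + c * (p - 1) * prox p c (y i) powr (p - 2))"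
    using prox_pos[OF i(2), of c] den[of i] by simp
  then show ?thesis
    using i den p unfolding prox_speed_def
    by (intro mult_pos_pos sum_pos2[of _ i] divide_nonneg_pos) auto
qed

lemma prox_speed_eq_0: "lp_sum p n y = 0 \<Longrightarrow> prox_speed p n c y = 0"
  using lp_sum_pos_iff[of p n y] p by (simp add: prox_speed_def prox_0)

lemma continuous_on_prox_speed: "continuous_on {0<..} (\<lambda>c. prox_speed p n c y)"
proof -
  have "continuous_on {0<..} (\<lambda>c. prox p c a powr (2 * p - 2) / (1 + c * (p - 1) * prox p c a powr (p - 2)))" for a
  proof (cases "a = 0")
    case False
    have cp: "continuous_on {0<..} (\<lambda>c. prox p c a)"
      by (rule continuous_on_subset[OF continuous_on_prox]) auto
    have pos: "0 < prox p c a" for c by (rule prox_pos[OF False])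
    have "0 < 1 + c * (p - 1) * prox p c a powr (p - 2)" if "c > 0" for c
      using that p by (intro add_pos_nonneg) auto
    then show ?thesis
      using pos by (intro continuous_intros cp ballI) (auto simp: less_imp_neq[symmetric])
  qed (simp add: prox_0)
  then show ?thesis unfolding prox_speed_def by (intro continuous_on_mult_left continuous_on_sum)
qed

lemma measurable_prox_speed [measurable (raw)]:
  assumes [measurable]: "C \<in> borel_measurable M" "Y \<in> M \<rightarrow>\<^sub>M lborel_n n"
  shows "(\<lambda>w. prox_speed p n (C w) (Y w)) \<in> borel_measurable M"
proof -
  have [measurable]: "(\<lambda>w. prox p (C w) (Y w i)) \<in> borel_measurable M" if "i < n" for i
    using that by (rule measurable_prox[OF assms(1) measurable_lborel_n_component[OF _ assms(2)]])
  show ?thesis unfolding prox_speed_def by measurable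
qed

lemma nn_integral_prox_sum:
  fixes h :: "real \<Rightarrow> ennreal"
  assumes [measurable]: "h \<in> borel_measurable borel"
  shows "(\<integral>\<^sup>+R. h R * indicator {0<..<lp_sum p n y} R \<partial>lborel) =
    (\<integral>\<^sup>+c\<in>{0<..}. h (prox_sum p n c y) * ennreal (prox_speed p n c y) \<partial>lborel)"
proof (cases "lp_sum p n y = 0")
  case True
  then show ?thesis by (simp add: prox_speed_eq_0)
next
  case False
  then have pos: "0 < lp_sum p n y" using lp_sum_nonneg[of p n y] by linarith
  \<comment> \<open>\<open>prox_sum\<close> decreases in c while the substitution rule is for
    increasing maps; hence the reflection of R to - R.\<close>
  have "(\<integral>\<^sup>+R. h R * indicator {0<..<lp_sum p n y} R \<partial>lborel) =
      (\<integral>\<^sup>+R. h (- R) * indicator {- lp_sum p n y<..<0} R \<partial>lborel)"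
    by (subst nn_integral_real_affine[of _ "-1" 0]) (auto simp: indicator_def intro!: nn_integral_cong)
  also have "\<dots> = (\<integral>\<^sup>+c\<in>{0<..}. h (- (- prox_sum p n c y)) * ennreal (prox_speed p n c y) \<partial>lborel)"
  proof (rule nn_integral_subst_halfline)
    show "((\<lambda>c. - prox_sum p n c y) has_real_derivative prox_speed p n c y) (at c)" if "c > 0" for c
      using DERIV_minus[OF has_derivative_prox_sum[OF that, of n y]] by simp
    have "(\<lambda>c. - prox_sum p n c y) ` {0<..} = uminus ` ((\<lambda>c. prox_sum p n c y) ` {0<..})"
      by (simp add: image_image)
    also have "\<dots> = {- lp_sum p n y<..<0}"
      unfolding prox_sum_image[OF pos] by simp
    finally show "(\<lambda>c. - prox_sum p n c y) ` {0<..} = {- lp_sum p n y<..<0}" .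
  qed (use continuous_on_prox_speed prox_speed_pos pos in auto)
  finally show ?thesis by simp
qed

lemma weight_nonneg: "0 \<le> c \<Longrightarrow> 0 \<le> weight p n c x"
  using p unfolding weight_def
  by (intro mult_nonneg_nonneg sum_nonneg prod_nonneg) (auto intro!: less_imp_le expand'_pos)

lemma measurable_weight [measurable (raw)]:
  assumes C [measurable]: "C \<in> borel_measurable M" and X [measurable]: "X \<in> M \<rightarrow>\<^sub>M lborel_n n"
  shows "(\<lambda>w. weight p n (C w) (X w)) \<in> borel_measurable M"
proof -
  have 1: "(\<lambda>w. \<bar>X w k\<bar> powr (2 * p - 2)) \<in> borel_measurable M" if "k < n" for k
    using measurable_lborel_n_component[OF that X] by measurable
  have 2: "(\<lambda>w. expand' p (C w) (X w k)) \<in> borel_measurable M" if "k < n" for k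
    using measurable_lborel_n_component[OF that X] unfolding expand'_def by measurable
  have [measurable]: "(\<lambda>w. \<Sum>i<n. \<bar>X w i\<bar> powr (2 * p - 2) * (\<Prod>k\<in>{..<n} - {i}. expand' p (C w) (X w k))) \<in> borel_measurable M"
    using 1 2 by (intro borel_measurable_sum borel_measurable_times borel_measurable_prod) auto
  show ?thesis unfolding weight_def by measurable
qed

text \<open>\<open>prox\<close> undoes \<open>expand\<close> up to sign, so every quantity at the
  point y becomes explicit in x.\<close>

lemma prox_expand_vector:
  fixes n :: nat
  assumes c: "0 < c"
  defines "y \<equiv> \<lambda>x. \<lambda>i\<in>{..<n}. expand p c (x i)"
  shows "prox_sum p n c (y x) = lp_sum p n x"
    and "prox_dist2 p n c (y x) = c\<^sup>2 * lp_sum (2 * p - 2) n x"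
    and "exp (- lp_sum p n x) * prox_speed p n c (y x) * (\<Prod>i<n. expand' p c (x i)) = weight p n c x"
proof -
  have prox_y: "prox p c (y x i) = \<bar>x i\<bar>" if "i < n" for i
    using that c by (simp add: y_def)
  show "prox_sum p n c (y x) = lp_sum p n x"
    unfolding prox_sum_def by (intro lp_sum_cong) (simp add: prox_y)
  show "prox_dist2 p n c (y x) = c\<^sup>2 * lp_sum (2 * p - 2) n x"
    unfolding prox_dist2_def using lp_sum_cong[of n "\<lambda>i. prox p c (y x i)" x] by (simp add: prox_y)
  have "prox_speed p n c (y x) = p * (\<Sum>i<n. \<bar>x i\<bar> powr (2 * p - 2) / expand' p c (x i))"
    unfolding prox_speed_def expand'_def
    by (intro arg_cong[of _ _ "(*) p"] sum.cong refl) (simp add: prox_y)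
  moreover have "(\<Sum>i<n. \<bar>x i\<bar> powr (2 * p - 2) / expand' p c (x i)) * (\<Prod>i<n. expand' p c (x i)) =
      (\<Sum>i<n. \<bar>x i\<bar> powr (2 * p - 2) * (\<Prod>k\<in>{..<n} - {i}. expand' p c (x k)))"
    unfolding sum_distrib_right
  proof (intro sum.cong refl)
    fix i assume "i \<in> {..<n}"
    then have "(\<Prod>i<n. expand' p c (x i)) = expand' p c (x i) * (\<Prod>k\<in>{..<n} - {i}. expand' p c (x k))"
      by (intro prod.remove) auto
    then show "\<bar>x i\<bar> powr (2 * p - 2) / expand' p c (x i) * (\<Prod>i<n. expand' p c (x i)) =
        \<bar>x i\<bar> powr (2 * p - 2) * (\<Prod>k\<in>{..<n} - {i}. expand' p c (x k))"
      using expand'_pos[of c "x i"] c by simp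
  qed
  ultimately show "exp (- lp_sum p n x) * prox_speed p n c (y x) * (\<Prod>i<n. expand' p c (x i)) = weight p n c x"
    by (simp only: weight_def mult.assoc)
qed

text \<open>
  The left-hand side averages the volume of the shells over all levels \<open>R\<close>. For fixed \<open>y\<close> one
  substitutes \<open>R = prox_sum p n c y\<close>, then for fixed \<open>c\<close> the coordinatewise map \<open>expand p c\<close>.
  This avoids surface integrals.
\<close>

lemma nn_integral_shells:
  fixes \<rho> :: "real \<Rightarrow> real"
  assumes [measurable]: "\<rho> \<in> borel_measurable borel" and \<rho>: "\<And>R. 0 < R \<Longrightarrow> 0 \<le> \<rho> R"
  shows "(\<integral>\<^sup>+R\<in>{0<..}. ennreal (exp (- R)) * emeasure (lborel_n n) (parallel_body n (lp_ball p n R) (\<rho> R) - lp_ball p n R) \<partial>lborel) =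
    (\<integral>\<^sup>+x. \<integral>\<^sup>+c. (if 0 < c \<and> c\<^sup>2 * lp_sum (2 * p - 2) n x \<le> (\<rho> (lp_sum p n x))\<^sup>2
       then ennreal (weight p n c x) else 0) \<partial>lborel \<partial>lborel_n n)"
    (is "nn_integral _ ?A = _")
proof -
  let ?L = "lborel_n n"
  interpret L: sigma_finite_measure ?L by (rule sigma_finite_lborel_n)
  interpret P: pair_sigma_finite lborel ?L by standard
  define S where "S R y \<longleftrightarrow> 0 < R \<and> y \<in> parallel_body n (lp_ball p n R) (\<rho> R)" for R y
  have S_meas [measurable]: "Measurable.pred M (\<lambda>w. S (f w) (g w))"
    if [measurable]: "f \<in> borel_measurable M" "g \<in> M \<rightarrow>\<^sub>M ?L" for M and f :: "'z \<Rightarrow> real" and g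
    unfolding S_def by (intro measurable_parallel_body) (auto intro: \<rho>)
  \<comment> \<open>\<open>B\<close>, \<open>F\<close> and \<open>G\<close> are the same integrand
    in the variables (R, y), (c, y) and (c, x); each change of variables contributes its
    derivative.\<close>
  define B where "B R y = (if S R y \<and> R < lp_sum p n y then ennreal (exp (- R)) else 0)" for R y
  have [measurable]: "(\<lambda>(R, y). B R y) \<in> borel_measurable (lborel \<Otimes>\<^sub>M ?L)"
    unfolding B_def by measurable
  define F where "F c y = (if 0 < c \<and> S (prox_sum p n c y) y
    then ennreal (exp (- prox_sum p n c y)) * ennreal (prox_speed p n c y) else 0)" for c y
  have [measurable]: "(\<lambda>(c, y). F c y) \<in> borel_measurable (lborel \<Otimes>\<^sub>M ?L)"
    unfolding F_def by measurable
  define G where "G c x = (if 0 < c \<and> c\<^sup>2 * lp_sum (2 * p - 2) n x \<le> (\<rho> (lp_sum p n x))\<^sup>2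
    then ennreal (weight p n c x) else 0)" for c x
  have [measurable]: "(\<lambda>(c, x). G c x) \<in> borel_measurable (lborel \<Otimes>\<^sub>M ?L)"
    unfolding G_def by measurable
  have "nn_integral lborel ?A = (\<integral>\<^sup>+R. \<integral>\<^sup>+y. B R y \<partial>?L \<partial>lborel)"
  proof (rule nn_integral_cong)
    fix R :: real
    show "?A R = (\<integral>\<^sup>+y. B R y \<partial>?L)"
    proof (cases "0 < R")
      case True
      have "parallel_body n (lp_ball p n R) (\<rho> R) - lp_ball p n R = {y \<in> space ?L. S R y \<and> R < lp_sum p n y}"
        using True subsetD[OF parallel_body_subset, of _ n "lp_ball p n R" "\<rho> R"]
        unfolding space_lborel_n lp_ball_def S_def by auto
      then show ?thesis
        using True by (simp add: nn_integral_cmult_indicator[symmetric])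
          (auto intro!: nn_integral_cong simp: indicator_def B_def)
    qed (simp add: S_def B_def)
  qed
  also have "\<dots> = (\<integral>\<^sup>+y. \<integral>\<^sup>+R. B R y \<partial>lborel \<partial>?L)"
    by (rule P.Fubini'[symmetric]) measurable
  also have "\<dots> = (\<integral>\<^sup>+y. \<integral>\<^sup>+c. F c y \<partial>lborel \<partial>?L)"
  proof (rule nn_integral_cong)
    fix y assume [simp]: "y \<in> space ?L"
    define h where "h R = (if S R y then ennreal (exp (- R)) else 0)" for R
    have [measurable]: "h \<in> borel_measurable borel" unfolding h_def by measurable
    have "(\<integral>\<^sup>+R. B R y \<partial>lborel) = (\<integral>\<^sup>+R. h R * indicator {0<..<lp_sum p n y} R \<partial>lborel)"
      by (intro nn_integral_cong) (auto simp: h_def indicator_def S_def B_def)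
    also have "\<dots> = (\<integral>\<^sup>+c\<in>{0<..}. h (prox_sum p n c y) * ennreal (prox_speed p n c y) \<partial>lborel)"
      by (rule nn_integral_prox_sum) measurable
    also have "\<dots> = (\<integral>\<^sup>+c. F c y \<partial>lborel)"
      by (intro nn_integral_cong) (auto simp: h_def F_def indicator_def)
    finally show "(\<integral>\<^sup>+R. B R y \<partial>lborel) = (\<integral>\<^sup>+c. F c y \<partial>lborel)" .
  qed
  also have "\<dots> = (\<integral>\<^sup>+c. \<integral>\<^sup>+y. F c y \<partial>?L \<partial>lborel)"
    by (rule P.Fubini') measurable
  also have "\<dots> = (\<integral>\<^sup>+c. \<integral>\<^sup>+x. G c x \<partial>?L \<partial>lborel)"
    (is "nn_integral _ ?f = nn_integral _ ?g")
  proof (rule nn_integral_cong)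
    fix c :: real
    show "?f c = ?g c"
    proof (cases "0 < c")
      case c: True
      have "(\<integral>\<^sup>+y. F c y \<partial>?L) = (\<integral>\<^sup>+x. F c (\<lambda>i\<in>{..<n}. expand p c (x i)) * (\<Prod>i<n. ennreal (expand' p c (x i))) \<partial>?L)"
        using c by (intro nn_integral_lborel_n_subst nn_integral_expand measurable_expand) auto
      also have "\<dots> = (\<integral>\<^sup>+x. G c x \<partial>?L)"
      proof (rule nn_integral_cong)
        fix x :: "nat \<Rightarrow> real"
        define y where "y = (\<lambda>i\<in>{..<n}. expand p c (x i))"
        have y: "y \<in> {..<n} \<rightarrow>\<^sub>E UNIV" by (simp add: y_def)
        note expand_x = prox_expand_vector[OF c, where n = n and x = x, folded y_def]
        have pos: "0 < expand' p c a" for a using c by (intro expand'_pos) auto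
        show "F c y * (\<Prod>i<n. ennreal (expand' p c (x i))) = G c x"
        \<comment> \<open>At the origin the level is 0, so \<open>S\<close> is false, and the weight
          vanishes as well; both sides are 0.\<close>
        proof (cases "lp_sum p n x = 0")
          case True
          then have "\<forall>i<n. x i = 0" using lp_sum_pos_iff[of p n x] by auto
          then have "weight p n c x = 0" by (simp add: weight_def)
          then show ?thesis
            using True by (simp add: F_def G_def expand_x prox_speed_eq_0 S_def)
        next
          case False
          then have N: "0 < lp_sum p n x" using lp_sum_nonneg[of p n x] by linarith
          have "S (lp_sum p n x) y \<longleftrightarrow> c\<^sup>2 * lp_sum (2 * p - 2) n x \<le> (\<rho> (lp_sum p n x))\<^sup>2"
            using prox_projection[OF y, of c "\<rho> (lp_sum p n x)"] N c \<rho>[OF N] unfolding S_def expand_x by simp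
          moreover have "ennreal (exp (- lp_sum p n x)) * ennreal (prox_speed p n c y) * (\<Prod>i<n. ennreal (expand' p c (x i))) =
              ennreal (weight p n c x)"
          proof -
            have "(\<Prod>i<n. ennreal (expand' p c (x i))) = ennreal (\<Prod>i<n. expand' p c (x i))"
              using pos by (intro prod_ennreal) (simp add: less_imp_le)
            moreover have "0 \<le> prox_speed p n c y" "0 \<le> (\<Prod>i<n. expand' p c (x i))"
              using pos c by (auto intro!: prox_speed_nonneg prod_nonneg simp: less_imp_le)
            ultimately show ?thesis
              unfolding expand_x(3)[symmetric] by (simp flip: ennreal_mult)
          qed
          ultimately show ?thesis using c by (simp add: F_def G_def expand_x(1))
        qed
      qed
      finally show ?thesis .
    qed (simp add: F_def G_def)
  qed
  also have "\<dots> = (\<integral>\<^sup>+x. \<integral>\<^sup>+c. G c x \<partial>lborel \<partial>?L)"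
    by (rule P.Fubini'[symmetric]) measurable
  finally show ?thesis unfolding G_def .
qed

section \<open>The Steiner polynomial\<close>

lemma lp_sum_scale: "0 \<le> c \<Longrightarrow> lp_sum q n (\<lambda>i. c * x i) = c powr q * lp_sum q n x"
  by (simp add: lp_sum_def abs_mult powr_mult sum_distrib_left)

lemma lp_ball_scale_iff:
  assumes "0 < R" "x \<in> {..<n} \<rightarrow>\<^sub>E UNIV"
  shows "(\<lambda>i\<in>{..<n}. R powr (1 / p) * x i) \<in> lp_ball p n R \<longleftrightarrow> x \<in> lp_ball p n 1"
  using assms p by (auto simp: lp_ball_def lp_sum_scale powr_powr)

lemma parallel_body_scale_iff:
  assumes R: "0 < R" and x: "x \<in> {..<n} \<rightarrow>\<^sub>E UNIV" and \<rho>: "0 \<le> \<rho>"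
  shows "(\<lambda>i\<in>{..<n}. R powr (1 / p) * x i) \<in> parallel_body n (lp_ball p n R) \<rho> \<longleftrightarrow>
    x \<in> parallel_body n (lp_ball p n 1) (\<rho> / R powr (1 / p))"
proof -
  define c where "c = R powr (1 / p)"
  have c: "c > 0" using R by (simp add: c_def)
  have bij: "z \<in> lp_ball p n R \<longleftrightarrow> (\<exists>w\<in>lp_ball p n 1. z = (\<lambda>i\<in>{..<n}. c * w i))" for z
  proof
    assume z: "z \<in> lp_ball p n R"
    define w where "w = (\<lambda>i\<in>{..<n}. z i / c)"
    have zw: "z = (\<lambda>i\<in>{..<n}. c * w i)"
      using z c by (auto simp: w_def lp_ball_def fun_eq_iff PiE_def extensional_def)
    moreover have "w \<in> lp_ball p n 1"
    proof -
      have "w \<in> {..<n} \<rightarrow>\<^sub>E UNIV" by (simp add: w_def)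
      from lp_ball_scale_iff[OF R this] have "(\<lambda>i\<in>{..<n}. c * w i) \<in> lp_ball p n R \<longleftrightarrow> w \<in> lp_ball p n 1"
        by (simp only: c_def)
      then show ?thesis using z unfolding zw[symmetric] by simp
    qed
    ultimately show "\<exists>w\<in>lp_ball p n 1. z = (\<lambda>i\<in>{..<n}. c * w i)" by blast
  next
    assume "\<exists>w\<in>lp_ball p n 1. z = (\<lambda>i\<in>{..<n}. c * w i)"
    then show "z \<in> lp_ball p n R"
      using lp_ball_scale_iff[OF R, of _ n] lp_ball_subset[of p n 1] by (auto simp: c_def)
  qed
  have sum: "(\<Sum>i<n. ((\<lambda>i\<in>{..<n}. c * x i) i - (\<lambda>i\<in>{..<n}. c * w i) i)\<^sup>2) = c\<^sup>2 * (\<Sum>i<n. (x i - w i)\<^sup>2)" for w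
    by (simp add: sum_distrib_left power_mult_distrib flip: right_diff_distrib)
  have "(\<lambda>i\<in>{..<n}. c * x i) \<in> parallel_body n (lp_ball p n R) \<rho> \<longleftrightarrow>
      (\<exists>w\<in>lp_ball p n 1. c\<^sup>2 * (\<Sum>i<n. (x i - w i)\<^sup>2) \<le> \<rho>\<^sup>2)"
  proof -
    have yE: "(\<lambda>i\<in>{..<n}. c * x i) \<in> {..<n} \<rightarrow>\<^sub>E UNIV" by simp
    show ?thesis
      unfolding mem_parallel_body_iff[OF yE lp_ball_subset \<rho>] Bex_def bij sum[symmetric] by blast
  qed
  also have "\<dots> \<longleftrightarrow> x \<in> parallel_body n (lp_ball p n 1) (\<rho> / c)"
  proof -
    have \<rho>c: "0 \<le> \<rho> / c" using c \<rho> by simp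
    show ?thesis
      unfolding mem_parallel_body_iff[OF x lp_ball_subset \<rho>c]
      using c by (simp add: power_divide pos_le_divide_eq mult.commute)
  qed
  finally show ?thesis unfolding c_def .
qed

lemma parallel_body_sets [measurable]:
  assumes "0 < R" "0 \<le> \<rho>"
  shows "parallel_body n (lp_ball p n R) \<rho> \<in> sets (lborel_n n)"
proof -
  have "Measurable.pred (lborel_n n) (\<lambda>y. 0 < R \<and> y \<in> parallel_body n (lp_ball p n R) \<rho>)"
    using assms by (intro measurable_parallel_body) auto
  then have "{y \<in> space (lborel_n n). 0 < R \<and> y \<in> parallel_body n (lp_ball p n R) \<rho>} \<in> sets (lborel_n n)"
    by measurable
  also have "{y \<in> space (lborel_n n). 0 < R \<and> y \<in> parallel_body n (lp_ball p n R) \<rho>} = parallel_body n (lp_ball p n R) \<rho>"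
    using assms(1) subsetD[OF parallel_body_subset] unfolding space_lborel_n by blast
  finally show ?thesis .
qed

lemma emeasure_shell_scale:
  assumes R: "0 < R" and "0 \<le> \<rho>"
  shows "emeasure (lborel_n n) (parallel_body n (lp_ball p n R) \<rho> - lp_ball p n R) =
    ennreal (R powr (n / p)) * shell p n (\<rho> / R powr (1 / p))"
proof -
  have "{x \<in> space (lborel_n n). (\<lambda>i\<in>{..<n}. R powr (1 / p) * x i) \<in> parallel_body n (lp_ball p n R) \<rho> - lp_ball p n R} =
    {x \<in> space (lborel_n n). x \<in> parallel_body n (lp_ball p n 1) (\<rho> / R powr (1 / p)) - lp_ball p n 1}"
    unfolding Diff_iff space_lborel_n
    using parallel_body_scale_iff[OF R _ assms(2), of _ n] lp_ball_scale_iff[OF R, of _ n] by blast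
  also have "\<dots> = parallel_body n (lp_ball p n 1) (\<rho> / R powr (1 / p)) - lp_ball p n 1"
    using subsetD[OF parallel_body_subset] unfolding space_lborel_n by blast
  finally show ?thesis
    using R assms(2)
    by (subst emeasure_lborel_n_scale[of "R powr (1 / p)"])
       (auto simp: shell_def powr_powr simp flip: powr_realpow intro!: sets.Diff parallel_body_sets)
qed

lemma parallel_body_emeasure_finite:
  assumes "0 \<le> t"
  shows "emeasure (lborel_n n) (parallel_body n (lp_ball p n 1) t) < \<infinity>"
proof -
  have "parallel_body n (lp_ball p n 1) t \<subseteq> {..<n} \<rightarrow>\<^sub>E {- (1 + t)..1 + t}"
  proof
    fix y assume "y \<in> parallel_body n (lp_ball p n 1) t"
    then obtain x u where x: "x \<in> lp_ball p n 1" and u: "u \<in> euclidean_ball n"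
      and y: "y = (\<lambda>i\<in>{..<n}. x i + t * u i)"
      unfolding parallel_body_def by auto
    have "\<bar>x i + t * u i\<bar> \<le> 1 + t" if i: "i < n" for i
    proof -
      have "\<bar>x i\<bar> powr p \<le> lp_sum p n x"
        unfolding lp_sum_def using i by (intro member_le_sum) auto
      also have "\<dots> \<le> 1" using x by (simp add: lp_ball_def)
      finally have "\<bar>x i\<bar> \<le> 1"
        using p powr_mono2[of "1 / p" "\<bar>x i\<bar> powr p" 1] by (simp add: powr_powr)
      moreover have "(u i)\<^sup>2 \<le> (\<Sum>i<n. (u i)\<^sup>2)" using i by (intro member_le_sum) auto
      then have "\<bar>u i\<bar> \<le> 1"
        using u by (simp add: euclidean_ball_def abs_square_le_1[symmetric])
      then have "\<bar>t * u i\<bar> \<le> t" using assms by (simp add: abs_mult mult_left_le)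
      ultimately show ?thesis by linarith
    qed
    then show "y \<in> {..<n} \<rightarrow>\<^sub>E {- (1 + t)..1 + t}"
      by (auto simp: y abs_le_iff) (smt (verit))
  qed
  moreover have "({..<n} \<rightarrow>\<^sub>E {- (1 + t)..1 + t}) \<in> sets (lborel_n n)"
    unfolding lborel_n_def by (intro sets_PiM_I_finite) auto
  ultimately show ?thesis
    using emeasure_mono emeasure_lborel_n_box_finite by (metis infinity_ennreal_def le_less_trans)
qed

lemma shell_finite: "0 \<le> t \<Longrightarrow> shell p n t < \<infinity>"
  unfolding shell_def
  using parallel_body_emeasure_finite[of t n] parallel_body_sets[of 1 t n]
  by (meson Diff_subset emeasure_mono le_less_trans zero_less_one)

lemma weight_coeff_nonneg: "0 \<le> weight_coeff p n m x"
  using p unfolding weight_coeff_def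
  by (intro mult_nonneg_nonneg sum_nonneg prod_nonneg) auto

lemma measurable_weight_coeff [measurable]: "weight_coeff p n m \<in> borel_measurable (lborel_n n)"
proof -
  have 1: "(\<lambda>x. \<bar>x k\<bar> powr q) \<in> borel_measurable (lborel_n n)" if "k < n" for k q
    using measurable_lborel_n_coordinate[OF that] by measurable
  have [measurable]: "(\<lambda>x. \<Sum>i<n. \<bar>x i\<bar> powr (2 * p - 2) *
      (\<Sum>S\<in>{S \<in> Pow ({..<n} - {i}). card S = m}. \<Prod>k\<in>S. (p - 1) * \<bar>x k\<bar> powr (p - 2))) \<in> borel_measurable (lborel_n n)"
    using 1 by (intro borel_measurable_sum borel_measurable_times borel_measurable_prod borel_measurable_const) auto
  show ?thesis unfolding weight_coeff_def by measurable
qed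

lemma weight_expand: "weight p n c x = (\<Sum>m<n. c ^ m * weight_coeff p n m x)"
proof -
  have "(\<Prod>k\<in>{..<n} - {i}. expand' p c (x k)) =
      (\<Sum>m<n. c ^ m * (\<Sum>S\<in>{S \<in> Pow ({..<n} - {i}). card S = m}. \<Prod>k\<in>S. (p - 1) * \<bar>x k\<bar> powr (p - 2)))"
    if "i < n" for i
    unfolding expand'_def mult.assoc using that by (intro prod_one_plus_expand) auto
  then have "weight p n c x = exp (- lp_sum p n x) * p * (\<Sum>i<n. \<bar>x i\<bar> powr (2 * p - 2) *
      (\<Sum>m<n. c ^ m * (\<Sum>S\<in>{S \<in> Pow ({..<n} - {i}). card S = m}. \<Prod>k\<in>S. (p - 1) * \<bar>x k\<bar> powr (p - 2))))"
    unfolding weight_def by (intro arg_cong[of _ _ "\<lambda>t. exp (- lp_sum p n x) * p * t"] sum.cong refl) simp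
  moreover have "K * (\<Sum>i<n. a i * (\<Sum>m<n. c ^ m * e i m)) = (\<Sum>m<n. c ^ m * (K * (\<Sum>i<n. a i * e i m)))"
    for K :: real and a e
    unfolding sum_distrib_left by (subst sum.swap) (simp only: mult_ac)
  ultimately show ?thesis unfolding weight_coeff_def by simp
qed

lemma weight_coeff_eq_0: "lp_sum q n x = 0 \<Longrightarrow> weight_coeff p n m x = 0"
  using lp_sum_pos_iff[of q n x] by (simp add: weight_coeff_def)

lemma nn_integral_weight:
  assumes a: "0 \<le> a"
  shows "(\<integral>\<^sup>+c. (if 0 < c \<and> c\<^sup>2 * lp_sum (2 * p - 2) n x \<le> a\<^sup>2 then ennreal (weight p n c x) else 0) \<partial>lborel) =
    (\<Sum>m<n. ennreal (weight_coeff p n m x * (a / sqrt (lp_sum (2 * p - 2) n x)) ^ (m + 1) / (m + 1)))"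
proof (cases "lp_sum (2 * p - 2) n x = 0")
  \<comment> \<open>At the origin c is unconstrained, but the weight vanishes for all c, and so do
    the coefficients on the right that multiply the division by 0.\<close>
  case True
  then show ?thesis by (simp add: weight_expand weight_coeff_eq_0 cong: if_cong)
next
  case False
  define V where "V = lp_sum (2 * p - 2) n x"
  have V: "V > 0" using False lp_sum_nonneg[of "2 * p - 2" n x] unfolding V_def by linarith
  define b where "b = a / sqrt V"
  have b: "0 \<le> b" using a V by (simp add: b_def)
  have iff: "c\<^sup>2 * V \<le> a\<^sup>2 \<longleftrightarrow> c \<le> b" if "0 < c" for c
  proof -
    have "c \<le> b \<longleftrightarrow> c * sqrt V \<le> a" using V by (simp add: b_def pos_le_divide_eq)
    also have "\<dots> \<longleftrightarrow> (c * sqrt V)\<^sup>2 \<le> a\<^sup>2" using that V a by (intro power2_le_iff_abs_le[symmetric, THEN trans[OF _ refl]] | simp add: abs_le_square_iff[symmetric] abs_mult)+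
    finally show ?thesis using V by (simp add: power_mult_distrib)
  qed
  have "(\<integral>\<^sup>+c. (if 0 < c \<and> c\<^sup>2 * V \<le> a\<^sup>2 then ennreal (weight p n c x) else 0) \<partial>lborel) =
    (\<integral>\<^sup>+c. (\<Sum>m<n. ennreal (weight_coeff p n m x) * (ennreal (c ^ m) * indicator {0<..b} c)) \<partial>lborel)"
    (is "nn_integral _ ?f = nn_integral _ ?g")
  proof (rule nn_integral_cong)
    fix c :: real
    show "?f c = ?g c"
    proof (cases "0 < c \<and> c \<le> b")
      case True
      then have "ennreal (weight p n c x) = (\<Sum>m<n. ennreal (c ^ m * weight_coeff p n m x))"
        unfolding weight_expand by (subst sum_ennreal) (auto intro!: mult_nonneg_nonneg weight_coeff_nonneg)
      then show ?thesis using True iff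
        by (simp add: indicator_def ennreal_mult weight_coeff_nonneg mult.commute)
    qed (use iff in \<open>auto simp: indicator_def\<close>)
  qed
  also have "\<dots> = (\<Sum>m<n. \<integral>\<^sup>+c. ennreal (weight_coeff p n m x) * (ennreal (c ^ m) * indicator {0<..b} c) \<partial>lborel)"
    by (intro nn_integral_sum) measurable
  also have "\<dots> = (\<Sum>m<n. ennreal (weight_coeff p n m x) * ennreal (b ^ (m + 1) / (m + 1)))"
    by (intro sum.cong refl) (simp add: nn_integral_cmult nn_integral_power_Ioc[OF b])
  also have "\<dots> = (\<Sum>m<n. ennreal (weight_coeff p n m x * b ^ (m + 1) / (m + 1)))"
    using b by (intro sum.cong refl) (simp add: weight_coeff_nonneg flip: ennreal_mult)
  finally show ?thesis unfolding V_def b_def .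
qed

text \<open>With \<open>\<rho> R = t R powr (1 / p)\<close> all shells are homothetic, so the average is a multiple of \<open>shell p n t\<close>.\<close>

lemma shell_poly_ennreal:
  "\<exists>A::nat \<Rightarrow> ennreal. \<forall>t\<ge>0. ennreal (Gamma (n / p + 1)) * shell p n t = (\<Sum>m<n. A m * ennreal (t ^ (m + 1)))"
proof (intro exI allI impI)
  define D where "D m x = ennreal (weight_coeff p n m x * (lp_sum p n x powr (1 / p) / sqrt (lp_sum (2 * p - 2) n x)) ^ (m + 1) / (m + 1))" for m x
  have [measurable]: "D m \<in> borel_measurable (lborel_n n)" for m unfolding D_def by measurable
  fix t :: real assume t: "0 \<le> t"
  define \<rho> where "\<rho> R = t * R powr (1 / p)" for R
  have \<rho>: "0 \<le> \<rho> R" for R using t by (simp add: \<rho>_def)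
  have [measurable]: "\<rho> \<in> borel_measurable borel" unfolding \<rho>_def by measurable
  have "ennreal (Gamma (n / p + 1)) * shell p n t = (\<integral>\<^sup>+R\<in>{0<..}. ennreal (R powr (n / p) * exp (- R)) \<partial>lborel) * shell p n t"
    using p by (subst nn_integral_powr_exp_minus) (auto intro: less_le_trans[of _ 0])
  also have "\<dots> = (\<integral>\<^sup>+R. ennreal (R powr (n / p) * exp (- R)) * indicator {0<..} R * shell p n t \<partial>lborel)"
    by (rule nn_integral_multc[symmetric]) measurable
  also have "\<dots> = (\<integral>\<^sup>+R\<in>{0<..}. ennreal (exp (- R)) * emeasure (lborel_n n) (parallel_body n (lp_ball p n R) (\<rho> R) - lp_ball p n R) \<partial>lborel)"
  proof (rule nn_integral_cong)
    fix R :: real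
    have "emeasure (lborel_n n) (parallel_body n (lp_ball p n R) (\<rho> R) - lp_ball p n R) =
        ennreal (R powr (n / p)) * shell p n t" if "0 < R"
      using emeasure_shell_scale[OF that \<rho>[of R], of n] that by (simp add: \<rho>_def)
    then show "ennreal (R powr (n / p) * exp (- R)) * indicator {0<..} R * shell p n t =
      ennreal (exp (- R)) * emeasure (lborel_n n) (parallel_body n (lp_ball p n R) (\<rho> R) - lp_ball p n R) * indicator {0<..} R"
      by (auto simp: indicator_def ennreal_mult mult_ac)
  qed
  also have "\<dots> = (\<integral>\<^sup>+x. \<integral>\<^sup>+c. (if 0 < c \<and> c\<^sup>2 * lp_sum (2 * p - 2) n x \<le> (\<rho> (lp_sum p n x))\<^sup>2
       then ennreal (weight p n c x) else 0) \<partial>lborel \<partial>lborel_n n)"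
    by (intro nn_integral_shells \<rho>) measurable
  also have "\<dots> = (\<integral>\<^sup>+x. (\<Sum>m<n. D m x * ennreal (t ^ (m + 1))) \<partial>lborel_n n)"
    (is "nn_integral _ ?f = nn_integral _ ?g")
  proof (rule nn_integral_cong)
    fix x
    show "?f x = ?g x"
      unfolding nn_integral_weight[OF \<rho>] D_def
      using t by (intro sum.cong refl)
        (simp add: \<rho>_def power_mult_distrib power_divide weight_coeff_nonneg mult_ac flip: ennreal_mult del: power_Suc)
  qed
  also have "\<dots> = (\<Sum>m<n. (\<integral>\<^sup>+x. D m x \<partial>lborel_n n) * ennreal (t ^ (m + 1)))"
    by (simp add: nn_integral_sum nn_integral_multc)
  finally show "ennreal (Gamma (n / p + 1)) * shell p n t = (\<Sum>m<n. (\<integral>\<^sup>+x. D m x \<partial>lborel_n n) * ennreal (t ^ (m + 1)))" .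
qed

text \<open>Only the polynomial form is extracted here; the coefficients become explicit through
  \<open>shell_coefficients\<close>. They are finite because the shell of width 1 has finite volume
  and is their sum up to a positive factor.\<close>

lemma shell_poly:
  obtains q :: "nat \<Rightarrow> real" where "\<And>m. 0 \<le> q m"
    and "\<And>t. 0 \<le> t \<Longrightarrow> shell p n t = (\<Sum>m<n. ennreal (q m * t ^ (m + 1)))"
proof -
  obtain A where A: "\<And>t. 0 \<le> t \<Longrightarrow> ennreal (Gamma (n / p + 1)) * shell p n t = (\<Sum>m<n. A m * ennreal (t ^ (m + 1)))"
    using shell_poly_ennreal by blast
  define g where "g = Gamma (n / p + 1)"
  have g: "g > 0" using p by (auto simp: g_def intro!: Gamma_real_pos add_nonneg_pos)
  have fin: "A m < \<infinity>" if "m < n" for m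
  proof -
    have "A m \<le> (\<Sum>m<n. A m)" using that by (intro member_le_sum) auto
    also have "\<dots> = ennreal g * shell p n 1" using A[of 1] by (simp add: g_def)
    also have "\<dots> < \<infinity>" using shell_finite[of 1 n] by (simp add: ennreal_mult_less_top)
    finally show ?thesis .
  qed
  show thesis
  proof (rule that[of "\<lambda>m. enn2real (A m) / g"])
    show "0 \<le> enn2real (A m) / g" for m using g by simp
    fix t :: real assume t: "0 \<le> t"
    have "shell p n t = ennreal (1 / g) * (ennreal g * shell p n t)"
      using g by (simp add: mult.assoc[symmetric] flip: ennreal_mult)
    also have "\<dots> = (\<Sum>m<n. ennreal (1 / g) * (A m * ennreal (t ^ (m + 1))))"
      using A[OF t] by (simp add: g_def sum_distrib_left)
    also have "\<dots> = (\<Sum>m<n. ennreal (enn2real (A m) / g * t ^ (m + 1)))"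
    proof (intro sum.cong refl)
      fix m assume "m \<in> {..<n}"
      then obtain r where r: "A m = ennreal r" "0 \<le> r" using fin[of m] by (cases "A m") auto
      then show "ennreal (1 / g) * (A m * ennreal (t ^ (m + 1))) = ennreal (enn2real (A m) / g * t ^ (m + 1))"
        using g t by (simp flip: ennreal_mult)
    qed
    finally show "shell p n t = (\<Sum>m<n. ennreal (enn2real (A m) / g * t ^ (m + 1)))" .
  qed
qed

section \<open>The coefficients of the Steiner polynomial\<close>

lemma measurable_kern [measurable]: "kern p \<theta> \<in> borel_measurable borel"
  unfolding kern_def by measurable

lemma measurable_moment [measurable]: "moment p q \<in> borel_measurable borel"
  unfolding moment_def kern_def by measurable

lemma nn_integral_expand'_exp:
  assumes c: "0 \<le> c"
  shows "(\<integral>\<^sup>+u. ennreal (expand' p c u * kern p \<theta> u) \<partial>lborel) =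
    moment p 0 \<theta> + ennreal (c * (p - 1)) * moment p (p - 2) \<theta>"
proof -
  have "(\<integral>\<^sup>+u. ennreal (expand' p c u * kern p \<theta> u) \<partial>lborel) =
    (\<integral>\<^sup>+u. ennreal (\<bar>u\<bar> powr 0 * kern p \<theta> u) + ennreal (c * (p - 1)) * ennreal (\<bar>u\<bar> powr (p - 2) * kern p \<theta> u) \<partial>lborel)"
  proof (rule nn_integral_cong_AE, use AE_lborel_singleton[of 0] in eventually_elim)
    fix u :: real assume "u \<noteq> 0"
    then have "expand' p c u * kern p \<theta> u = \<bar>u\<bar> powr 0 * kern p \<theta> u + (c * (p - 1)) * (\<bar>u\<bar> powr (p - 2) * kern p \<theta> u)"
      by (simp add: expand'_def algebra_simps)
    then show "ennreal (expand' p c u * kern p \<theta> u) = ennreal (\<bar>u\<bar> powr 0 * kern p \<theta> u) + ennreal (c * (p - 1)) * ennreal (\<bar>u\<bar> powr (p - 2) * kern p \<theta> u)"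
      using c p by (simp add: kern_def flip: ennreal_mult ennreal_plus)
  qed
  also have "\<dots> = (\<integral>\<^sup>+u. ennreal (\<bar>u\<bar> powr 0 * kern p \<theta> u) \<partial>lborel) + ennreal (c * (p - 1)) * (\<integral>\<^sup>+u. ennreal (\<bar>u\<bar> powr (p - 2) * kern p \<theta> u) \<partial>lborel)"
    by (subst nn_integral_add) (auto simp: nn_integral_cmult)
  finally show ?thesis by (simp add: moment_def)
qed

text \<open>Each summand of \<open>weight\<close> is a product over the coordinates, and so are both
  exponentials. In the summand i the coordinate i gives the moment of order 2 p - 2 and the others
  give equal factors; by symmetry the n summands agree.\<close>

lemma nn_integral_weight_exp:
  assumes c: "0 \<le> c"
  shows "(\<integral>\<^sup>+x. ennreal (weight p n c x * exp (- (\<theta> * lp_sum (2 * p - 2) n x))) \<partial>lborel_n n) =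
    ennreal (p * n) * (moment p (2 * p - 2) \<theta> * (moment p 0 \<theta> + ennreal (c * (p - 1)) * moment p (p - 2) \<theta>) ^ (n - 1))"
    (is "_ = _ * ?r")
proof -
  have E: "0 \<le> kern p \<theta> u" for u by (simp add: kern_def)
  define f where "f i k u = ennreal ((if k = i then \<bar>u\<bar> powr (2 * p - 2) else expand' p c u) * kern p \<theta> u)" for i k :: nat and u
  have [measurable]: "f i k \<in> borel_measurable borel" for i k
    unfolding f_def by (cases "k = i") simp_all
  have exp_pos: "0 \<le> expand' p c u" for u by (rule less_imp_le[OF expand'_pos[OF c]])
  have "ennreal (weight p n c x * exp (- (\<theta> * lp_sum (2 * p - 2) n x))) = (\<Sum>i<n. ennreal p * (\<Prod>k<n. f i k (x k)))" for x
  proof -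
    have eq: "exp (- lp_sum p n x) * exp (- (\<theta> * lp_sum (2 * p - 2) n x)) = (\<Prod>k<n. kern p \<theta> (x k))"
      by (simp add: kern_def lp_sum_def exp_sum[symmetric] sum_subtractf sum_negf sum_distrib_left flip: exp_add)
    have "weight p n c x * exp (- (\<theta> * lp_sum (2 * p - 2) n x)) =
      p * (\<Sum>i<n. \<bar>x i\<bar> powr (2 * p - 2) * (\<Prod>k\<in>{..<n} - {i}. expand' p c (x k))) * (\<Prod>k<n. kern p \<theta> (x k))"
      unfolding weight_def eq[symmetric] by (simp only: mult_ac)
    also have "\<dots> = (\<Sum>i<n. p * (\<Prod>k<n. (if k = i then \<bar>x k\<bar> powr (2 * p - 2) else expand' p c (x k)) * kern p \<theta> (x k)))"
      unfolding sum_distrib_left sum_distrib_right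
    proof (intro sum.cong refl)
      fix i assume i: "i \<in> {..<n}"
      have "(\<Prod>k<n. (if k = i then \<bar>x k\<bar> powr (2 * p - 2) else expand' p c (x k))) =
        \<bar>x i\<bar> powr (2 * p - 2) * (\<Prod>k\<in>{..<n} - {i}. expand' p c (x k))"
        using i by (subst prod.remove[of _ i]) auto
      then show "p * (\<bar>x i\<bar> powr (2 * p - 2) * (\<Prod>k\<in>{..<n} - {i}. expand' p c (x k))) * (\<Prod>k<n. kern p \<theta> (x k)) =
        p * (\<Prod>k<n. (if k = i then \<bar>x k\<bar> powr (2 * p - 2) else expand' p c (x k)) * kern p \<theta> (x k))"
        by (simp only: prod.distrib mult.assoc)
    qed
    also have "ennreal \<dots> = (\<Sum>i<n. ennreal p * (\<Prod>k<n. f i k (x k)))"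
    proof -
      define g where "g i k = (if k = i then \<bar>x k\<bar> powr (2 * p - 2) else expand' p c (x k)) * kern p \<theta> (x k)" for i k
      have g: "0 \<le> g i k" for i k using E exp_pos by (simp add: g_def)
      have "ennreal (\<Sum>i<n. p * (\<Prod>k<n. g i k)) = (\<Sum>i<n. ennreal p * (\<Prod>k<n. ennreal (g i k)))"
        using p g by (subst sum_ennreal[symmetric]) (simp_all add: ennreal_mult prod_ennreal prod_nonneg)
      then show ?thesis by (simp only: g_def f_def)
    qed
    finally show ?thesis .
  qed
  then have "(\<integral>\<^sup>+x. ennreal (weight p n c x * exp (- (\<theta> * lp_sum (2 * p - 2) n x))) \<partial>lborel_n n) =
    (\<integral>\<^sup>+x. (\<Sum>i<n. ennreal p * (\<Prod>k<n. f i k (x k))) \<partial>lborel_n n)" by simp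
  also have "\<dots> = (\<Sum>i<n. ennreal p * (\<Prod>k<n. \<integral>\<^sup>+u. f i k u \<partial>lborel))"
  proof -
    have [measurable]: "(\<lambda>x. \<Prod>k<n. f i k (x k)) \<in> borel_measurable (lborel_n n)" for i
    proof (rule borel_measurable_prod_ennreal)
      fix k assume "k \<in> {..<n}"
      then show "(\<lambda>x. f i k (x k)) \<in> borel_measurable (lborel_n n)"
        by (intro measurable_compose[OF measurable_lborel_n_coordinate[of k n], of "f i k"]) auto
    qed
    show ?thesis
      by (subst nn_integral_sum) (auto simp: nn_integral_cmult nn_integral_lborel_n_prod)
  qed
  also have "\<dots> = (\<Sum>i<n. ennreal p * (?r))"
  proof (intro sum.cong refl arg_cong[of _ _ "\<lambda>t. ennreal p * t"])
    fix i assume i: "i \<in> {..<n}"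
    have 1: "(\<integral>\<^sup>+u. f i i u \<partial>lborel) = moment p (2 * p - 2) \<theta>" by (simp add: f_def moment_def)
    have 2: "(\<integral>\<^sup>+u. f i k u \<partial>lborel) = moment p 0 \<theta> + ennreal (c * (p - 1)) * moment p (p - 2) \<theta>" if "k \<noteq> i" for k
      using nn_integral_expand'_exp[OF c, of \<theta>] that by (simp add: f_def)
    show "(\<Prod>k<n. \<integral>\<^sup>+u. f i k u \<partial>lborel) = ?r"
      using i by (subst prod.remove[of _ i]) (auto simp: 1 2)
  qed
  also have "\<dots> = ennreal (p * n) * (?r)"
    using p by (simp add: ennreal_mult ennreal_of_nat_eq_real_of_nat mult_ac)
  finally show ?thesis .
qed

text \<open>The substitution c = z sqrt \<theta> removes z from the moments, and the binomial
  theorem separates its powers: c ^ m dc becomes z ^ (m + 1) \<theta> powr ((m - 1) / 2) d\<theta> /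
  2.\<close>

lemma nn_integral_cone:
  assumes z: "0 < z" and n: "0 < n"
  shows "(\<integral>\<^sup>+c\<in>{0<..}. moment p (2 * p - 2) (c\<^sup>2 / z\<^sup>2) *
      (moment p 0 (c\<^sup>2 / z\<^sup>2) + ennreal (c * (p - 1)) * moment p (p - 2) (c\<^sup>2 / z\<^sup>2)) ^ (n - 1) \<partial>lborel) =
    (\<Sum>m<n. ennreal ((n - 1) choose m) * ennreal ((p - 1) ^ m / 2) * H_int p n m * ennreal (z ^ (m + 1)))"
proof -
  let ?M = "moment p (2 * p - 2)" and ?J = "moment p (p - 2)" and ?I = "moment p 0"
  have "(\<integral>\<^sup>+c\<in>{0<..}. ?M (c\<^sup>2 / z\<^sup>2) * (?I (c\<^sup>2 / z\<^sup>2) + ennreal (c * (p - 1)) * ?J (c\<^sup>2 / z\<^sup>2)) ^ (n - 1) \<partial>lborel) =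
    (\<integral>\<^sup>+\<theta>\<in>{0<..}. ?M ((z * sqrt \<theta>)\<^sup>2 / z\<^sup>2) * (?I ((z * sqrt \<theta>)\<^sup>2 / z\<^sup>2) + ennreal (z * sqrt \<theta> * (p - 1)) * ?J ((z * sqrt \<theta>)\<^sup>2 / z\<^sup>2)) ^ (n - 1) *
       ennreal (z * (inverse (sqrt \<theta>) / 2)) \<partial>lborel)"
  proof (rule nn_integral_subst_halfline)
    show "((\<lambda>\<theta>. z * sqrt \<theta>) has_real_derivative z * (inverse (sqrt \<theta>) / 2)) (at \<theta>)" if "\<theta> > 0" for \<theta>
      using DERIV_cmult[OF DERIV_real_sqrt[OF that], of z] by simp
    show "continuous_on {0<..} (\<lambda>\<theta>. z * (inverse (sqrt \<theta>) / 2))" by (intro continuous_intros) auto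
    show "(\<lambda>\<theta>. z * sqrt \<theta>) ` {0<..} = {0<..}"
    proof (intro equalityI subsetI)
      fix c :: real assume "c \<in> {0<..}"
      then show "c \<in> (\<lambda>\<theta>. z * sqrt \<theta>) ` {0<..}"
        using z by (intro image_eqI[of _ _ "(c / z)\<^sup>2"]) auto
    qed (use z in auto)
  qed (use z in auto)
  also have "\<dots> = (\<integral>\<^sup>+\<theta>. (\<Sum>m<n. ennreal ((n - 1) choose m) * ennreal ((p - 1) ^ m / 2) * ennreal (z ^ (m + 1)) *
      (ennreal (\<theta> powr ((real m - 1) / 2)) * ?M \<theta> * ?J \<theta> ^ m * ?I \<theta> ^ (n - 1 - m) * indicator {0<..} \<theta>)) \<partial>lborel)"
  proof (rule nn_integral_cong)
    fix \<theta> :: real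
    show "?M ((z * sqrt \<theta>)\<^sup>2 / z\<^sup>2) * (?I ((z * sqrt \<theta>)\<^sup>2 / z\<^sup>2) + ennreal (z * sqrt \<theta> * (p - 1)) * ?J ((z * sqrt \<theta>)\<^sup>2 / z\<^sup>2)) ^ (n - 1) *
       ennreal (z * (inverse (sqrt \<theta>) / 2)) * indicator {0<..} \<theta> =
      (\<Sum>m<n. ennreal ((n - 1) choose m) * ennreal ((p - 1) ^ m / 2) * ennreal (z ^ (m + 1)) *
      (ennreal (\<theta> powr ((real m - 1) / 2)) * ?M \<theta> * ?J \<theta> ^ m * ?I \<theta> ^ (n - 1 - m) * indicator {0<..} \<theta>))"
    proof (cases "0 < \<theta>")
      case \<theta>: True
      define b where "b = ennreal (z * sqrt \<theta> * (p - 1))"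
      have arg: "(z * sqrt \<theta>)\<^sup>2 / z\<^sup>2 = \<theta>" using z \<theta> by (simp add: power_mult_distrib)
      have binom: "(?I \<theta> + b * ?J \<theta>) ^ (n - 1) = (\<Sum>m<n. of_nat ((n - 1) choose m) * (b * ?J \<theta>) ^ m * ?I \<theta> ^ (n - 1 - m))"
        using n by (subst add.commute, subst binomial_ring) (simp add: lessThan_Suc_atMost[symmetric])
      have coeff: "b ^ m * ennreal (z * (inverse (sqrt \<theta>) / 2)) =
          ennreal ((p - 1) ^ m / 2) * ennreal (z ^ (m + 1)) * ennreal (\<theta> powr ((real m - 1) / 2))" for m
      proof -
        have "sqrt \<theta> ^ m * inverse (sqrt \<theta>) = \<theta> powr ((real m - 1) / 2)"
        proof -
          have "sqrt \<theta> ^ m = \<theta> powr (real m / 2)"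
            using \<theta> by (simp add: powr_half_sqrt[symmetric] powr_power)
          moreover have "inverse (sqrt \<theta>) = \<theta> powr (- (1 / 2))"
            using \<theta> by (simp add: powr_minus powr_half_sqrt)
          ultimately show ?thesis by (simp add: diff_divide_distrib flip: powr_add)
        qed
        then have "(z * sqrt \<theta> * (p - 1)) ^ m * (z * (inverse (sqrt \<theta>) / 2)) =
          (p - 1) ^ m / 2 * z ^ (m + 1) * \<theta> powr ((real m - 1) / 2)"
          by (simp add: power_mult_distrib flip: mult.assoc)
        then show ?thesis using z p \<theta> unfolding b_def
          by (simp add: ennreal_power flip: ennreal_mult del: power_Suc)
      qed
      have "of_nat ((n - 1) choose m) * (b * ?J \<theta>) ^ m * ?I \<theta> ^ (n - 1 - m) * ?M \<theta> * ennreal (z * (inverse (sqrt \<theta>) / 2)) =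
        ennreal ((n - 1) choose m) * ennreal ((p - 1) ^ m / 2) * ennreal (z ^ (m + 1)) *
          (ennreal (\<theta> powr ((real m - 1) / 2)) * ?M \<theta> * ?J \<theta> ^ m * ?I \<theta> ^ (n - 1 - m))" for m
      proof -
        have "of_nat ((n - 1) choose m) * (b * ?J \<theta>) ^ m * ?I \<theta> ^ (n - 1 - m) * ?M \<theta> * ennreal (z * (inverse (sqrt \<theta>) / 2)) =
          of_nat ((n - 1) choose m) * (b ^ m * ennreal (z * (inverse (sqrt \<theta>) / 2))) * (?M \<theta> * ?J \<theta> ^ m * ?I \<theta> ^ (n - 1 - m))"
          by (simp only: power_mult_distrib mult_ac)
        then show ?thesis unfolding coeff ennreal_of_nat_eq_real_of_nat by (simp only: mult_ac)
      qed
      then show ?thesis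
        using \<theta> unfolding arg b_def[symmetric] binom by (simp add: sum_distrib_left sum_distrib_right mult_ac)
    qed simp
  qed
  also have "\<dots> = (\<Sum>m<n. ennreal ((n - 1) choose m) * ennreal ((p - 1) ^ m / 2) * ennreal (z ^ (m + 1)) * H_int p n m)"
    unfolding H_int_def by (subst nn_integral_sum) (auto simp: nn_integral_cmult)
  finally show ?thesis by (simp only: mult_ac)
qed

text \<open>Homogeneity: the coefficient of t ^ (m + 1) scales with the power n - 1 - m of the
  radius \<open>R powr (1 / p)\<close>. Integrated against exp (- R), this power later gives the
  factor Gamma ((n - 1 - m) / p + 1).\<close>

lemma emeasure_shell_poly:
  assumes R: "0 < R" and t: "0 \<le> t" and q: "\<And>m. 0 \<le> q m"
    and shell: "\<And>t. 0 \<le> t \<Longrightarrow> shell p n t = (\<Sum>m<n. ennreal (q m * t ^ (m + 1)))"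
  shows "emeasure (lborel_n n) (parallel_body n (lp_ball p n R) t - lp_ball p n R) =
    (\<Sum>m<n. ennreal (q m * R powr (real (n - 1 - m) / p) * t ^ (m + 1)))"
proof -
  define r where "r = R powr (1 / p)"
  have r: "0 < r" using R by (simp add: r_def)
  have "emeasure (lborel_n n) (parallel_body n (lp_ball p n R) t - lp_ball p n R) =
      (\<Sum>m<n. ennreal (R powr (n / p)) * ennreal (q m * (t / r) ^ (m + 1)))"
    unfolding emeasure_shell_scale[OF R t] r_def[symmetric] using shell[of "t / r"] t r by (simp add: sum_distrib_left)
  also have "\<dots> = (\<Sum>m<n. ennreal (q m * R powr (real (n - 1 - m) / p) * t ^ (m + 1)))"
  proof (intro sum.cong refl)
    fix m assume m: "m \<in> {..<n}"
    have "r ^ (m + 1) = R powr ((m + 1) / p)"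
      unfolding r_def using R by (simp add: powr_power del: power_Suc)
    then have "R powr (real (n - 1 - m) / p) = R powr (n / p) / r ^ (m + 1)"
      using m by (simp add: of_nat_diff diff_divide_distrib flip: powr_diff del: power_Suc)
    then have "R powr (n / p) * (q m * (t / r) ^ (m + 1)) = q m * R powr (real (n - 1 - m) / p) * t ^ (m + 1)"
      unfolding power_divide by (simp only: divide_inverse mult_ac)
    then show "ennreal (R powr (n / p)) * ennreal (q m * (t / r) ^ (m + 1)) = ennreal (q m * R powr (real (n - 1 - m) / p) * t ^ (m + 1))"
      using q t r by (simp flip: ennreal_mult del: power_Suc)
  qed
  finally show ?thesis .
qed

text \<open>
  The shells of constant width \<open>s\<close> are averaged against the density \<open>2 s / z\<^sup>2 * exp (- s\<^sup>2 / z\<^sup>2)\<close>: this replaces the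
  constraint \<open>c \<bar>v(x)\<bar> \<le> s\<close> by the factor \<open>exp (- c\<^sup>2 \<bar>v(x)\<bar>\<^sup>2 / z\<^sup>2)\<close>, and the integral over \<open>x\<close> factorizes.
\<close>

lemma shell_coefficients:
  assumes n: "0 < n" and q: "\<And>m. 0 \<le> q m"
    and shell: "\<And>t. 0 \<le> t \<Longrightarrow> shell p n t = (\<Sum>m<n. ennreal (q m * t ^ (m + 1)))"
    and z: "0 < z"
  shows "(\<Sum>m<n. ennreal (q m * Gamma (real (n - 1 - m) / p + 1) * Gamma ((real m + 1) / 2 + 1) * z ^ (m + 1))) =
    (\<Sum>m<n. ennreal (p * n) * (ennreal ((n - 1) choose m) * ennreal ((p - 1) ^ m / 2) * H_int p n m) * ennreal (z ^ (m + 1)))"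
proof -
  let ?L = "lborel_n n"
  interpret L: sigma_finite_measure ?L by (rule sigma_finite_lborel_n)
  interpret P: pair_sigma_finite lborel ?L by standard
  define V where "V x = lp_sum (2 * p - 2) n x" for x
  have V [simp]: "0 \<le> V x" for x by (simp add: V_def)
  have [measurable]: "(\<lambda>w. V (Y w)) \<in> borel_measurable M" if "Y \<in> M \<rightarrow>\<^sub>M ?L" for M Y
    unfolding V_def using that by measurable
  define W where "W s = ennreal (2 * s / z\<^sup>2 * exp (- (s\<^sup>2 / z\<^sup>2)))" for s
  have [measurable]: "W \<in> borel_measurable borel" unfolding W_def by measurable
  define g where "g m = Gamma (real (n - 1 - m) / p + 1)" for m
  have g: "0 < g m" for m unfolding g_def using p by (intro Gamma_real_pos add_nonneg_pos) auto
  define X where "X s = (\<integral>\<^sup>+R\<in>{0<..}. ennreal (exp (- R)) *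
      emeasure ?L (parallel_body n (lp_ball p n R) s - lp_ball p n R) \<partial>lborel)" for s
  define f where "f s x c = (if 0 < s \<and> 0 < c \<and> c\<^sup>2 * V x \<le> s\<^sup>2 then ennreal (weight p n c x) * W s else 0)" for s x c
  have f_meas [measurable]: "(\<lambda>w. f (S w) (Y w) (C w)) \<in> borel_measurable M"
    if [measurable]: "S \<in> borel_measurable M" "C \<in> borel_measurable M" "Y \<in> M \<rightarrow>\<^sub>M ?L" for M S Y C
    unfolding f_def by measurable
  have X_poly: "X s = (\<Sum>m<n. ennreal (q m * g m) * ennreal (s ^ (m + 1)))" if s: "0 < s" for s
  proof -
    have "X s = (\<integral>\<^sup>+R. (\<Sum>m<n. ennreal (q m * s ^ (m + 1)) * (ennreal (R powr (real (n - 1 - m) / p) * exp (- R)) * indicator {0<..} R)) \<partial>lborel)"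
      unfolding X_def
    proof (rule nn_integral_cong)
      fix R :: real
      show "ennreal (exp (- R)) * emeasure ?L (parallel_body n (lp_ball p n R) s - lp_ball p n R) * indicator {0<..} R =
        (\<Sum>m<n. ennreal (q m * s ^ (m + 1)) * (ennreal (R powr (real (n - 1 - m) / p) * exp (- R)) * indicator {0<..} R))"
      proof (cases "0 < R")
        case True
        then show ?thesis
          using s q by (subst emeasure_shell_poly[OF True less_imp_le[OF s] q shell])
            (simp_all add: sum_distrib_left mult_ac flip: ennreal_mult del: power_Suc sum_ennreal)
      qed simp
    qed
    also have "\<dots> = (\<Sum>m<n. ennreal (q m * s ^ (m + 1)) *
        (\<integral>\<^sup>+R\<in>{0<..}. ennreal (R powr (real (n - 1 - m) / p) * exp (- R)) \<partial>lborel))"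
      by (subst nn_integral_sum) (auto simp: nn_integral_cmult simp del: power_Suc)
    also have "\<dots> = (\<Sum>m<n. ennreal (q m * g m) * ennreal (s ^ (m + 1)))"
    proof (intro sum.cong refl)
      fix m
      have "0 \<le> real (n - 1 - m) / p" using p by simp
      then have "-1 < real (n - 1 - m) / p" by linarith
      then have "(\<integral>\<^sup>+R\<in>{0<..}. ennreal (R powr (real (n - 1 - m) / p) * exp (- R)) \<partial>lborel) = ennreal (g m)"
        unfolding g_def by (rule nn_integral_powr_exp_minus)
      then show "ennreal (q m * s ^ (m + 1)) * (\<integral>\<^sup>+R\<in>{0<..}. ennreal (R powr (real (n - 1 - m) / p) * exp (- R)) \<partial>lborel) =
          ennreal (q m * g m) * ennreal (s ^ (m + 1))"
        using q[of m] g[of m] s by (simp add: mult_ac flip: ennreal_mult del: power_Suc)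
    qed
    finally show ?thesis .
  qed
  have "(\<integral>\<^sup>+s\<in>{0<..}. X s * W s \<partial>lborel) =
    (\<integral>\<^sup>+s. (\<Sum>m<n. ennreal (q m * g m) * (ennreal (s ^ (m + 1)) * W s * indicator {0<..} s)) \<partial>lborel)"
    by (intro nn_integral_cong) (auto simp: indicator_def X_poly sum_distrib_right mult.assoc simp del: power_Suc)
  also have "\<dots> = (\<Sum>m<n. ennreal (q m * g m) * (\<integral>\<^sup>+s\<in>{0<..}. ennreal (s ^ (m + 1)) * W s \<partial>lborel))"
    by (subst nn_integral_sum) (auto simp: nn_integral_cmult simp del: power_Suc)
  also have "\<dots> = (\<Sum>m<n. ennreal (q m * g m * Gamma ((real m + 1) / 2 + 1) * z ^ (m + 1)))"
  proof (intro sum.cong refl)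
    fix m
    have "0 \<le> Gamma ((real m + 1) / 2 + 1)" by (intro less_imp_le Gamma_real_pos) (simp add: add_pos_pos)
    then show "ennreal (q m * g m) * (\<integral>\<^sup>+s\<in>{0<..}. ennreal (s ^ (m + 1)) * W s \<partial>lborel) =
        ennreal (q m * g m * Gamma ((real m + 1) / 2 + 1) * z ^ (m + 1))"
      using q[of m] g[of m] z unfolding W_def nn_integral_Gaussian_moment[OF z]
      by (simp add: mult.assoc flip: ennreal_mult del: power_Suc)
  qed
  finally have lhs: "(\<integral>\<^sup>+s\<in>{0<..}. X s * W s \<partial>lborel) =
    (\<Sum>m<n. ennreal (q m * g m * Gamma ((real m + 1) / 2 + 1) * z ^ (m + 1)))" .
  have "(\<integral>\<^sup>+s\<in>{0<..}. X s * W s \<partial>lborel) = (\<integral>\<^sup>+s. \<integral>\<^sup>+x. \<integral>\<^sup>+c. f s x c \<partial>lborel \<partial>?L \<partial>lborel)"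
    (is "nn_integral _ ?f = nn_integral _ ?g")
  proof (rule nn_integral_cong)
    fix s :: real
    show "?f s = ?g s"
    proof (cases "0 < s")
      case s: True
      define k where "k x c = (if 0 < c \<and> c\<^sup>2 * V x \<le> s\<^sup>2 then ennreal (weight p n c x) else 0)" for x c
      have [measurable]: "(\<lambda>(x, c). k x c) \<in> borel_measurable (?L \<Otimes>\<^sub>M lborel)"
        unfolding k_def by measurable
      have "X s = (\<integral>\<^sup>+x. \<integral>\<^sup>+c. k x c \<partial>lborel \<partial>?L)"
        unfolding X_def k_def V_def using s by (intro nn_integral_shells) auto
      moreover have "f s x c = k x c * W s" for x c using s by (simp add: f_def k_def)
      moreover have "(\<integral>\<^sup>+x. \<integral>\<^sup>+c. k x c \<partial>lborel \<partial>?L) * W s = (\<integral>\<^sup>+x. (\<integral>\<^sup>+c. k x c \<partial>lborel) * W s \<partial>?L)"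
        by (rule nn_integral_multc[symmetric]) measurable
      moreover have "\<dots> = (\<integral>\<^sup>+x. \<integral>\<^sup>+c. k x c * W s \<partial>lborel \<partial>?L)"
        (is "nn_integral _ ?f = nn_integral _ ?g")
      proof (rule nn_integral_cong)
        fix x assume [simp]: "x \<in> space ?L"
        show "?f x = ?g x"
          by (rule nn_integral_multc[symmetric]) measurable
      qed
      ultimately show ?thesis
        using s by simp
    qed (simp add: f_def)
  qed
  \<comment> \<open>The order is changed until s is innermost. Its tail integral yields the
    exponential factor in x, after which the integral over x at fixed c is a product.\<close>
  also have "\<dots> = (\<integral>\<^sup>+x. \<integral>\<^sup>+s. \<integral>\<^sup>+c. f s x c \<partial>lborel \<partial>lborel \<partial>?L)"
    by (rule P.Fubini'[symmetric]) measurable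
  also have "\<dots> = (\<integral>\<^sup>+x. \<integral>\<^sup>+c. \<integral>\<^sup>+s. f s x c \<partial>lborel \<partial>lborel \<partial>?L)"
    by (rule nn_integral_cong, rule lborel_pair.Fubini') measurable
  also have "\<dots> = (\<integral>\<^sup>+c. \<integral>\<^sup>+x. \<integral>\<^sup>+s. f s x c \<partial>lborel \<partial>?L \<partial>lborel)"
    by (rule P.Fubini') measurable
  also have "\<dots> = (\<integral>\<^sup>+c. ennreal (p * n) * (moment p (2 * p - 2) (c\<^sup>2 / z\<^sup>2) *
      (moment p 0 (c\<^sup>2 / z\<^sup>2) + ennreal (c * (p - 1)) * moment p (p - 2) (c\<^sup>2 / z\<^sup>2)) ^ (n - 1) * indicator {0<..} c) \<partial>lborel)"
    (is "nn_integral _ ?f = nn_integral _ ?g")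
  proof (rule nn_integral_cong)
    fix c :: real
    show "?f c = ?g c"
    proof (cases "0 < c")
      case c: True
      have "(\<integral>\<^sup>+s. f s x c \<partial>lborel) = ennreal (weight p n c x * exp (- (c\<^sup>2 / z\<^sup>2 * lp_sum (2 * p - 2) n x)))" for x
      proof -
        define a where "a = c * sqrt (V x)"
        have a: "0 \<le> a" using c by (simp add: a_def)
        have a2: "a\<^sup>2 = c\<^sup>2 * V x" by (simp add: a_def power_mult_distrib)
        have "f s x c = ennreal (weight p n c x) * (W s * indicator {a..} s)" for s
        proof (cases "0 < s")
          case True
          then have "c\<^sup>2 * V x \<le> s\<^sup>2 \<longleftrightarrow> a \<le> s"
            unfolding a2[symmetric] using a by (intro power_mono_iff) auto
          then show ?thesis using True c by (simp add: f_def indicator_def)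
        next
          case False
          then show ?thesis using a by (cases "s = 0") (auto simp: f_def W_def indicator_def)
        qed
        then have "(\<integral>\<^sup>+s. f s x c \<partial>lborel) = ennreal (weight p n c x) * (\<integral>\<^sup>+s\<in>{a..}. W s \<partial>lborel)"
          by (simp add: nn_integral_cmult)
        also have "\<dots> = ennreal (weight p n c x * exp (- (a\<^sup>2 / z\<^sup>2)))"
          unfolding W_def nn_integral_Gaussian_tail[OF z a] using weight_nonneg[of c n x] c
          by (simp flip: ennreal_mult)
        finally show ?thesis by (simp add: a2 V_def)
      qed
      then show ?thesis
        using c nn_integral_weight_exp[of c n "c\<^sup>2 / z\<^sup>2"] by simp
    qed (simp add: f_def)
  qed
  also have "\<dots> = ennreal (p * n) * (\<integral>\<^sup>+c\<in>{0<..}. moment p (2 * p - 2) (c\<^sup>2 / z\<^sup>2) *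
      (moment p 0 (c\<^sup>2 / z\<^sup>2) + ennreal (c * (p - 1)) * moment p (p - 2) (c\<^sup>2 / z\<^sup>2)) ^ (n - 1) \<partial>lborel)"
    by (rule nn_integral_cmult) measurable
  also have "\<dots> = (\<Sum>m<n. ennreal (p * n) * (ennreal ((n - 1) choose m) * ennreal ((p - 1) ^ m / 2) * H_int p n m) * ennreal (z ^ (m + 1)))"
    unfolding nn_integral_cone[OF z n] by (simp add: sum_distrib_left mult.assoc del: power_Suc)
  finally show ?thesis using lhs by (simp add: g_def)
qed

section \<open>Volume and intrinsic volumes of the balls\<close>

lemma emeasure_lp_ball_scale:
  assumes R: "0 < R"
  shows "emeasure (lborel_n n) (lp_ball p n R) = ennreal (R powr (n / p)) * emeasure (lborel_n n) (lp_ball p n 1)"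
proof -
  have "{x \<in> space (lborel_n n). (\<lambda>i\<in>{..<n}. R powr (1 / p) * x i) \<in> lp_ball p n R} = lp_ball p n 1"
    unfolding space_lborel_n using lp_ball_scale_iff[OF R, of _ n] lp_ball_subset[of p n 1] by blast
  then show ?thesis
    using R by (subst emeasure_lborel_n_scale[of "R powr (1 / p)"])
       (auto simp: powr_powr simp flip: powr_realpow)
qed

text \<open>The integral of exp (- N x) over the whole space is computed in two ways: through the
  sublevel sets, which gives the Gamma factor, and coordinate by coordinate.\<close>

lemma emeasure_lp_ball:
  "ennreal (Gamma (n / p + 1)) * emeasure (lborel_n n) (lp_ball p n 1) = moment p 0 0 ^ n"
proof -
  let ?L = "lborel_n n"
  interpret L: sigma_finite_measure ?L by (rule sigma_finite_lborel_n)
  interpret P: pair_sigma_finite lborel ?L by standard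
  have "ennreal (Gamma (n / p + 1)) * emeasure ?L (lp_ball p n 1) =
    (\<integral>\<^sup>+R\<in>{0<..}. ennreal (R powr (n / p) * exp (- R)) \<partial>lborel) * emeasure ?L (lp_ball p n 1)"
    using p by (subst nn_integral_powr_exp_minus) (auto intro: less_le_trans[of _ 0])
  also have "\<dots> = (\<integral>\<^sup>+R. ennreal (R powr (n / p) * exp (- R)) * indicator {0<..} R * emeasure ?L (lp_ball p n 1) \<partial>lborel)"
    by (rule nn_integral_multc[symmetric]) measurable
  also have "\<dots> = (\<integral>\<^sup>+R. \<integral>\<^sup>+x. (if 0 < R \<and> lp_sum p n x \<le> R then ennreal (exp (- R)) else 0) \<partial>?L \<partial>lborel)"
    (is "nn_integral _ ?f = nn_integral _ ?g")
  proof (rule nn_integral_cong)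
    fix R :: real
    show "?f R = ?g R"
    proof (cases "0 < R")
      case R: True
      have "(\<integral>\<^sup>+x. (if 0 < R \<and> lp_sum p n x \<le> R then ennreal (exp (- R)) else 0) \<partial>?L) =
        (\<integral>\<^sup>+x. ennreal (exp (- R)) * indicator (lp_ball p n R) x \<partial>?L)"
        using R by (intro nn_integral_cong) (auto simp: lp_ball_def space_lborel_n indicator_def)
      also have "\<dots> = ennreal (exp (- R)) * emeasure ?L (lp_ball p n R)"
        by (rule nn_integral_cmult_indicator) measurable
      finally show ?thesis
        using R unfolding emeasure_lp_ball_scale[OF R] by (simp add: ennreal_mult mult_ac)
    qed simp
  qed
  also have "\<dots> = (\<integral>\<^sup>+x. \<integral>\<^sup>+R. (if 0 < R \<and> lp_sum p n x \<le> R then ennreal (exp (- R)) else 0) \<partial>lborel \<partial>?L)"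
    by (rule P.Fubini'[symmetric]) measurable
  also have "\<dots> = (\<integral>\<^sup>+x. (\<Prod>i<n. ennreal (exp (- (\<bar>x i\<bar> powr p)))) \<partial>?L)"
  proof (rule nn_integral_cong)
    fix x
    define N where "N = lp_sum p n x"
    have N: "0 \<le> N" by (simp add: N_def)
    have "(\<integral>\<^sup>+R. (if 0 < R \<and> N \<le> R then ennreal (exp (- R)) else 0) \<partial>lborel) =
        (\<integral>\<^sup>+R\<in>{N..}. ennreal (exp (- (1 * R))) \<partial>lborel)"
      using N by (intro nn_integral_cong_AE eventually_mono[OF AE_lborel_singleton[of 0]]) (auto simp: indicator_def)
    also have "\<dots> = ennreal (exp (- N))" by (subst nn_integral_exp_atLeast) auto
    also have "\<dots> = (\<Prod>i<n. ennreal (exp (- (\<bar>x i\<bar> powr p))))"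
      by (simp add: N_def lp_sum_def prod_ennreal exp_sum sum_negf[symmetric])
    finally show "(\<integral>\<^sup>+R. (if 0 < R \<and> lp_sum p n x \<le> R then ennreal (exp (- R)) else 0) \<partial>lborel) =
      (\<Prod>i<n. ennreal (exp (- (\<bar>x i\<bar> powr p))))" by (simp add: N_def)
  qed
  also have "\<dots> = (\<integral>\<^sup>+u. ennreal (exp (- (\<bar>u\<bar> powr p))) \<partial>lborel) ^ n"
    by (subst nn_integral_lborel_n_prod) auto
  also have "(\<integral>\<^sup>+u. ennreal (exp (- (\<bar>u\<bar> powr p))) \<partial>lborel) = moment p 0 0"
    unfolding moment_def kern_def
    by (intro nn_integral_cong_AE eventually_mono[OF AE_lborel_singleton[of 0]]) auto
  finally show ?thesis .
qed

lemma scaled_lp_ball_eq: "scaled_lp_ball p n = lp_ball p n (real n)"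
  by (simp add: scaled_lp_ball_def lp_ball_def lp_sum_def)

lemma kappa_pos: "0 < kappa m"
  by (simp add: kappa_eq_unit_ball_vol)

lemma lp_ball_subset_parallel_body:
  assumes "0 \<le> t"
  shows "lp_ball p n R \<subseteq> parallel_body n (lp_ball p n R) t"
proof
  fix y assume y: "y \<in> lp_ball p n R"
  then have "y \<in> {..<n} \<rightarrow>\<^sub>E UNIV" using lp_ball_subset by blast
  from mem_parallel_body_iff[OF this lp_ball_subset assms] show "y \<in> parallel_body n (lp_ball p n R) t"
    using y by (auto intro!: bexI[of _ y])
qed

lemma emeasure_unit_lp_ball: "emeasure (lborel_n n) (lp_ball p n 1) = ennreal (vol n (lp_ball p n 1))"
proof -
  have "emeasure (lborel_n n) (lp_ball p n 1) \<le> emeasure (lborel_n n) (parallel_body n (lp_ball p n 1) 0)"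
    by (intro emeasure_mono lp_ball_subset_parallel_body parallel_body_sets) auto
  also have "\<dots> < \<infinity>" by (rule parallel_body_emeasure_finite) simp
  finally show ?thesis
    unfolding vol_def by (intro emeasure_eq_ennreal_measure) auto
qed

lemma vol_parallel_body:
  assumes R: "0 < R" and t: "0 \<le> t" and q: "\<And>m. 0 \<le> q m"
    and shell: "\<And>t. 0 \<le> t \<Longrightarrow> shell p n t = (\<Sum>m<n. ennreal (q m * t ^ (m + 1)))"
  shows "vol n (parallel_body n (lp_ball p n R) t) =
    R powr (n / p) * vol n (lp_ball p n 1) + (\<Sum>m<n. q m * R powr (real (n - 1 - m) / p) * t ^ (m + 1))"
    (is "_ = ?v")
proof -
  let ?L = "lborel_n n"
  note sub = lp_ball_subset_parallel_body[OF t, of n R] and v1 = emeasure_unit_lp_ball[of n]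
  have v1_nonneg: "0 \<le> vol n (lp_ball p n 1)" by (simp add: vol_def)
  have "emeasure ?L (parallel_body n (lp_ball p n R) t) =
      emeasure ?L (lp_ball p n R \<union> (parallel_body n (lp_ball p n R) t - lp_ball p n R))"
    using sub by (simp add: Un_absorb1)
  also have "\<dots> = emeasure ?L (lp_ball p n R) + emeasure ?L (parallel_body n (lp_ball p n R) t - lp_ball p n R)"
    using R t by (intro plus_emeasure[symmetric] sets.Diff parallel_body_sets p lp_ball_sets) auto
  also have "\<dots> = ennreal (R powr (n / p) * vol n (lp_ball p n 1)) + (\<Sum>m<n. ennreal (q m * R powr (real (n - 1 - m) / p) * t ^ (m + 1)))"
    unfolding emeasure_lp_ball_scale[OF R] v1
    using v1_nonneg by (subst emeasure_shell_poly[OF R t q shell]) (simp_all add: ennreal_mult)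
  also have "ennreal (R powr (n / p) * vol n (lp_ball p n 1)) + (\<Sum>m<n. ennreal (q m * R powr (real (n - 1 - m) / p) * t ^ (m + 1))) =
      ennreal (?v)"
  proof -
    have "0 \<le> q m * R powr (real (n - 1 - m) / p) * t ^ (m + 1)" for m
      using q t by simp
    then show ?thesis
      using v1_nonneg by (subst sum_ennreal) (simp_all only: ennreal_plus sum_nonneg mult_nonneg_nonneg powr_ge_zero)
  qed
  finally have E: "emeasure ?L (parallel_body n (lp_ball p n R) t) =
    ennreal (?v)" .
  show ?thesis
  proof (subst (1) vol_def, rule measure_eq_emeasure_eq_ennreal[OF _ E])
    show "0 \<le> ?v"
      using q t v1_nonneg by (intro add_nonneg_nonneg mult_nonneg_nonneg sum_nonneg) auto
  qed
qed

text \<open>The power t ^ (m + 1) belongs to j = n - 1 - m. The constant term is the volume of the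
  ball itself, which the shells do not contain; it is the case j = n.\<close>

lemma steiner_formula_lp_ball:
  assumes R: "0 < R" and q: "\<And>m. 0 \<le> q m"
    and shell: "\<And>t. 0 \<le> t \<Longrightarrow> shell p n t = (\<Sum>m<n. ennreal (q m * t ^ (m + 1)))"
  shows "steiner_formula n (lp_ball p n R)
    (\<lambda>j. if j = n then R powr (n / p) * vol n (lp_ball p n 1) else q (n - 1 - j) * R powr (j / p) / kappa (n - j))"
    (is "steiner_formula _ _ ?V")
  unfolding steiner_formula_def
proof (intro allI impI)
  fix t :: real assume t: "0 \<le> t"
  have "(\<Sum>j=0..n. kappa (n - j) * ?V j * t ^ (n - j)) =
    kappa 0 * ?V n + (\<Sum>j<n. kappa (n - j) * ?V j * t ^ (n - j))"
    by (simp add: atLeast0AtMost lessThan_Suc_atMost[symmetric])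
  also have "kappa 0 = 1" by (simp add: kappa_eq_unit_ball_vol)
  also have "(\<Sum>j<n. kappa (n - j) * ?V j * t ^ (n - j)) =
      (\<Sum>j<n. q (n - Suc j) * R powr (real (n - 1 - (n - Suc j)) / p) * t ^ (n - Suc j + 1))"
  proof (intro sum.cong refl)
    fix j assume j: "j \<in> {..<n}"
    have "kappa (n - j) \<noteq> 0" using kappa_pos[of "n - j"] by simp
    moreover have "n - 1 - (n - Suc j) = j" "n - Suc j + 1 = n - j" using j by auto
    ultimately show "kappa (n - j) * ?V j * t ^ (n - j) = q (n - Suc j) * R powr (real (n - 1 - (n - Suc j)) / p) * t ^ (n - Suc j + 1)"
      using j by simp
  qed
  also have "\<dots> = (\<Sum>m<n. q m * R powr (real (n - 1 - m) / p) * t ^ (m + 1))"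
    by (rule sum.nat_diff_reindex)
  finally show "vol n (parallel_body n (lp_ball p n R) t) = (\<Sum>j=0..n. kappa (n - j) * ?V j * t ^ (n - j))"
    using vol_parallel_body[OF R t q shell] by simp
qed

text \<open>The index j = n is the volume and has no corresponding \<open>H_int\<close>, hence the
  separate treatment.\<close>

lemma intrinsic_volume_top:
  assumes n: "0 < n"
  shows "0 \<le> intrinsic_volume n (scaled_lp_ball p n) n"
    and "ennreal (intrinsic_volume n (scaled_lp_ball p n) n * Gamma (n / p + 1)) = ennreal (n powr (n / p)) * moment p 0 0 ^ n"
proof -
  obtain q where q: "\<And>m. 0 \<le> q m"
    and shell: "\<And>t. 0 \<le> t \<Longrightarrow> shell p n t = (\<Sum>m<n. ennreal (q m * t ^ (m + 1)))"
    using shell_poly by blast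
  have eq: "intrinsic_volume n (scaled_lp_ball p n) n = n powr (n / p) * vol n (lp_ball p n 1)"
    unfolding scaled_lp_ball_eq
    using intrinsic_volume_eqI[OF steiner_formula_lp_ball[OF _ q shell], of "real n" n] n by simp
  then show "0 \<le> intrinsic_volume n (scaled_lp_ball p n) n" by (simp add: vol_def)
  have g: "0 < Gamma (n / p + 1)" using p by (intro Gamma_real_pos add_nonneg_pos) auto
  have *: "moment p 0 0 ^ n = ennreal (Gamma (n / p + 1)) * ennreal (vol n (lp_ball p n 1))"
    using emeasure_lp_ball[of n] by (simp add: emeasure_unit_lp_ball)
  show "ennreal (intrinsic_volume n (scaled_lp_ball p n) n * Gamma (n / p + 1)) = ennreal (n powr (n / p)) * moment p 0 0 ^ n"
    unfolding eq * using g by (simp add: vol_def mult_ac flip: ennreal_mult)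
qed

text \<open>Comparison of the coefficients of z ^ (n - j) in \<open>shell_coefficients\<close>. The
  left-hand side is kept as a product so that \<open>kappa (n - j)\<close> can later absorb the last
  Gamma factor.\<close>

lemma intrinsic_volume_lower:
  assumes j: "j < n"
  shows "0 \<le> intrinsic_volume n (scaled_lp_ball p n) j"
    and "ennreal (intrinsic_volume n (scaled_lp_ball p n) j * kappa (n - j) * Gamma (j / p + 1) * Gamma (real (n - j) / 2 + 1)) =
      ennreal (n powr (j / p) * (p * n * ((n - 1) choose j) * (p - 1) ^ (n - 1 - j) / 2)) * H_int p n (n - 1 - j)"
proof -
  obtain q where q: "\<And>m. 0 \<le> q m"
    and shell: "\<And>t. 0 \<le> t \<Longrightarrow> shell p n t = (\<Sum>m<n. ennreal (q m * t ^ (m + 1)))"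
    using shell_poly by blast
  define m where "m = n - 1 - j"
  have m: "m < n" "n - 1 - m = j" "real m + 1 = real (n - j)" 
    "((n - 1) choose m) = ((n - 1) choose j)"
    using j binomial_symmetric[of j "n - 1"] by (auto simp: m_def of_nat_diff)
  have n: "0 < n" using j by simp
  have kappa: "0 < kappa (n - j)" by (rule kappa_pos)
  have "intrinsic_volume n (scaled_lp_ball p n) j = q m * n powr (j / p) / kappa (n - j)"
    unfolding scaled_lp_ball_eq m_def
    using intrinsic_volume_eqI[OF steiner_formula_lp_ball[OF _ q shell], of "real n" j] j by simp
  then have eq: "intrinsic_volume n (scaled_lp_ball p n) j * kappa (n - j) = q m * n powr (j / p)"
    and "0 \<le> intrinsic_volume n (scaled_lp_ball p n) j"
    using kappa q[of m] by (auto simp: less_imp_le)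
  then show "0 \<le> intrinsic_volume n (scaled_lp_ball p n) j" by simp
  have G: "0 \<le> Gamma (real k / p + 1)" "0 \<le> Gamma ((real k + 1) / 2 + 1)" for k
    using p by (auto intro!: less_imp_le[OF Gamma_real_pos] add_nonneg_pos)
  have "ennreal (p * n) * (ennreal ((n - 1) choose m) * ennreal ((p - 1) ^ m / 2) * H_int p n m) =
    ennreal (q m * Gamma (real (n - 1 - m) / p + 1) * Gamma ((real m + 1) / 2 + 1))"
  proof (rule poly_coeff_ennreal[where n = n and b = "\<lambda>m. ennreal (p * n) * (ennreal ((n - 1) choose m) * ennreal ((p - 1) ^ m / 2) * H_int p n m)"
      and a = "\<lambda>m. q m * Gamma (real (n - 1 - m) / p + 1) * Gamma ((real m + 1) / 2 + 1)"])
    show "0 \<le> q m * Gamma (real (n - 1 - m) / p + 1) * Gamma ((real m + 1) / 2 + 1)" for m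
      by (intro mult_nonneg_nonneg q G)
    show "(\<Sum>m<n. ennreal (q m * Gamma (real (n - 1 - m) / p + 1) * Gamma ((real m + 1) / 2 + 1) * z ^ (m + 1))) =
      (\<Sum>m<n. ennreal (p * n) * (ennreal ((n - 1) choose m) * ennreal ((p - 1) ^ m / 2) * H_int p n m) * ennreal (z ^ (m + 1)))"
      if "0 < z" for z
      by (rule shell_coefficients[OF n q shell that])
  qed (rule m)
  then have *: "ennreal (p * n) * (ennreal ((n - 1) choose j) * ennreal ((p - 1) ^ m / 2) * H_int p n m) =
    ennreal (q m * Gamma (j / p + 1) * Gamma (real (n - j) / 2 + 1))"
    unfolding m .
  have "ennreal (q m * n powr (j / p) * Gamma (j / p + 1) * Gamma (real (n - j) / 2 + 1)) =
    ennreal (n powr (j / p)) * ennreal (q m * Gamma (j / p + 1) * Gamma (real (n - j) / 2 + 1))"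
    by (subst ennreal_mult'[symmetric]) (auto simp: mult_ac)
  also have "\<dots> = ennreal (n powr (j / p) * (p * n * ((n - 1) choose j) * (p - 1) ^ m / 2)) * H_int p n m"
  proof -
    have "ennreal (n powr (j / p) * (p * n * ((n - 1) choose j) * (p - 1) ^ m / 2)) =
      ennreal (n powr (j / p)) * (ennreal (p * n) * (ennreal ((n - 1) choose j) * ennreal ((p - 1) ^ m / 2)))"
      using p by (simp add: mult.assoc flip: ennreal_mult)
    then show ?thesis unfolding *[symmetric] by (simp only: mult.assoc)
  qed
  finally show "ennreal (intrinsic_volume n (scaled_lp_ball p n) j * kappa (n - j) * Gamma (j / p + 1) * Gamma (real (n - j) / 2 + 1)) =
      ennreal (n powr (j / p) * (p * n * ((n - 1) choose j) * (p - 1) ^ (n - 1 - j) / 2)) * H_int p n (n - 1 - j)"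
    unfolding eq by (simp only: m_def)
qed

section \<open>Moments\<close>

lemma moment_rescale:
  assumes l: "0 < l"
  shows "moment p q \<theta> = ennreal (l powr (q + 1)) *
    (\<integral>\<^sup>+u. ennreal (\<bar>u\<bar> powr q * exp (- (l powr p * \<bar>u\<bar> powr p) - \<theta> * l powr (2 * p - 2) * \<bar>u\<bar> powr (2 * p - 2))) \<partial>lborel)"
    (is "_ = _ * nn_integral _ ?g")
proof -
  have "moment p q \<theta> = ennreal l * (\<integral>\<^sup>+u. ennreal (\<bar>l * u\<bar> powr q * exp (- (\<bar>l * u\<bar> powr p) - \<theta> * \<bar>l * u\<bar> powr (2 * p - 2))) \<partial>lborel)"
    unfolding moment_def kern_def using l by (subst nn_integral_real_affine[of _ l 0]) auto
  also have "\<dots> = (\<integral>\<^sup>+u. ennreal l * ennreal (\<bar>l * u\<bar> powr q * exp (- (\<bar>l * u\<bar> powr p) - \<theta> * \<bar>l * u\<bar> powr (2 * p - 2))) \<partial>lborel)"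
    by (rule nn_integral_cmult[symmetric]) measurable
  also have "\<dots> = (\<integral>\<^sup>+u. ennreal (l powr (q + 1)) * ?g u \<partial>lborel)"
    using l by (intro nn_integral_cong) (simp add: abs_mult powr_mult powr_add mult_ac flip: ennreal_mult)
  also have "\<dots> = ennreal (l powr (q + 1)) *
    (\<integral>\<^sup>+u. ?g u \<partial>lborel)"
    by (rule nn_integral_cmult) measurable
  finally show ?thesis .
qed

lemma moment_antimono: "\<theta> \<le> \<eta> \<Longrightarrow> moment p q \<eta> \<le> moment p q \<theta>"
  unfolding moment_def kern_def by (intro nn_integral_mono ennreal_leI mult_left_mono) (auto intro: mult_right_mono)

lemma nn_integral_abs_powr_exp_finite:
  assumes "-1 < q" "0 < b"
  shows "(\<integral>\<^sup>+u. ennreal (\<bar>u\<bar> powr q * exp (- (\<bar>u\<bar> powr b))) \<partial>lborel) < \<infinity>"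
proof -
  have "(\<integral>\<^sup>+u. ennreal (\<bar>u\<bar> powr q * exp (- (\<bar>u\<bar> powr b))) \<partial>lborel) =
     (\<integral>\<^sup>+u. 2 * (ennreal (u powr q * exp (- (u powr b))) * indicator {0<..} u) \<partial>lborel)"
    by (subst nn_integral_split_sign) (auto intro!: nn_integral_cong simp: indicator_def mult_2)
  also have "\<dots> = 2 * (\<integral>\<^sup>+u\<in>{0<..}. ennreal (u powr q * exp (- (u powr b))) \<partial>lborel)"
    by (rule nn_integral_cmult) measurable
  also have "\<dots> < \<infinity>"
    unfolding nn_integral_powr_exp[OF assms] by (simp add: ennreal_mult_less_top)
  finally show ?thesis .
qed

lemma moment_finite:
  assumes "-1 < q" "0 \<le> \<theta>"
  shows "moment p q \<theta> < \<infinity>"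
proof -
  have "moment p q \<theta> \<le> moment p q 0" using assms by (intro moment_antimono) auto
  also have "\<dots> < \<infinity>"
    using nn_integral_abs_powr_exp_finite[of q p] assms p by (simp add: moment_def kern_def)
  finally show ?thesis .
qed

lemma moment_pos: "0 < moment p q \<theta>"
proof -
  have "moment p q \<theta> \<noteq> 0"
  proof
    assume "moment p q \<theta> = 0"
    then have "AE u in lborel. ennreal (\<bar>u\<bar> powr q * kern p \<theta> u) = 0"
      unfolding moment_def by (subst (asm) nn_integral_0_iff_AE) auto
    then have "AE u::real in lborel. False"
      using AE_lborel_singleton[of 0] by eventually_elim (auto simp: kern_def ennreal_eq_0_iff mult_le_0_iff not_le)
    then show False by (simp add: eventually_False ae_filter_eq_bot_iff)
  qed
  then show ?thesis by (simp add: zero_less_iff_neq_zero)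
qed

lemma moment_rmom: "-1 < q \<Longrightarrow> 0 \<le> \<theta> \<Longrightarrow> moment p q \<theta> = ennreal (rmom p q \<theta>)"
  using moment_finite[of q \<theta>] by (simp add: rmom_def)

lemma rmom_pos: "-1 < q \<Longrightarrow> 0 \<le> \<theta> \<Longrightarrow> 0 < rmom p q \<theta>"
  using moment_finite[of q \<theta>] moment_pos[of q \<theta>] by (auto simp: rmom_def enn2real_positive_iff)

lemma rmom_antimono: "-1 < q \<Longrightarrow> 0 \<le> \<theta> \<Longrightarrow> \<theta> \<le> \<eta> \<Longrightarrow> rmom p q \<eta> \<le> rmom p q \<theta>"
  using moment_antimono[of \<theta> \<eta> q] moment_finite[of q \<theta>] by (auto simp: rmom_def intro: enn2real_mono)

lemma I_fun_rmom: "I_fun p \<theta> = rmom p 0 \<theta>"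
proof -
  have "I_fun p \<theta> = enn2real (\<integral>\<^sup>+x. ennreal (exp (- (\<bar>x\<bar> powr p) - \<theta> * \<bar>x\<bar> powr (2 * p - 2))) \<partial>lborel)"
    unfolding I_fun_def by (rule integral_eq_nn_integral) auto
  also have "(\<integral>\<^sup>+x. ennreal (exp (- (\<bar>x\<bar> powr p) - \<theta> * \<bar>x\<bar> powr (2 * p - 2))) \<partial>lborel) = moment p 0 \<theta>"
    unfolding moment_def kern_def
    by (intro nn_integral_cong_AE eventually_mono[OF AE_lborel_singleton[of 0]]) auto
  finally show ?thesis by (simp add: rmom_def)
qed

lemma J_fun_rmom: "J_fun p \<theta> = rmom p (p - 2) \<theta>"
  unfolding J_fun_def rmom_def moment_def kern_def by (rule integral_eq_nn_integral) auto

text \<open>Rescale the variable by l = d powr (- 1 / (2 p - 2)), chosen such that d \<theta> l powr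
  (2 p - 2) = \<theta>. Since l \<le> 1, the other term of the exponent only improves, and the loss
  is the Jacobian power l powr (q + 1).\<close>

lemma rmom_scale_ge:
  assumes q: "-1 < q" and \<theta>: "0 \<le> \<theta>" and d: "1 \<le> d"
  shows "d powr (- ((q + 1) / (2 * p - 2))) * rmom p q \<theta> \<le> rmom p q (d * \<theta>)"
proof -
  define l where "l = d powr (- (1 / (2 * p - 2)))"
  have l: "0 < l" using d by (simp add: l_def)
  have "l \<le> d powr 0" unfolding l_def using d p by (intro powr_mono) auto
  then have l1: "l powr p \<le> 1" using l d p by (intro powr_le1) auto
  have l2: "d * \<theta> * l powr (2 * p - 2) = \<theta>"
  proof -
    have "l powr (2 * p - 2) = d powr (- 1)" using p by (simp add: l_def powr_powr)
    then show ?thesis using d by (simp add: powr_minus_divide)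
  qed
  have l3: "l powr (q + 1) = d powr (- ((q + 1) / (2 * p - 2)))"
    by (simp add: l_def powr_powr)
  have "moment p q \<theta> \<le> (\<integral>\<^sup>+u. ennreal (\<bar>u\<bar> powr q * exp (- (l powr p * \<bar>u\<bar> powr p) - \<theta> * \<bar>u\<bar> powr (2 * p - 2))) \<partial>lborel)"
    unfolding moment_def kern_def using l1
    by (intro nn_integral_mono ennreal_leI mult_left_mono) (auto simp: mult_left_le_one_le)
  then have "ennreal (l powr (q + 1)) * moment p q \<theta> \<le> moment p q (d * \<theta>)"
    unfolding moment_rescale[OF l, of q "d * \<theta>"] l2 by (intro mult_left_mono) auto
  then show ?thesis
    using q \<theta> d moment_rmom[of q \<theta>] moment_rmom[of q "d * \<theta>"] rmom_pos[of q "d * \<theta>"] rmom_pos[of q \<theta>]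
    by (simp add: l3 flip: ennreal_mult)
qed

text \<open>Rescaling by \<theta> powr (- 1 / (2 p - 2)) normalizes the second term of the exponent,
  and the first is dropped. The power that comes out is exactly \<theta> powr (- 1 / 2), because (p
  - 1) / (2 p - 2) = 1 / 2.\<close>

lemma sqrt_times_J_bounded: "\<exists>C>0. \<forall>\<theta>>0. sqrt \<theta> * rmom p (p - 2) \<theta> \<le> C"
proof -
  define c where "c = (\<integral>\<^sup>+u. ennreal (\<bar>u\<bar> powr (p - 2) * exp (- (\<bar>u\<bar> powr (2 * p - 2)))) \<partial>lborel)"
  have c: "c < \<infinity>" unfolding c_def using p by (intro nn_integral_abs_powr_exp_finite) auto
  have "sqrt \<theta> * rmom p (p - 2) \<theta> \<le> enn2real c + 1" if \<theta>: "0 < \<theta>" for \<theta>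
  proof -
    define l where "l = \<theta> powr (- (1 / (2 * p - 2)))"
    have l: "0 < l" using \<theta> by (simp add: l_def)
    have l2: "\<theta> * l powr (2 * p - 2) = 1"
    proof -
      have "l powr (2 * p - 2) = \<theta> powr (- 1)" using p by (simp add: l_def powr_powr)
      then show ?thesis using \<theta> by (simp add: powr_minus_divide)
    qed
    have l3: "l powr (p - 2 + 1) = inverse (sqrt \<theta>)"
    proof -
      have "l powr (p - 2 + 1) = \<theta> powr (- ((p - 1) / (2 * p - 2)))"
        by (simp add: l_def powr_powr)
      also have "(p - 1) / (2 * p - 2) = 1 / 2" using p by (simp add: field_simps)
      finally show ?thesis using \<theta> by (simp add: powr_minus powr_half_sqrt)
    qed
    have "moment p (p - 2) \<theta> \<le> ennreal (inverse (sqrt \<theta>)) * c"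
      unfolding moment_rescale[OF l, of "p - 2" \<theta>] l2 l3 c_def
      by (intro mult_left_mono nn_integral_mono ennreal_leI) auto
    moreover obtain r where r: "c = ennreal r" "0 \<le> r" using c by (cases c) auto
    ultimately have "rmom p (p - 2) \<theta> \<le> inverse (sqrt \<theta>) * r"
      using \<theta> p moment_rmom[of "p - 2" \<theta>] by (simp flip: ennreal_mult)
    then have "sqrt \<theta> * rmom p (p - 2) \<theta> \<le> sqrt \<theta> * (inverse (sqrt \<theta>) * r)"
      using \<theta> by (intro mult_left_mono) auto
    also have "\<dots> = r" using \<theta> by simp
    finally show ?thesis using r by simp
  qed
  moreover have "0 < enn2real c + 1" using enn2real_nonneg[of c] by linarith
  ultimately show ?thesis by blast
qed

text \<open>The factor x = \<theta> \<bar>u\<bar> powr (2 p - 2) costs half of the exponential: x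
  exp (- x) \<le> exp (- x / 2). This compares with I at \<theta> / 2, and
  \<open>rmom_scale_ge\<close> with d = 2 returns to \<theta>. The decay 1 / \<theta> gives
  convergence at infinity in \<open>H_int_upper\<close>.\<close>

lemma M_le_I: "\<exists>C>0. \<forall>\<theta>>0. rmom p (2 * p - 2) \<theta> \<le> C / \<theta> * rmom p 0 \<theta>"
proof (intro exI[of _ "2 powr (1 / (2 * p - 2))"] conjI allI impI)
  fix \<theta> :: real assume \<theta>: "0 < \<theta>"
  have xexp: "x * exp (- x) \<le> exp (- (x / 2))" for x :: real
  proof -
    have "x \<le> exp (x / 2)"
    proof (cases "0 \<le> x")
      case True
      have "1 + x / 2 + (x / 2)\<^sup>2 / 2 \<le> exp (x / 2)"
        using exp_lower_Taylor_quadratic[of "x / 2"] True by simp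
      moreover have "x \<le> 1 + x / 2 + (x / 2)\<^sup>2 / 2"
        using zero_le_power2[of "x - 2"] by (simp add: power2_eq_square field_simps)
      ultimately show ?thesis by linarith
    qed (use exp_gt_zero[of "x / 2"] in linarith)
    then have "x * exp (- x) \<le> exp (x / 2) * exp (- x)" by (intro mult_right_mono) auto
    also have "\<dots> = exp (- (x / 2))" by (simp flip: exp_add)
    finally show ?thesis .
  qed
  have "ennreal \<theta> * moment p (2 * p - 2) \<theta> =
    (\<integral>\<^sup>+u. ennreal \<theta> * ennreal (\<bar>u\<bar> powr (2 * p - 2) * kern p \<theta> u) \<partial>lborel)"
    unfolding moment_def by (rule nn_integral_cmult[symmetric]) measurable
  also have "\<dots> \<le> moment p 0 (\<theta> / 2)"
    unfolding moment_def
  proof (intro nn_integral_mono_AE eventually_mono[OF AE_lborel_singleton[of 0]])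
    fix u :: real assume u: "u \<noteq> 0"
    define t where "t = \<bar>u\<bar> powr (2 * p - 2)"
    have "\<theta> * (t * exp (- (\<bar>u\<bar> powr p) - \<theta> * t)) = (\<theta> * t * exp (- (\<theta> * t))) * exp (- (\<bar>u\<bar> powr p))"
      by (simp add: exp_diff exp_minus field_simps)
    also have "\<dots> \<le> exp (- (\<theta> * t / 2)) * exp (- (\<bar>u\<bar> powr p))"
      using xexp[of "\<theta> * t"] by (intro mult_right_mono) auto
    also have "\<dots> = \<bar>u\<bar> powr 0 * exp (- (\<bar>u\<bar> powr p) - \<theta> / 2 * t)"
      using u by (simp flip: exp_add)
    finally show "ennreal \<theta> * ennreal (\<bar>u\<bar> powr (2 * p - 2) * kern p \<theta> u)
      \<le> ennreal (\<bar>u\<bar> powr 0 * kern p (\<theta> / 2) u)"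
      using \<theta> unfolding t_def kern_def by (simp add: ennreal_leI flip: ennreal_mult)
  qed
  finally have "\<theta> * rmom p (2 * p - 2) \<theta> \<le> rmom p 0 (\<theta> / 2)"
    using \<theta> p moment_rmom[of "2 * p - 2" \<theta>] moment_rmom[of 0 "\<theta> / 2"] rmom_pos[of 0 "\<theta> / 2"] rmom_pos[of "2 * p - 2" \<theta>]
    by (simp flip: ennreal_mult)
  also have "\<dots> \<le> 2 powr (1 / (2 * p - 2)) * rmom p 0 \<theta>"
    using rmom_scale_ge[of 0 "\<theta> / 2" 2] \<theta> by (simp add: powr_minus_divide field_simps)
  finally show "rmom p (2 * p - 2) \<theta> \<le> 2 powr (1 / (2 * p - 2)) / \<theta> * rmom p 0 \<theta>"
    using \<theta> by (simp add: field_simps)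
qed simp

text \<open>From 1 - x \<le> exp (- x) under the integral. This is the quantitative continuity of I
  at 0 behind \<open>S_1\<close>.\<close>

lemma I_ge: "0 \<le> \<theta> \<Longrightarrow> rmom p 0 0 - \<theta> * rmom p (2 * p - 2) 0 \<le> rmom p 0 \<theta>"
proof -
  assume \<theta>: "0 \<le> \<theta>"
  have "moment p 0 0 \<le> (\<integral>\<^sup>+u. ennreal (\<bar>u\<bar> powr 0 * kern p \<theta> u) +
      ennreal \<theta> * ennreal (\<bar>u\<bar> powr (2 * p - 2) * kern p 0 u) \<partial>lborel)"
    (is "_ \<le> nn_integral _ ?g")
    unfolding moment_def
  proof (intro nn_integral_mono_AE eventually_mono[OF AE_lborel_singleton[of 0]])
    fix u :: real assume u: "u \<noteq> 0"
    define t where "t = \<bar>u\<bar> powr (2 * p - 2)"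
    define e where "e = exp (- (\<bar>u\<bar> powr p))"
    have "1 - \<theta> * t \<le> exp (- (\<theta> * t))" using exp_ge_add_one_self[of "- (\<theta> * t)"] by simp
    then have "e * 1 \<le> e * (exp (- (\<theta> * t)) + \<theta> * t)" by (intro mult_left_mono) (auto simp: e_def)
    also have "\<dots> = exp (- (\<bar>u\<bar> powr p) - \<theta> * t) + \<theta> * (t * e)"
      by (simp add: e_def exp_diff exp_minus field_simps)
    finally have "e \<le> exp (- (\<bar>u\<bar> powr p) - \<theta> * t) + \<theta> * (t * e)" by simp
    then show "ennreal (\<bar>u\<bar> powr 0 * kern p 0 u) \<le> ?g u"
      using \<theta> u by (simp add: kern_def t_def e_def flip: ennreal_mult ennreal_plus)
  qed
  also have "\<dots> = moment p 0 \<theta> + ennreal \<theta> * moment p (2 * p - 2) 0"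
    unfolding moment_def by (subst nn_integral_add) (auto simp: nn_integral_cmult)
  finally show ?thesis
    using \<theta> p moment_rmom[of 0 0] moment_rmom[of 0 \<theta>] moment_rmom[of "2 * p - 2" 0]
      rmom_pos[of 0 \<theta>] rmom_pos[of "2 * p - 2" 0]
    by (simp flip: ennreal_mult ennreal_plus)
qed

section \<open>Uniform Laplace asymptotics\<close>

lemma IJM_pos: "0 \<le> \<theta> \<Longrightarrow> 0 < rmom p 0 \<theta>" "0 \<le> \<theta> \<Longrightarrow> 0 < rmom p (p - 2) \<theta>" "0 \<le> \<theta> \<Longrightarrow> 0 < rmom p (2 * p - 2) \<theta>"
  using p by (auto intro!: rmom_pos)

lemma Psi_eq: "Psi p \<alpha> \<theta> = (1 - \<alpha>) / 2 * ln \<theta> + \<alpha> * ln (rmom p 0 \<theta>) + (1 - \<alpha>) * ln (rmom p (p - 2) \<theta>)"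
  by (simp add: Psi_def I_fun_rmom J_fun_rmom)

lemma exp_Psi:
  assumes "0 < n" "j \<le> n" "0 < \<theta>"
  shows "exp (n * Psi p (j / n) \<theta>) = \<theta> powr (real (n - j) / 2) * rmom p 0 \<theta> ^ j * rmom p (p - 2) \<theta> ^ (n - j)"
proof -
  have "n * Psi p (j / n) \<theta> = real (n - j) / 2 * ln \<theta> + j * ln (rmom p 0 \<theta>) + real (n - j) * ln (rmom p (p - 2) \<theta>)"
    using assms by (simp add: Psi_eq of_nat_diff field_simps)
  then show ?thesis
    using assms IJM_pos[of \<theta>] by (simp add: exp_add powr_def exp_of_nat_mult del: of_nat_diff)
qed

lemma Psi_bdd_above: "0 \<le> \<alpha> \<Longrightarrow> \<alpha> \<le> 1 \<Longrightarrow> bdd_above (Psi p \<alpha> ` {0<..})"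
proof -
  assume \<alpha>: "0 \<le> \<alpha>" "\<alpha> \<le> 1"
  obtain C where C: "C > 0" "\<And>\<theta>. 0 < \<theta> \<Longrightarrow> sqrt \<theta> * rmom p (p - 2) \<theta> \<le> C"
    using sqrt_times_J_bounded by blast
  show ?thesis
  proof (rule bdd_aboveI2)
    fix \<theta> :: real assume "\<theta> \<in> {0<..}"
    then have \<theta>: "0 < \<theta>" by simp
    have "ln (sqrt \<theta> * rmom p (p - 2) \<theta>) \<le> ln C"
      using C \<theta> IJM_pos[of \<theta>] by (subst ln_le_cancel_iff) auto
    then have J: "1 / 2 * ln \<theta> + ln (rmom p (p - 2) \<theta>) \<le> ln C" using \<theta> IJM_pos[of \<theta>] by (simp add: ln_mult ln_sqrt)
    have I: "ln (rmom p 0 \<theta>) \<le> ln (rmom p 0 0)"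
      using \<theta> IJM_pos[of \<theta>] IJM_pos[of 0] rmom_antimono[of 0 0 \<theta>] by (subst ln_le_cancel_iff) auto
    have "Psi p \<alpha> \<theta> = (1 - \<alpha>) * (1 / 2 * ln \<theta> + ln (rmom p (p - 2) \<theta>)) + \<alpha> * ln (rmom p 0 \<theta>)"
      by (simp add: Psi_eq algebra_simps)
    also have "\<dots> \<le> (1 - \<alpha>) * ln C + \<alpha> * ln (rmom p 0 0)"
      using \<alpha> I J by (intro add_mono mult_left_mono) auto
    finally show "Psi p \<alpha> \<theta> \<le> (1 - \<alpha>) * ln C + \<alpha> * ln (rmom p 0 0)" .
  qed
qed

lemma Psi_le_S: "0 \<le> \<alpha> \<Longrightarrow> \<alpha> \<le> 1 \<Longrightarrow> 0 < \<theta> \<Longrightarrow> Psi p \<alpha> \<theta> \<le> S_fun p \<alpha>"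
  unfolding S_fun_def by (intro cSUP_upper Psi_bdd_above) auto

lemma S_leI: "(\<And>\<theta>. 0 < \<theta> \<Longrightarrow> Psi p \<alpha> \<theta> \<le> b) \<Longrightarrow> S_fun p \<alpha> \<le> b"
  unfolding S_fun_def by (intro cSUP_least) auto

lemma S_near:
  assumes "\<epsilon> > 0"
  obtains \<theta> where "0 < \<theta>" "S_fun p \<alpha> - \<epsilon> < Psi p \<alpha> \<theta>"
proof -
  have "\<exists>\<theta>>0. S_fun p \<alpha> - \<epsilon> < Psi p \<alpha> \<theta>"
  proof (rule ccontr)
    assume "\<not> ?thesis"
    then have "S_fun p \<alpha> \<le> S_fun p \<alpha> - \<epsilon>" by (intro S_leI) (meson not_less)
    then show False using assms by simp
  qed
  then show thesis using that by blast
qed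

lemma S_convex:
  assumes "0 \<le> l" "l \<le> 1" "0 \<le> \<alpha>" "\<alpha> \<le> 1" "0 \<le> \<beta>" "\<beta> \<le> 1"
  shows "S_fun p ((1 - l) * \<alpha> + l * \<beta>) \<le> (1 - l) * S_fun p \<alpha> + l * S_fun p \<beta>"
proof (rule S_leI)
  fix \<theta> :: real assume \<theta>: "0 < \<theta>"
  have "Psi p ((1 - l) * \<alpha> + l * \<beta>) \<theta> = (1 - l) * Psi p \<alpha> \<theta> + l * Psi p \<beta> \<theta>"
    by (simp add: Psi_eq field_simps)
  also have "\<dots> \<le> (1 - l) * S_fun p \<alpha> + l * S_fun p \<beta>"
    using assms \<theta> by (intro add_mono mult_left_mono Psi_le_S) auto
  finally show "Psi p ((1 - l) * \<alpha> + l * \<beta>) \<theta> \<le> (1 - l) * S_fun p \<alpha> + l * S_fun p \<beta>" .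
qed

text \<open>Convexity along the segment from \<alpha> to the endpoint on the side of \<beta>. The
  bound also covers \<alpha> = 0 and \<alpha> = 1: the quotient by 0 is then 0, and \<beta> cannot
  lie on that side.\<close>

lemma S_le_chord:
  assumes \<alpha>: "0 \<le> \<alpha>" "\<alpha> \<le> 1" and \<beta>: "0 \<le> \<beta>" "\<beta> \<le> 1"
  shows "S_fun p \<beta> \<le> S_fun p \<alpha> + \<bar>\<beta> - \<alpha>\<bar> * (\<bar>S_fun p 0 - S_fun p \<alpha>\<bar> / \<alpha> + \<bar>S_fun p 1 - S_fun p \<alpha>\<bar> / (1 - \<alpha>))"
proof -
  have chord: "S_fun p \<beta> \<le> S_fun p \<alpha> + l * \<bar>S_fun p e - S_fun p \<alpha>\<bar>"
    if "0 \<le> l" "l \<le> 1" "0 \<le> e" "e \<le> 1" "\<beta> = \<alpha> + l * (e - \<alpha>)" for l e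
  proof -
    have "\<beta> = (1 - l) * \<alpha> + l * e" using that(5) by (simp add: algebra_simps)
    then have "S_fun p \<beta> \<le> (1 - l) * S_fun p \<alpha> + l * S_fun p e"
      using S_convex[OF that(1,2) \<alpha> that(3,4)] by simp
    also have "\<dots> = S_fun p \<alpha> + l * (S_fun p e - S_fun p \<alpha>)" by (simp add: algebra_simps)
    also have "\<dots> \<le> S_fun p \<alpha> + l * \<bar>S_fun p e - S_fun p \<alpha>\<bar>"
      using that by (intro add_left_mono mult_left_mono) auto
    finally show ?thesis .
  qed
  have nn: "0 \<le> \<bar>\<beta> - \<alpha>\<bar> * (\<bar>S_fun p 0 - S_fun p \<alpha>\<bar> / \<alpha>)" "0 \<le> \<bar>\<beta> - \<alpha>\<bar> * (\<bar>S_fun p 1 - S_fun p \<alpha>\<bar> / (1 - \<alpha>))"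
    using \<alpha> by auto
  show ?thesis
  proof (cases \<beta> \<alpha> rule: linorder_cases)
    case less
    then have "S_fun p \<beta> \<le> S_fun p \<alpha> + (\<alpha> - \<beta>) / \<alpha> * \<bar>S_fun p 0 - S_fun p \<alpha>\<bar>"
      using \<alpha> \<beta> by (intro chord) (auto simp: divide_le_eq)
    then show ?thesis using less nn by (simp add: distrib_left)
  next
    case greater
    then have "S_fun p \<beta> \<le> S_fun p \<alpha> + (\<beta> - \<alpha>) / (1 - \<alpha>) * \<bar>S_fun p 1 - S_fun p \<alpha>\<bar>"
      using \<alpha> \<beta> by (intro chord) (auto simp: divide_le_eq)
    then show ?thesis using greater nn by (simp add: distrib_left)
  qed simp
qed

lemma Psi_diff_le: "\<bar>Psi p \<beta> \<theta> - Psi p \<alpha> \<theta>\<bar> \<le> \<bar>\<beta> - \<alpha>\<bar> * \<bar>ln (rmom p 0 \<theta>) - ln (rmom p (p - 2) \<theta>) - ln \<theta> / 2\<bar>"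
proof -
  have "Psi p \<beta> \<theta> - Psi p \<alpha> \<theta> = (\<beta> - \<alpha>) * (ln (rmom p 0 \<theta>) - ln (rmom p (p - 2) \<theta>) - ln \<theta> / 2)"
    by (simp add: Psi_eq field_simps)
  then show ?thesis by (simp add: abs_mult)
qed

text \<open>Convexity alone would allow upward jumps at 0 and 1. The upper estimate is the chord
  bound; the lower one holds because a nearly optimal \<theta> for \<alpha> stays nearly optimal
  nearby, as \<open>Psi\<close> is affine in \<alpha>.\<close>

lemma S_continuous:
  assumes \<alpha>: "0 \<le> \<alpha>" "\<alpha> \<le> 1" and \<epsilon>: "0 < \<epsilon>"
  obtains d where "0 < d" "\<And>\<beta>. 0 \<le> \<beta> \<Longrightarrow> \<beta> \<le> 1 \<Longrightarrow> \<bar>\<beta> - \<alpha>\<bar> < d \<Longrightarrow> \<bar>S_fun p \<beta> - S_fun p \<alpha>\<bar> < \<epsilon>"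
proof -
  obtain \<theta> where \<theta>: "0 < \<theta>" "S_fun p \<alpha> - \<epsilon> / 2 < Psi p \<alpha> \<theta>" using S_near[of "\<epsilon> / 2" \<alpha>] \<epsilon> by auto
  define B where "B = \<bar>ln (rmom p 0 \<theta>) - ln (rmom p (p - 2) \<theta>) - ln \<theta> / 2\<bar>"
  define K where "K = \<bar>S_fun p 0 - S_fun p \<alpha>\<bar> / \<alpha> + \<bar>S_fun p 1 - S_fun p \<alpha>\<bar> / (1 - \<alpha>)"
  obtain d1 where d1: "0 < d1" "\<And>x. 0 \<le> x \<Longrightarrow> x < d1 \<Longrightarrow> x * B < \<epsilon> / 2"
    using ex_delta_mult_less[of B "\<epsilon> / 2"] \<epsilon> by (auto simp: B_def)
  obtain d2 where d2: "0 < d2" "\<And>x. 0 \<le> x \<Longrightarrow> x < d2 \<Longrightarrow> x * K < \<epsilon>"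
    using ex_delta_mult_less[of K \<epsilon>] \<epsilon> \<alpha> by (auto simp: K_def)
  show thesis
  proof (rule that[of "min d1 d2"])
    fix \<beta> :: real assume \<beta>: "0 \<le> \<beta>" "\<beta> \<le> 1" "\<bar>\<beta> - \<alpha>\<bar> < min d1 d2"
    have "S_fun p \<beta> \<le> S_fun p \<alpha> + \<bar>\<beta> - \<alpha>\<bar> * K" unfolding K_def by (rule S_le_chord[OF \<alpha> \<beta>(1,2)])
    then have "S_fun p \<beta> < S_fun p \<alpha> + \<epsilon>" using d2(2)[of "\<bar>\<beta> - \<alpha>\<bar>"] \<beta> by simp
    moreover have "Psi p \<beta> \<theta> \<le> S_fun p \<beta>" by (rule Psi_le_S[OF \<beta>(1,2) \<theta>(1)])
    moreover have "\<bar>Psi p \<beta> \<theta> - Psi p \<alpha> \<theta>\<bar> \<le> \<bar>\<beta> - \<alpha>\<bar> * B" unfolding B_def by (rule Psi_diff_le)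
    then have "\<bar>Psi p \<beta> \<theta> - Psi p \<alpha> \<theta>\<bar> < \<epsilon> / 2" using d1(2)[of "\<bar>\<beta> - \<alpha>\<bar>"] \<beta> by simp
    ultimately show "\<bar>S_fun p \<beta> - S_fun p \<alpha>\<bar> < \<epsilon>" using \<theta>(2) by linarith
  qed (use d1 d2 in auto)
qed

text \<open>For \<alpha> = 1, \<open>Psi\<close> is ln of I(\<theta>), which grows as \<theta>
  decreases to 0. The supremum is therefore the limit at 0, and it matches the moment in the volume
  formula.\<close>

lemma S_1: "S_fun p 1 = ln (rmom p 0 0)"
proof (rule antisym)
  show "S_fun p 1 \<le> ln (rmom p 0 0)"
    using IJM_pos rmom_antimono[of 0 0]
    by (intro S_leI) (auto simp: Psi_eq less_imp_le)
  have "((\<lambda>\<theta>. ln (rmom p 0 0 - \<theta> * rmom p (2 * p - 2) 0)) \<longlongrightarrow> ln (rmom p 0 0 - 0 * rmom p (2 * p - 2) 0)) (at_right 0)"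
    using IJM_pos[of 0] by (intro tendsto_intros) auto
  then have lim: "((\<lambda>\<theta>. ln (rmom p 0 0 - \<theta> * rmom p (2 * p - 2) 0)) \<longlongrightarrow> ln (rmom p 0 0)) (at_right 0)" by simp
  have "((\<lambda>\<theta>. rmom p 0 0 - \<theta> * rmom p (2 * p - 2) 0) \<longlongrightarrow> rmom p 0 0 - 0 * rmom p (2 * p - 2) 0) (at_right 0)" by (intro tendsto_intros)
  then have "\<forall>\<^sub>F \<theta> in at_right 0. 0 < rmom p 0 0 - \<theta> * rmom p (2 * p - 2) 0"
    using IJM_pos(1)[of 0] by (intro order_tendstoD(1)) auto
  then have "\<forall>\<^sub>F \<theta> in at_right 0. ln (rmom p 0 0 - \<theta> * rmom p (2 * p - 2) 0) \<le> S_fun p 1"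
    using eventually_at_right_less[of 0]
  proof eventually_elim
    case (elim \<theta>)
    have "ln (rmom p 0 0 - \<theta> * rmom p (2 * p - 2) 0) \<le> ln (rmom p 0 \<theta>)"
      using elim IJM_pos[of \<theta>] I_ge[of \<theta>] by (subst ln_le_cancel_iff) auto
    also have "\<dots> = Psi p 1 \<theta>" by (simp add: Psi_eq)
    also have "\<dots> \<le> S_fun p 1" using elim by (intro Psi_le_S) auto
    finally show ?case .
  qed
  then show "ln (rmom p 0 0) \<le> S_fun p 1"
    by (rule tendsto_upperbound[OF lim]) simp
qed

lemma H_int_eq:
  assumes "j < n"
  shows "H_int p n (n - 1 - j) = (\<integral>\<^sup>+\<theta>\<in>{0<..}. ennreal (H_fun p n j \<theta>) \<partial>lborel)"
  unfolding H_int_def H_fun_def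
proof (rule nn_integral_cong)
  fix \<theta> :: real
  have [simp]: "n - Suc (n - Suc j) = j" using assms by simp
  show "ennreal (\<theta> powr ((real (n - 1 - j) - 1) / 2)) * moment p (2 * p - 2) \<theta> * moment p (p - 2) \<theta> ^ (n - 1 - j) *
      moment p 0 \<theta> ^ (n - 1 - (n - 1 - j)) * indicator {0<..} \<theta> =
    ennreal (\<theta> powr ((real (n - 1 - j) - 1) / 2) * rmom p (2 * p - 2) \<theta> * rmom p (p - 2) \<theta> ^ (n - 1 - j) * rmom p 0 \<theta> ^ j) * indicator {0<..} \<theta>"
    using p moment_rmom[of _ \<theta>] IJM_pos[of \<theta>]
    by (cases "0 < \<theta>") (simp_all add: ennreal_power less_imp_le flip: ennreal_mult)
qed

lemma measurable_rmom [measurable]: "rmom p q \<in> borel_measurable borel"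
  unfolding rmom_def using measurable_moment by measurable

text \<open>Factoring out exp of n \<open>Psi\<close> at j / n would leave M(\<theta>) / (\<theta>
  J(\<theta>)), with M the moment of order 2 p - 2; this is not integrable at 0. The integrand
  contains j factors I and n - 1 - j factors J; completing it by one more I gives \<open>Psi\<close>
  at (j + 1) / n and leaves the integrable weight w.\<close>

lemma H_int_upper: "\<exists>C>0. \<forall>n j. j < n \<longrightarrow> H_int p n (n - 1 - j) \<le> ennreal (C * exp (n * S_fun p (real (j + 1) / n)))"
proof -
  obtain B where B: "B > 0" "\<And>\<theta>. 0 < \<theta> \<Longrightarrow> rmom p (2 * p - 2) \<theta> \<le> B / \<theta> * rmom p 0 \<theta>" using M_le_I by blast
  define A where "A = rmom p (2 * p - 2) 0 / rmom p 0 1"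
  have A: "A > 0" using IJM_pos[of 0] IJM_pos[of 1] by (simp add: A_def)
  define w where "w \<theta> = \<theta> powr (- 1 / 2) * (rmom p (2 * p - 2) \<theta> / rmom p 0 \<theta>)" for \<theta>
  have [measurable]: "w \<in> borel_measurable borel" unfolding w_def by measurable
  \<comment> \<open>The weight is split at 1. Below, the quotient of moments is at most A by
    monotonicity, and a factor exp (1 - \<theta>) \<ge> 1 is inserted to obtain a Gamma integral;
    above, \<open>M_le_I\<close> gives the power - 3 / 2.\<close>
  have w_le: "ennreal (w \<theta>) * indicator {0<..} \<theta> \<le> ennreal (A * exp 1) * (ennreal (\<theta> powr (- 1 / 2) * exp (- \<theta>)) * indicator {0<..} \<theta>) +
      ennreal B * (ennreal (\<theta> powr (- 3 / 2)) * indicator {1..} \<theta>)"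
    (is "_ \<le> ?u \<theta>") for \<theta>
  proof -
    consider "\<theta> \<le> 0" | "0 < \<theta>" "\<theta> \<le> 1" | "1 < \<theta>" by linarith
    then show ?thesis
    proof cases
      case 2
      have "rmom p (2 * p - 2) \<theta> / rmom p 0 \<theta> \<le> A" unfolding A_def
        using 2 IJM_pos[of \<theta>] IJM_pos[of 1] rmom_antimono[of "2 * p - 2" 0 \<theta>] rmom_antimono[of 0 \<theta> 1] p
        by (intro frac_le) (auto simp: less_imp_le)
      then have "w \<theta> \<le> \<theta> powr (- 1 / 2) * A" unfolding w_def by (intro mult_left_mono) auto
      also have "\<dots> \<le> \<theta> powr (- 1 / 2) * A * exp (1 - \<theta>)" using 2 A mult_left_mono[of 1 "exp (1 - \<theta>)" "\<theta> powr (- 1 / 2) * A"] by simp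
      also have "\<dots> = A * exp 1 * (\<theta> powr (- 1 / 2) * exp (- \<theta>))"
      proof -
        have e: "exp (1 - \<theta>) = exp 1 * exp (- \<theta>)" by (simp flip: exp_add)
        show ?thesis unfolding e by (simp only: mult_ac)
      qed
      finally have "ennreal (w \<theta>) \<le> ennreal (A * exp 1) * ennreal (\<theta> powr (- 1 / 2) * exp (- \<theta>))"
        using A by (simp add: ennreal_leI flip: ennreal_mult)
      then show ?thesis using 2 by (simp add: add_increasing2)
    next
      case 3
      have "rmom p (2 * p - 2) \<theta> / rmom p 0 \<theta> \<le> B / \<theta>"
        using B(2)[of \<theta>] 3 IJM_pos[of \<theta>] by (simp add: pos_divide_le_eq)
      then have "w \<theta> \<le> \<theta> powr (- 1 / 2) * (B / \<theta>)" unfolding w_def by (intro mult_left_mono) auto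
      also have "\<dots> = B * \<theta> powr (- 3 / 2)"
        using 3 powr_add[of \<theta> "- 1 / 2" "- 1"] by (simp add: powr_minus_divide)
      finally have "ennreal (w \<theta>) \<le> ennreal B * ennreal (\<theta> powr (- 3 / 2))"
        using B by (simp add: ennreal_leI flip: ennreal_mult)
      then show ?thesis using 3 by (simp add: add_increasing)
    qed simp
  qed
  have "(\<integral>\<^sup>+\<theta>\<in>{0<..}. ennreal (w \<theta>) \<partial>lborel) \<le>
    (\<integral>\<^sup>+\<theta>. ?u \<theta> \<partial>lborel)"
    by (intro nn_integral_mono w_le)
  also have "\<dots> = ennreal (A * exp 1) * (\<integral>\<^sup>+\<theta>\<in>{0<..}. ennreal (\<theta> powr (- 1 / 2) * exp (- \<theta>)) \<partial>lborel) +
      ennreal B * (\<integral>\<^sup>+\<theta>\<in>{1..}. ennreal (\<theta> powr (- 3 / 2)) \<partial>lborel)"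
    by (subst nn_integral_add) (auto simp: nn_integral_cmult)
  also have "\<dots> < \<infinity>"
  proof -
    have "(\<integral>\<^sup>+\<theta>\<in>{1..}. ennreal (\<theta> powr (- 3 / 2)) \<partial>lborel) = ennreal (0 - (- 2 * 1 powr (- 1 / 2)))"
    proof (rule nn_integral_FTC_atLeast[where F = "\<lambda>t. - 2 * t powr (- 1 / 2)"])
      show "((\<lambda>t. - 2 * t powr (- 1 / 2)) has_real_derivative t powr (- 3 / 2)) (at t)" if "1 \<le> t" for t :: real
        using that by (auto intro!: derivative_eq_intros)
      have "((\<lambda>t::real. t powr (- (1 / 2))) \<longlongrightarrow> 0) at_top" by (rule tendsto_neg_powr) (auto simp: filterlim_ident)
      from tendsto_mult_left[OF this, of "- 2"] show "((\<lambda>t::real. - 2 * t powr (- 1 / 2)) \<longlongrightarrow> 0) at_top" by simp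
    qed auto
    then show ?thesis
      by (subst nn_integral_powr_exp_minus) (auto simp: ennreal_mult_less_top)
  qed
  finally obtain c where c: "(\<integral>\<^sup>+\<theta>\<in>{0<..}. ennreal (w \<theta>) \<partial>lborel) = ennreal c" "0 \<le> c"
    by (cases "\<integral>\<^sup>+\<theta>. ennreal (w \<theta>) * indicator {0<..} \<theta> \<partial>lborel") auto
  have "H_int p n (n - 1 - j) \<le> ennreal ((c + 1) * exp (n * S_fun p (real (j + 1) / n)))" if j: "j < n" for n j
  proof -
    define s where "s = n * S_fun p (real (j + 1) / n)"
    have "H_int p n (n - 1 - j) \<le> (\<integral>\<^sup>+\<theta>. ennreal (exp s) * (ennreal (w \<theta>) * indicator {0<..} \<theta>) \<partial>lborel)"
      unfolding H_int_eq[OF j]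
    proof (rule nn_integral_mono)
      fix \<theta> :: real
      show "ennreal (H_fun p n j \<theta>) * indicator {0<..} \<theta>
        \<le> ennreal (exp s) * (ennreal (w \<theta>) * indicator {0<..} \<theta>)"
      proof (cases "0 < \<theta>")
        case \<theta>: True
        have n: "0 < n" "j + 1 \<le> n" "n - (j + 1) = n - 1 - j" using j by auto
        have "n * Psi p (real (j + 1) / n) \<theta> \<le> s"
          unfolding s_def using n \<theta> by (intro mult_left_mono Psi_le_S) auto
        then have "exp (n * Psi p (real (j + 1) / n) \<theta>) * w \<theta> \<le> exp s * w \<theta>"
          using IJM_pos[of \<theta>] \<theta> by (intro mult_right_mono) (auto simp: w_def)
        moreover have "exp (n * Psi p (real (j + 1) / n) \<theta>) * w \<theta> =
          H_fun p n j \<theta>"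
        proof -
          have "\<theta> powr ((real (n - 1 - j) - 1) / 2) = \<theta> powr (real (n - 1 - j) / 2) * \<theta> powr (- 1 / 2)"
            by (simp add: diff_divide_distrib flip: powr_add)
          then show ?thesis
            unfolding exp_Psi[OF n(1,2) \<theta>] n(3) w_def H_fun_def using IJM_pos[of \<theta>] \<theta> by simp
        qed
        ultimately show ?thesis
          using \<theta> IJM_pos[of \<theta>] by (simp add: ennreal_leI w_def H_fun_def flip: ennreal_mult)
      qed simp
    qed
    also have "\<dots> = ennreal (exp s) * ennreal c"
      unfolding c(1)[symmetric] by (rule nn_integral_cmult) measurable
    also have "\<dots> \<le> ennreal ((c + 1) * exp s)"
      using c by (simp add: ennreal_leI algebra_simps flip: ennreal_mult)
    finally show ?thesis by (simp add: s_def)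
  qed
  moreover have "c + 1 > 0" using c by simp
  ultimately show ?thesis by blast
qed

text \<open>Restrict the integral to [\<theta>0, d \<theta>0]. There \<open>rmom_scale_ge\<close>
  costs at most d powr (- 1 / 2) per factor J and d powr (- 1 / (2 p - 2)) per factor I, so no
  maximizer and no second derivative enters. The constant c does not depend on n and j.\<close>

lemma H_int_lower:
  assumes \<theta>0: "0 < \<theta>0" and d: "1 < d"
  shows "\<exists>c>0. \<forall>n j. j < n \<longrightarrow>
    ennreal (c * exp (n * (Psi p (j / n) \<theta>0 - (1 / 2 + 1 / (2 * p - 2)) * ln d))) \<le> H_int p n (n - 1 - j)"
proof -
  define a where "a = 1 / (2 * p - 2)"
  have a: "0 < a" using p by (simp add: a_def)
  \<comment> \<open>A lower bound on the interval for M(\<theta>) / (\<theta> J(\<theta>)), the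
    factor by which the integrand differs from exp of n \<open>Psi\<close>; M is again the moment of
    order 2 p - 2.\<close>
  define b where "b = rmom p (2 * p - 2) (d * \<theta>0) / (d * \<theta>0 * rmom p (p - 2) \<theta>0)"
  have b: "0 < b" using \<theta>0 d IJM_pos[of \<theta>0] IJM_pos[of "d * \<theta>0"] by (simp add: b_def)
  have bound: "b * exp (n * (Psi p (j / n) \<theta>0 - (1 / 2 + a) * ln d)) \<le> H_fun p n j \<theta>"
    if j: "j < n" and \<theta>: "\<theta>0 \<le> \<theta>" "\<theta> \<le> d * \<theta>0" for n j \<theta>
  proof -
    define k where "k = n - j"
    have k: "0 < k" "k \<le> n" "n - 1 - j = k - 1" using j by (auto simp: k_def)
    have \<theta>_pos: "0 < \<theta>" using \<theta> \<theta>0 by simp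
    note pos = IJM_pos[of \<theta>0] IJM_pos[of \<theta>] IJM_pos[of "d * \<theta>0"]
    have half: "(p - 2 + 1) / (2 * p - 2) = 1 / 2" using p by (simp add: field_simps)
    have "d powr (- ((p - 2 + 1) / (2 * p - 2))) * rmom p (p - 2) \<theta>0 \<le> rmom p (p - 2) (d * \<theta>0)"
      using p \<theta>0 d by (intro rmom_scale_ge) auto
    then have "d powr (- (1 / 2)) * rmom p (p - 2) \<theta>0 \<le> rmom p (p - 2) (d * \<theta>0)"
      unfolding half .
    also have "\<dots> \<le> rmom p (p - 2) \<theta>" using \<theta> \<theta>_pos p by (intro rmom_antimono) auto
    finally have J: "(d powr (- (1 / 2)) * rmom p (p - 2) \<theta>0) ^ k \<le> rmom p (p - 2) \<theta> ^ k"
      using \<theta>0 pos by (intro power_mono) auto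
    have "d powr (- a) * rmom p 0 \<theta>0 \<le> rmom p 0 (d * \<theta>0)"
      using rmom_scale_ge[of 0 \<theta>0 d] p \<theta>0 d by (simp add: a_def)
    also have "\<dots> \<le> rmom p 0 \<theta>" using \<theta> \<theta>_pos p by (intro rmom_antimono) auto
    finally have I: "(d powr (- a) * rmom p 0 \<theta>0) ^ j \<le> rmom p 0 \<theta> ^ j"
      using \<theta>0 pos by (intro power_mono) auto
    have T: "\<theta>0 powr (real k / 2) \<le> \<theta> powr (real k / 2)" using \<theta> \<theta>0 by (intro powr_mono2) auto
    have B: "b \<le> rmom p (2 * p - 2) \<theta> / (\<theta> * rmom p (p - 2) \<theta>)"
      unfolding b_def using \<theta> \<theta>0 \<theta>_pos d p pos
      by (intro frac_le mult_mono rmom_antimono) (auto simp: less_imp_le)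
    have "exp (n * (Psi p (j / n) \<theta>0 - (1 / 2 + a) * ln d)) =
        exp (n * Psi p (j / n) \<theta>0) * d powr (- (real n * (1 / 2 + a)))"
      using d by (simp add: powr_def algebra_simps flip: exp_add)
    also have "\<dots> \<le> exp (n * Psi p (j / n) \<theta>0) * d powr (- (real k * (1 / 2)) - real j * a)"
    proof (intro mult_left_mono powr_mono)
      have "real k * (1 / 2) \<le> real n * (1 / 2)" "real j * a \<le> real n * a"
        using k j a by (auto intro!: mult_right_mono)
      then show "- (real n * (1 / 2 + a)) \<le> - (real k * (1 / 2)) - real j * a" by (simp add: algebra_simps)
    qed (use d in auto)
    also have "d powr (- (real k * (1 / 2)) - real j * a) = (d powr (- (1 / 2))) ^ k * (d powr (- a)) ^ j"
    proof -
      have "(d powr (- (1 / 2))) ^ k = d powr (- (real k * (1 / 2)))" "(d powr (- a)) ^ j = d powr (- (real j * a))"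
        using d by (simp_all add: powr_power mult.commute)
      then show ?thesis by (simp only: diff_conv_add_uminus powr_add)
    qed
    also have "exp (n * Psi p (j / n) \<theta>0) * ((d powr (- (1 / 2))) ^ k * (d powr (- a)) ^ j) =
        \<theta>0 powr (real k / 2) * ((d powr (- (1 / 2)) * rmom p (p - 2) \<theta>0) ^ k * (d powr (- a) * rmom p 0 \<theta>0) ^ j)"
      using exp_Psi[of n j \<theta>0] j \<theta>0 by (simp add: k_def power_mult_distrib mult_ac del: of_nat_diff)
    also have "\<dots> \<le> \<theta> powr (real k / 2) * (rmom p (p - 2) \<theta> ^ k * rmom p 0 \<theta> ^ j)"
      using T I J pos \<theta>0 \<theta>_pos by (intro mult_mono mult_nonneg_nonneg) (auto simp: less_imp_le)
    finally have "b * exp (n * (Psi p (j / n) \<theta>0 - (1 / 2 + a) * ln d)) \<le>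
        rmom p (2 * p - 2) \<theta> / (\<theta> * rmom p (p - 2) \<theta>) * (\<theta> powr (real k / 2) * (rmom p (p - 2) \<theta> ^ k * rmom p 0 \<theta> ^ j))"
      using B b pos \<theta>0 \<theta>_pos by (intro mult_mono) auto
    also have "\<dots> = \<theta> powr ((real (k - 1) - 1) / 2) * rmom p (2 * p - 2) \<theta> * rmom p (p - 2) \<theta> ^ (k - 1) * rmom p 0 \<theta> ^ j"
    proof -
      have "rmom p (p - 2) \<theta> ^ k = rmom p (p - 2) \<theta> * rmom p (p - 2) \<theta> ^ (k - 1)"
        using k(1) by (cases k) auto
      moreover have "\<theta> powr (real k / 2) = \<theta> * \<theta> powr ((real (k - 1) - 1) / 2)"
        using k(1) \<theta>_pos by (simp add: powr_mult_base of_nat_diff field_simps)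
      ultimately show ?thesis using pos \<theta>_pos by simp
    qed
    finally show ?thesis unfolding H_fun_def k(3) .
  qed
  have "ennreal (b * ((d - 1) * \<theta>0) * exp (n * (Psi p (j / n) \<theta>0 - (1 / 2 + a) * ln d))) \<le> H_int p n (n - 1 - j)"
    if j: "j < n" for n j
  proof -
    define e where "e = b * exp (n * (Psi p (j / n) \<theta>0 - (1 / 2 + a) * ln d))"
    have e: "0 \<le> e" using b by (simp add: e_def)
    have "ennreal (e * ((d - 1) * \<theta>0)) = (\<integral>\<^sup>+\<theta>\<in>{\<theta>0..d * \<theta>0}. ennreal e \<partial>lborel)"
      using \<theta>0 d e by (subst nn_integral_cmult_indicator) (auto simp: ennreal_mult left_diff_distrib)
    also have "\<dots> \<le> H_int p n (n - 1 - j)"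
      unfolding H_int_eq[OF j] using bound[OF j] \<theta>0
      by (intro nn_integral_mono) (auto simp: e_def indicator_def intro!: ennreal_leI)
    finally show ?thesis by (simp add: e_def mult_ac)
  qed
  moreover have "0 < b * ((d - 1) * \<theta>0)" using b d \<theta>0 by simp
  ultimately show ?thesis unfolding a_def by blast
qed

lemma H_int_pos:
  assumes "j < n"
  shows "0 < enn2real (H_int p n (n - 1 - j))"
proof -
  obtain c where "c > 0" "ennreal (c * exp (n * (Psi p (j / n) 1 - (1 / 2 + 1 / (2 * p - 2)) * ln 2))) \<le> H_int p n (n - 1 - j)"
    using H_int_lower[of 1 2] assms by auto
  then have "0 < H_int p n (n - 1 - j)" by (intro less_le_trans[OF _ \<open>ennreal _ \<le> _\<close>]) simp
  moreover have "H_int p n (n - 1 - j) < \<infinity>"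
    using H_int_upper assms by (metis ennreal_less_top infinity_ennreal_def le_less_trans)
  ultimately show ?thesis by (simp add: enn2real_positive_iff)
qed

text \<open>Near a fixed \<alpha> one nearly optimal \<theta> serves all j, so that the constants of
  both bounds are independent of n and j and disappear after division by n. Uniformity in j then
  comes from \<open>uniform_of_local\<close>.\<close>

lemma ln_H_int_local:
  assumes \<alpha>: "0 \<le> \<alpha>" "\<alpha> \<le> 1" and \<epsilon>: "0 < \<epsilon>"
  shows "\<exists>\<delta>>0. \<exists>N. \<forall>n\<ge>N. \<forall>j<n. \<bar>j / n - \<alpha>\<bar> < \<delta> \<longrightarrow> \<bar>ln (enn2real (H_int p n (n - 1 - j))) / n - S_fun p (j / n)\<bar> < \<epsilon>"
proof -
  \<comment> \<open>The lower bound spends e five times: on ln c / n, on the loss through d, on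
    moving \<open>Psi\<close> from \<alpha> to j / n, on the choice of \<theta>, and on moving
    \<open>S_fun\<close> back to j / n.\<close>
  define e where "e = \<epsilon> / 5"
  have e: "0 < e" using \<epsilon> by (simp add: e_def)
  obtain d1 where d1: "0 < d1" "\<And>\<beta>. 0 \<le> \<beta> \<Longrightarrow> \<beta> \<le> 1 \<Longrightarrow> \<bar>\<beta> - \<alpha>\<bar> < d1 \<Longrightarrow> \<bar>S_fun p \<beta> - S_fun p \<alpha>\<bar> < e"
    using S_continuous[OF \<alpha> e] by blast
  obtain \<theta> where \<theta>: "0 < \<theta>" "S_fun p \<alpha> - e < Psi p \<alpha> \<theta>" using S_near[OF e] by blast
  define B where "B = \<bar>ln (rmom p 0 \<theta>) - ln (rmom p (p - 2) \<theta>) - ln \<theta> / 2\<bar>"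
  obtain d2 where d2: "0 < d2" "\<And>x. 0 \<le> x \<Longrightarrow> x < d2 \<Longrightarrow> x * B < e"
    using ex_delta_mult_less[of B e] e by (auto simp: B_def)
  define K where "K = 1 / 2 + 1 / (2 * p - 2)"
  have K: "0 < K" using p by (simp add: K_def add_pos_pos)
  \<comment> \<open>Chosen such that the loss K ln d per dimension in \<open>H_int_lower\<close>
    equals e.\<close>
  define d where "d = exp (e / K)"
  have d: "1 < d" "K * ln d = e" using e K by (auto simp: d_def)
  obtain C where C: "C > 0" "\<And>n j. j < n \<Longrightarrow> H_int p n (n - 1 - j) \<le> ennreal (C * exp (n * S_fun p (real (j + 1) / n)))"
    using H_int_upper by blast
  obtain c where c: "c > 0" "\<And>n j. j < n \<Longrightarrow> ennreal (c * exp (n * (Psi p (j / n) \<theta> - e))) \<le> H_int p n (n - 1 - j)"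
    using H_int_lower[OF \<theta>(1) d(1)] unfolding K_def[symmetric] d(2) by blast
  \<comment> \<open>The first term keeps the shifted point (j + 1) / n of the upper bound within d1
    of \<alpha>; the second absorbs the constants c and C.\<close>
  obtain N where N: "2 / d1 + (\<bar>ln C\<bar> + \<bar>ln c\<bar>) / e < real N" using reals_Archimedean2 by blast
  show ?thesis
  proof (intro exI[of _ "min (d1 / 2) d2"] conjI exI[of _ N] allI impI)
    fix n j :: nat assume n: "N \<le> n" and j: "j < n" and near: "\<bar>real j / n - \<alpha>\<bar> < min (d1 / 2) d2"
    have n0: "0 < real n" using j by simp
    have "(\<bar>ln C\<bar> + \<bar>ln c\<bar>) / e \<ge> 0" "2 / d1 \<ge> 0" using e d1 by auto
    then have nbig: "2 / d1 < n" "(\<bar>ln C\<bar> + \<bar>ln c\<bar>) / e < n" using N n by linarith+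
    have "\<bar>ln C\<bar> + \<bar>ln c\<bar> < n * e" using nbig(2) e by (simp add: pos_divide_less_eq)
    then have Cc: "ln C / n < e" "- e < ln c / n"
      using n0 by (auto simp: pos_divide_less_eq pos_less_divide_eq mult.commute)
    have "1 / n < d1 / 2" using nbig(1) d1 n0 by (simp add: field_simps)
    moreover have "real (j + 1) / n = real j / n + 1 / n" by (simp add: add_divide_distrib)
    moreover have "0 < 1 / real n" using n0 by simp
    ultimately have near1: "\<bar>real (j + 1) / n - \<alpha>\<bar> < d1" using near by linarith
    define r where "r = enn2real (H_int p n (n - 1 - j))"
    have "H_int p n (n - 1 - j) < \<infinity>" using C(2)[OF j] by (metis ennreal_less_top infinity_ennreal_def le_less_trans)
    then have r: "H_int p n (n - 1 - j) = ennreal r" by (simp add: r_def)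
    have r_nonneg: "0 \<le> r" by (simp add: r_def)
    have lo: "c * exp (n * (Psi p (j / n) \<theta> - e)) \<le> r" using c(2)[OF j] r_nonneg unfolding r by simp
    have hi: "r \<le> C * exp (n * S_fun p (real (j + 1) / n))" using C(2)[OF j] C(1) unfolding r by simp
    have r_pos: "0 < r" using lo c(1) by (meson exp_gt_zero less_le_trans mult_pos_pos)
    have "ln (c * exp (n * (Psi p (j / n) \<theta> - e))) \<le> ln r" using lo c(1) r_pos by (subst ln_le_cancel_iff) auto
    then have "ln c + n * (Psi p (j / n) \<theta> - e) \<le> ln r" using c(1) by (simp add: ln_mult)
    then have "(ln c + n * (Psi p (j / n) \<theta> - e)) / n \<le> ln r / n" using n0 by (intro divide_right_mono) auto
    then have lo': "ln c / n + (Psi p (j / n) \<theta> - e) \<le> ln r / n" using n0 by (simp add: add_divide_distrib)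
    have "ln r \<le> ln (C * exp (n * S_fun p (real (j + 1) / n)))" using hi C(1) r_pos by (subst ln_le_cancel_iff) auto
    then have "ln r \<le> ln C + n * S_fun p (real (j + 1) / n)" using C(1) by (simp add: ln_mult)
    then have "ln r / n \<le> (ln C + n * S_fun p (real (j + 1) / n)) / n" using n0 by (intro divide_right_mono) auto
    then have hi': "ln r / n \<le> ln C / n + S_fun p (real (j + 1) / n)" using n0 by (simp add: add_divide_distrib)
    have "\<bar>S_fun p (real (j + 1) / n) - S_fun p \<alpha>\<bar> < e" using j near1 by (intro d1(2)) auto
    moreover have "\<bar>S_fun p (j / n) - S_fun p \<alpha>\<bar> < e" using j near d1(1) by (intro d1(2)) auto
    moreover have "\<bar>Psi p (j / n) \<theta> - Psi p \<alpha> \<theta>\<bar> < e"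
      using Psi_diff_le[of "j / n" \<theta> \<alpha>] d2(2)[of "\<bar>real j / n - \<alpha>\<bar>"] near unfolding B_def by simp
    ultimately show "\<bar>ln (enn2real (H_int p n (n - 1 - j))) / n - S_fun p (j / n)\<bar> < \<epsilon>"
      unfolding r_def[symmetric] using lo' hi' Cc \<theta>(2) unfolding e_def by linarith
  qed (use d1 d2 in auto)
qed

lemma ln_H_int_uniform:
  assumes "0 < \<epsilon>"
  shows "\<exists>N. \<forall>n\<ge>N. \<forall>j<n. \<bar>ln (enn2real (H_int p n (n - 1 - j))) / n - S_fun p (j / n)\<bar> < \<epsilon>"
  using ln_H_int_local assms by (intro uniform_of_local) auto

section \<open>Stirling's formula and the uniform limit\<close>

lemma kappa_fun_eq:
  assumes n: "0 < n" and j: "j \<le> n"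
  shows "n * kappa_fun p (j / n) = j / p * ln n - (j / p * ln (j / p) - j / p) + real (n - j) * ln (p - 1) +
    (n * ln n - j * ln j - real (n - j) * ln (real (n - j))) - real (n - j) / 2 * ln pi"
proof -
  define k where "k = real n - real j"
  have k: "real (n - j) = k" "0 \<le> k" "real n = j + k" using j by (auto simp: k_def)
  have n0: "0 < real n" using n by simp
  \<comment> \<open>The case distinctions here and below isolate j = 0 and j = n, where the terms
    vanish by multiplication with 0 and the logarithm of a quotient cannot be split.\<close>
  have 1: "n * (j / n / p * (1 - ln (j / n / p))) = j / p * ln n - (j / p * ln (j / p) - j / p)"
    using n0 p by (cases "j = 0") (auto simp: ln_div ln_mult field_simps)
  have 2: "n * (real j / n * ln (j / n)) = j * ln j - j * ln n"
    using n0 by (cases "j = 0") (auto simp: ln_div field_simps)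
  have a: "1 - j / n = k / n" using n0 by (simp add: k_def field_simps)
  have 3: "n * (k / n * ln (k / n)) = k * ln k - k * ln n"
    using n0 k by (cases "k = 0") (auto simp: ln_div field_simps)
  have "n * kappa_fun p (j / n) = n * (j / n / p * (1 - ln (j / n / p))) + n * (k / n) * ln (p - 1) -
      n * (real j / n * ln (j / n)) - n * (k / n * ln (k / n)) - n * (k / n) / 2 * ln pi"
    unfolding kappa_fun_def a by (simp add: algebra_simps)
  also have "n * (k / n) = k" using n0 by simp
  finally show ?thesis unfolding 1 2 3 k(1) using k(3) by (simp add: algebra_simps)
qed

text \<open>By \<open>S_1\<close> the moment factor of the volume is exactly n times
  \<open>S_fun\<close> at 1, so the only error is that of one Gamma function.\<close>

lemma ln_intrinsic_volume_top:
  assumes n: "0 < n"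
  shows "ln (intrinsic_volume n (scaled_lp_ball p n) n) = n * (kappa_fun p (n / n) + S_fun p (n / n)) - stirling_err (n / p)"
proof -
  define V where "V = intrinsic_volume n (scaled_lp_ball p n) n"
  have G: "0 < Gamma (n / p + 1)" using p by (intro Gamma_real_pos add_nonneg_pos) auto
  have I: "0 < rmom p 0 0" by (rule IJM_pos) simp
  have "ennreal (V * Gamma (n / p + 1)) = ennreal (n powr (n / p) * rmom p 0 0 ^ n)"
    using intrinsic_volume_top(2)[OF n] I moment_rmom[of 0 0]
    by (simp add: V_def ennreal_power less_imp_le flip: ennreal_mult)
  then have eq: "V * Gamma (n / p + 1) = n powr (n / p) * rmom p 0 0 ^ n"
    using intrinsic_volume_top(1)[OF n] G I by (subst (asm) ennreal_inj) (auto simp: V_def)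
  then have "0 < V * Gamma (n / p + 1)" using I n by simp
  then have V: "0 < V" using G by (simp add: zero_less_mult_iff)
  have "ln V + ln (Gamma (n / p + 1)) = ln (V * Gamma (n / p + 1))" using V G by (simp add: ln_mult)
  also have "\<dots> = n / p * ln n + n * ln (rmom p 0 0)"
    unfolding eq using n I by (simp add: ln_mult ln_powr ln_realpow)
  finally have "ln V = n / p * ln n + n * ln (rmom p 0 0) - ln (Gamma (n / p + 1))" by simp
  moreover have "real n / real n = 1" using n by simp
  then have "n * S_fun p (n / n) = n * ln (rmom p 0 0)" by (simp only: S_1)
  moreover have "n * kappa_fun p (n / n) = n / p * ln n - (n / p * ln (n / p) - n / p)"
    using kappa_fun_eq[OF n order_refl] by simp
  ultimately show ?thesis
    unfolding V_def[symmetric] distrib_left stirling_err_def by linarith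
qed

text \<open>An exact identity. \<open>kappa_fun\<close> collects the leading Stirling terms of the
  Gamma factor and the binomial coefficient together with the elementary powers
  (\<open>kappa_fun_eq\<close>); the terms of at most logarithmic size stay visible.\<close>

lemma ln_intrinsic_volume_lower:
  assumes j: "j < n" and H: "0 < enn2real (H_int p n (n - 1 - j))"
  shows "ln (intrinsic_volume n (scaled_lp_ball p n) j) =
    n * kappa_fun p (j / n) + ln (enn2real (H_int p n (n - 1 - j))) + ln (p / 2) - ln (p - 1) + ln (n - j) +
    stirling_err n - stirling_err j - stirling_err (real (n - j)) - stirling_err (j / p)"
proof -
  define V where "V = intrinsic_volume n (scaled_lp_ball p n) j"
  define r where "r = enn2real (H_int p n (n - 1 - j))"
  define k where "k = n - j"
  have k: "0 < k" "n - 1 - j = k - 1" "real n = real j + real k" using j by (auto simp: k_def)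
  have n: "0 < n" using j by simp
  have r: "H_int p n (n - 1 - j) = ennreal r" "0 < r"
    using H by (auto simp: r_def enn2real_positive_iff)
  have G: "0 < Gamma (real i / p + 1)" "0 < Gamma (real i / 2 + 1)" "0 < Gamma (real i + 1)" for i
    using p by (auto intro!: Gamma_real_pos add_nonneg_pos)
  \<comment> \<open>The Gamma factor of the Gaussian average cancels the one in the volume of the
    unit ball and leaves the power of pi in \<open>kappa_fun\<close>.\<close>
  have kap: "kappa k * Gamma (real k / 2 + 1) = pi powr (real k / 2)"
    using less_imp_neq[OF G(2)[of k]] by (simp add: kappa_eq_unit_ball_vol unit_ball_vol_def)
  have V0: "0 \<le> V" unfolding V_def by (rule intrinsic_volume_lower(1)[OF j])
  have "ennreal (V * kappa k * Gamma (j / p + 1) * Gamma (real k / 2 + 1)) =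
      ennreal (n powr (j / p) * (p * n * ((n - 1) choose j) * (p - 1) ^ (k - 1) / 2) * r)"
    using intrinsic_volume_lower(2)[OF j] r p unfolding V_def[symmetric] k_def[symmetric] k(2)
    by (simp flip: ennreal_mult)
  then have "V * kappa k * Gamma (j / p + 1) * Gamma (real k / 2 + 1) =
      n powr (j / p) * (p * n * ((n - 1) choose j) * (p - 1) ^ (k - 1) / 2) * r"
  proof (subst (asm) ennreal_inj)
    show "0 \<le> V * kappa k * Gamma (j / p + 1) * Gamma (real k / 2 + 1)"
      by (intro mult_nonneg_nonneg V0 less_imp_le[OF G(1)] less_imp_le[OF G(2)] less_imp_le[OF kappa_pos])
  qed (use r p in auto)
  \<comment> \<open>Absorption passes from n - 1 to n in the binomial coefficient and creates the
    term ln (n - j); completing the power of p - 1 in the next line creates - ln (p - 1).\<close>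
  moreover have "real n * ((n - 1) choose j) = real k * (n choose j)"
    using binomial_absorb_comp[of n j] unfolding k_def of_nat_mult[symmetric] by simp
  moreover have "(p - 1) ^ k = (p - 1) ^ (k - 1) * (p - 1)" using k(1) by (cases k) auto
  ultimately have eq: "V * (pi powr (real k / 2) * Gamma (j / p + 1)) * (p - 1) =
      n powr (j / p) * (p / 2) * (real k * (n choose j)) * (p - 1) ^ k * r"
    unfolding kap[symmetric] by (simp add: mult_ac)
  have choose: "0 < real (n choose j)" using j by simp
  have "0 < V * (pi powr (real k / 2) * Gamma (j / p + 1)) * (p - 1)"
    unfolding eq using n p k choose r by simp
  then have V: "0 < V" using V0 by (cases "V = 0") auto
  have "ln V + (real k / 2 * ln pi + ln (Gamma (j / p + 1))) + ln (p - 1) =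
      ln (V * (pi powr (real k / 2) * Gamma (j / p + 1)) * (p - 1))"
    using V G(1)[of j] p by (simp add: ln_mult ln_powr)
  also have "\<dots> = j / p * ln n + ln (p / 2) + (ln k + ln (n choose j)) + k * ln (p - 1) + ln r"
  proof -
    have "ln (a * b * (c * d) * e * f) = ln a + ln b + (ln c + ln d) + ln e + ln f"
      if "0 < a" "0 < b" "0 < c" "0 < d" "0 < e" "0 < f" for a b c d e f :: real
      using that by (simp add: ln_mult)
    from this[of "n powr (j / p)" "p / 2" k "n choose j" "(p - 1) ^ k" r] show ?thesis
      unfolding eq using n p k(1) choose r(2) by (simp add: ln_powr ln_realpow)
  qed
  finally have lnV: "ln V = j / p * ln n + ln (p / 2) + (ln k + ln (n choose j)) + k * ln (p - 1) + ln r -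
    (real k / 2 * ln pi + ln (Gamma (j / p + 1))) - ln (p - 1)" by simp
  have "real (n choose j) = Gamma (real n + 1) / (Gamma (real j + 1) * Gamma (real k + 1))"
    using j by (simp add: binomial_fact k_def Gamma_fact[symmetric] add.commute)
  then have "ln (n choose j) = ln (Gamma (real n + 1)) - ln (Gamma (real j + 1)) - ln (Gamma (real k + 1))"
  proof -
    have "ln (a / (b * c)) = ln a - ln b - ln c" if "0 < a" "0 < b" "0 < c" for a b c :: real
      using that by (simp add: ln_div ln_mult)
    from this[OF G(3)[of n] G(3)[of j] G(3)[of k]] show ?thesis
      unfolding \<open>real (n choose j) = _\<close> .
  qed
  then have lnC: "ln (n choose j) = stirling_err n - stirling_err j - stirling_err k + n * ln n - j * ln j - k * ln k"
    using k(3) by (simp add: stirling_err_def)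
  have kf: "n * kappa_fun p (j / n) = j / p * ln n - (j / p * ln (j / p) - j / p) + k * ln (p - 1) +
    (n * ln n - j * ln j - k * ln k) - k / 2 * ln pi"
    using kappa_fun_eq[OF n less_imp_le[OF j]] unfolding k_def .
  have "ln (real n - real j) = ln k" using k(3) by simp
  then show ?thesis
    unfolding V_def[symmetric] r_def[symmetric] k_def[symmetric] lnV lnC kf by (simp add: stirling_err_def)
qed

lemma ln_intrinsic_volume_uniform:
  assumes \<epsilon>: "0 < \<epsilon>"
  shows "\<exists>N. \<forall>n\<ge>N. \<forall>j\<le>n. \<bar>1 / n * ln (intrinsic_volume n (scaled_lp_ball p n) j) - g_fun p (j / n)\<bar> < \<epsilon>"
proof -
  \<comment> \<open>The 8 makes up for the step from 4 L to 4 ln n, since L \<le> ln n + 2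
    below.\<close>
  define c where "c = \<bar>ln (p / 2)\<bar> + \<bar>ln (p - 1)\<bar> + 8"
  obtain N1 where N1: "\<And>n j. N1 \<le> n \<Longrightarrow> j < n \<Longrightarrow> \<bar>ln (enn2real (H_int p n (n - 1 - j))) / n - S_fun p (j / n)\<bar> < \<epsilon> / 2"
    using ln_H_int_uniform[of "\<epsilon> / 2"] \<epsilon> by auto
  have "\<forall>\<^sub>F n in sequentially. (c + 4 * ln (real n)) / real n < \<epsilon> / 2"
    using \<epsilon> by (intro order_tendstoD(2)[OF ln_over_n_const_tendsto]) auto
  then obtain N2 where N2: "\<And>n. N2 \<le> n \<Longrightarrow> (c + 4 * ln (real n)) / real n < \<epsilon> / 2"
    by (auto simp: eventually_sequentially)
  show ?thesis
  proof (intro exI[of _ "max 1 (max N1 N2)"] allI impI)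
    fix n j :: nat assume n: "max 1 (max N1 N2) \<le> n" and j: "j \<le> n"
    have n0: "0 < n" "0 < real n" using n by auto
    define V where "V = ln (intrinsic_volume n (scaled_lp_ball p n) j)"
    define D where "D = V - n * kappa_fun p (j / n)"
    define s where "s = stirling_err"
    define L where "L = ln (real n + 1) + 1"
    have s: "0 \<le> s x" "s x \<le> L" if "0 \<le> x" "x \<le> n" for x :: real
      using stirling_err_bounds[OF that] by (auto simp: s_def L_def)
    have "real j * 1 \<le> real n * p" using j p by (intro mult_mono) auto
    then have jp: "real j / p \<le> n" using p by (simp add: divide_le_eq)
    have "ln (real n + 1) \<le> ln (real n) + 1"
    proof -
      have "ln ((real n + 1) / real n) \<le> (real n + 1) / real n - 1" using n0 by (intro ln_le_minus_one) auto
      also have "\<dots> \<le> 1" using n0 by (simp add: field_simps)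
      finally show ?thesis using n0 by (simp add: ln_div)
    qed
    then have L: "L \<le> ln (real n) + 2" by (simp add: L_def)
    have g: "g_fun p (j / n) = kappa_fun p (j / n) + S_fun p (j / n)"
      by (simp add: g_fun_def S_fun_def)
    \<comment> \<open>The quantity h is n \<open>S_fun\<close> for j = n and the logarithm of the
      coefficient integral otherwise; what separates it from D is a constant plus logarithms and
      Stirling errors.\<close>
    have "\<exists>h. \<bar>h / n - S_fun p (j / n)\<bar> < \<epsilon> / 2 \<and> \<bar>D - h\<bar> \<le> c - 8 + 4 * L"
    proof (cases "j = n")
      case True
      have "D - n * S_fun p (j / n) = - s (j / p)"
        using ln_intrinsic_volume_top[OF n0(1)] True by (simp add: D_def V_def s_def distrib_left)
      moreover have "0 \<le> s (j / p)" "s (j / p) \<le> L" using s[of "j / p"] jp p by auto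
      moreover have "0 \<le> c - 8" by (simp add: c_def)
      ultimately have "\<bar>D - n * S_fun p (j / n)\<bar> \<le> c - 8 + 4 * L" by linarith
      then show ?thesis using \<epsilon> n0 by (intro exI[of _ "n * S_fun p (j / n)"]) simp
    next
      case False
      then have j: "j < n" using j by simp
      define r where "r = enn2real (H_int p n (n - 1 - j))"
      have hn: "\<bar>ln r / n - S_fun p (j / n)\<bar> < \<epsilon> / 2" using N1[of n j] n j by (simp add: r_def)
      have r: "0 < r" unfolding r_def by (rule H_int_pos[OF j])
      have "D - ln r = ln (p / 2) - ln (p - 1) + ln (real (n - j)) +
          s n - s j - s (real (n - j)) - s (j / p)"
        using ln_intrinsic_volume_lower[OF j] r unfolding D_def V_def r_def[symmetric] s_def using j by simp
      moreover have "0 \<le> s n" "s n \<le> L" "0 \<le> s j" "s j \<le> L" "0 \<le> s (real (n - j))" "s (real (n - j)) \<le> L"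
        "0 \<le> s (j / p)" "s (j / p) \<le> L"
        using s[of n] s[of j] s[of "real (n - j)"] s[of "j / p"] jp p j by auto
      moreover have "0 \<le> ln (real (n - j))" using j by (intro ln_ge_zero) linarith
      moreover have "ln (real (n - j)) \<le> L"
      proof -
        have "ln (real (n - j)) \<le> ln (real n + 1)" using j by (subst ln_le_cancel_iff) auto
        then show ?thesis by (simp add: L_def)
      qed
      ultimately have "\<bar>D - ln r\<bar> \<le> c - 8 + 4 * L" unfolding c_def by linarith
      then show ?thesis using hn by blast
    qed
    then obtain h where h: "\<bar>h / n - S_fun p (j / n)\<bar> < \<epsilon> / 2" "\<bar>D - h\<bar> \<le> c - 8 + 4 * L"
      by blast
    have "\<bar>D - h\<bar> / n \<le> (c + 4 * ln (real n)) / n"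
      using h(2) L n0 by (intro divide_right_mono) auto
    also have "\<dots> < \<epsilon> / 2" using N2 n by simp
    also have "\<bar>D - h\<bar> / n = \<bar>(D - h) / n\<bar>" using n0 by simp
    also have "(D - h) / n = V / n - kappa_fun p (j / n) - h / n"
      using n0 by (simp add: D_def diff_divide_distrib)
    finally have "\<bar>V / n - kappa_fun p (j / n) - h / n\<bar> < \<epsilon> / 2" .
    then have "\<bar>V / n - g_fun p (j / n)\<bar> < \<epsilon>" unfolding g using h(1) by linarith
    then show "\<bar>1 / n * ln (intrinsic_volume n (scaled_lp_ball p n) j) - g_fun p (j / n)\<bar> < \<epsilon>"
      by (simp add: V_def)
  qed
qed

end

theorem theorem2p17:
  fixes p :: real
  assumes "1 < p"
  shows "(\<lambda>n. SUP j\<in>{0..n}.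
            \<bar>1 / real n * ln (intrinsic_volume n (scaled_lp_ball p n) j)
              - g_fun p (real j / real n)\<bar>) \<longlonglongrightarrow> 0"
proof (rule LIMSEQ_I)
  fix \<epsilon> :: real assume \<epsilon>: "0 < \<epsilon>"
  define f where "f n j = \<bar>1 / real n * ln (intrinsic_volume n (scaled_lp_ball p n) j) - g_fun p (real j / real n)\<bar>" for n j
  \<comment> \<open>Half of \<epsilon>, because passing to the supremum weakens the strict
    inequality.\<close>
  obtain N where N: "\<And>n j. N \<le> n \<Longrightarrow> j \<le> n \<Longrightarrow> f n j < \<epsilon> / 2"
    using ln_intrinsic_volume_uniform[OF assms, of "\<epsilon> / 2"] \<epsilon> unfolding f_def by auto
  have "norm ((SUP j\<in>{0..n}. f n j) - 0) < \<epsilon>" if n: "N \<le> n" for n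
  proof -
    have "(SUP j\<in>{0..n}. f n j) \<le> \<epsilon> / 2"
      using N[OF n] by (intro cSUP_least) (auto intro: less_imp_le)
    moreover have "f n 0 \<le> (SUP j\<in>{0..n}. f n j)" by (intro cSUP_upper bdd_above_finite) auto
    moreover have "0 \<le> f n 0" by (simp add: f_def)
    ultimately show ?thesis using \<epsilon> by simp
  qed
  then show "\<exists>N. \<forall>n\<ge>N. norm ((SUP j\<in>{0..n}. \<bar>1 / real n * ln (intrinsic_volume n (scaled_lp_ball p n) j)
      - g_fun p (real j / real n)\<bar>) - 0) < \<epsilon>"
    unfolding f_def by blast
qed

end
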